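(* Let $d\geq 1$. There is a constant $C_d$ depending only on $d$ such that for every positive integer $n$ and every sum-free set $S\subseteq \{0,1,\ldots,n\}^d$ we have $|S|\leq c_d^* n^d + C_d n^{d-1}$.
   Context: A subset $S$ of $\mathbb{Z}^d$ is sum-free if there are no $x,y,z\in S$ (not necessarily distinct) with $x+y=z$. For $u\in[0,d]$ let $S_d(u)=\{x\in[0,1]^d : u\leq \sum_i x_i<2u\}$. Let $u_d^*$ be the value of $u\in[0,d]$ maximizing the volume $\mathrm{Vol}(S_d(u))$, and let $c_d^*=\mathrm{Vol}(S_d(u_d^* ))$ be this maximum volume. *)

theory Defs
  imports "HOL-Analysis.Analysis"
begin

definition sum_free :: "'a::plus set \<Rightarrow> bool" where
  "sum_free S \<longleftrightarrow> \<not> (\<exists>x\<in>S. \<exists>y\<in>S. \<exists>z\<in>S. x + y = z)"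

text \<open>The dimension \<open>d\<close> is the cardinality of the index type \<open>'d\<close>.\<close>

definition slab :: "real \<Rightarrow> (real ^ 'd) set" where
  "slab u = {x. (\<forall>i. 0 \<le> x $ i \<and> x $ i \<le> 1) \<and> u \<le> (\<Sum>i\<in>UNIV. x $ i) \<and> (\<Sum>i\<in>UNIV. x $ i) < 2 * u}"

definition slab_vol :: "'d::finite itself \<Rightarrow> real \<Rightarrow> real" where
  "slab_vol _ u = measure lborel (slab u :: (real ^ 'd) set)"

text \<open>A maximizer exists because \<open>slab_vol\<close> is continuous on the compact interval \<open>[0, d]\<close>.
  The operator \<open>arg_max_on\<close> picks one, and \<open>c_star\<close> does not depend on which.\<close>

definition u_star :: "'d::finite itself \<Rightarrow> real" where
  "u_star D = arg_max_on (slab_vol D) {0..real CARD('d)}"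

definition c_star :: "'d::finite itself \<Rightarrow> real" where
  "c_star D = slab_vol D (u_star D)"

end

theory Submission
  imports Defs
begin

text \<open>
  Let \<open>m = n + 1\<close>, let \<open>W\<close> count the points of \<open>{0..n}\<^sup>d\<close> by coordinate sum and \<open>N\<close> those of
  \<open>{0..n}\<close> to the power \<open>d - 1\<close>. It suffices to find \<open>u\<close> with
  \<open>|S| \<le> \<Sum>k\<in>{u..2u-1}. W k + O(m\<^sup>d\<^sup>-\<^sup>1)\<close>: comparing lattice points with unit cubes bounds
  the sum by \<open>m\<^sup>d\<close> times the volume of a slab.

  Fibre \<open>S\<close> over all coordinates but one. If \<open>p + q = r\<close>, the fibres over \<open>p\<close>, \<open>q\<close>, \<open>r\<close> have total
  size at most \<open>2m\<close>, since \<open>a + b = c\<close> is forbidden. To average this over coordinate sums one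
  needs a random triple \<open>(p, q, p + q)\<close> whose three entries are uniform on prescribed levels. For
  one coordinate such a coupling comes from the invariant vector in a tensor product of three
  irreducible representations of \<open>sl\<^sub>2\<close>; averaging repeatedly over pairs of coordinates flattens
  functions on a level and so extends this to several coordinates. A weighted sum of the resulting
  inequalities over pairs of levels gives the bound when the counts satisfy three inequalities at
  \<open>u\<close>. In the limit these are inequalities between values of cardinal B-splines; they follow from
  log-concavity and a cubic ratio bound for \<open>d > 40\<close> and by computation otherwise.
  The dimensions 1 and 2 are treated separately.
\<close>

section \<open>Couplings from invariants of sl2\<close>

text \<open>The base levels then fall into three kinds. The columns over a middle level lie inside
  the slab. The columns over levels near \<open>u\<close> and near \<open>2 * u\<close> cross its
  boundary; they are controlled together by one inequality for the levels \<open>u\<close>,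
  \<open>u\<close>, \<open>2 * u\<close> of the full box, applied to the fibre size regarded as a
  function that ignores the fibre coordinate. Every remaining level lies outside the slab, and
  points over it force the fibres over certain middle levels to fall short of \<open>m\<close>. The
  bound follows if the middle levels are populous enough for this loss to outweigh the gain, which
  is what the conditions comparing values of \<open>N\<close> express.\<close>

text \<open>These are the coefficient arrays of nonzero invariants in the product of the symmetric
  powers \<open>Sym^p\<close>, \<open>Sym^q\<close>, \<open>Sym^r\<close>, in the monomials
  \<open>a^x b^(p-x)\<close>: weight zero, and killed by \<open>a d/db\<close> and by
  \<open>b d/da\<close>. Integer indices let shifts run off the support, where the array is 0,
  without boundary cases.\<close>

definition sl2_invariant :: "nat \<Rightarrow> nat \<Rightarrow> nat \<Rightarrow> (int \<Rightarrow> int \<Rightarrow> int \<Rightarrow> real) \<Rightarrow> bool" where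
  "sl2_invariant p q r k \<longleftrightarrow>
     (\<forall>x y w. k x y w \<noteq> 0 \<longrightarrow> x \<in> {0..int p} \<and> y \<in> {0..int q} \<and> w \<in> {0..int r}
        \<and> 2 * (x + y + w) = int (p + q + r)) \<and>
     (\<exists>x y w. k x y w \<noteq> 0) \<and>
     (\<forall>x y w. (of_int (int p - x) + 1) * k (x - 1) y w + (of_int (int q - y) + 1) * k x (y - 1) w
        + (of_int (int r - w) + 1) * k x y (w - 1) = 0) \<and>
     (\<forall>x y w. (of_int x + 1) * k (x + 1) y w + (of_int y + 1) * k x (y + 1) w
        + (of_int w + 1) * k x y (w + 1) = 0)"

lemma sl2_invariantI:
  assumes "\<And>x y w. k x y w \<noteq> 0 \<Longrightarrow> x \<in> {0..int p} \<and> y \<in> {0..int q} \<and> w \<in> {0..int r}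
        \<and> 2 * (x + y + w) = int (p + q + r)"
    and "\<exists>x y w. k x y w \<noteq> 0"
    and "\<And>x y w. (of_int (int p - x) + 1) * k (x - 1) y w + (of_int (int q - y) + 1) * k x (y - 1) w
        + (of_int (int r - w) + 1) * k x y (w - 1) = 0"
    and "\<And>x y w. (of_int x + 1) * k (x + 1) y w + (of_int y + 1) * k x (y + 1) w
        + (of_int w + 1) * k x y (w + 1) = 0"
  shows "sl2_invariant p q r k"
  using assms unfolding sl2_invariant_def by blast

lemma sl2_invariantD:
  assumes "sl2_invariant p q r k"
  shows "k x y w \<noteq> 0 \<Longrightarrow> x \<in> {0..int p} \<and> y \<in> {0..int q} \<and> w \<in> {0..int r}
        \<and> 2 * (x + y + w) = int (p + q + r)"
    and "\<exists>x y w. k x y w \<noteq> 0"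
    and "(of_int (int p - x) + 1) * k (x - 1) y w + (of_int (int q - y) + 1) * k x (y - 1) w
        + (of_int (int r - w) + 1) * k x y (w - 1) = 0"
    and "(of_int x + 1) * k (x + 1) y w + (of_int y + 1) * k x (y + 1) w
        + (of_int w + 1) * k x y (w + 1) = 0"
  using assms unfolding sl2_invariant_def by blast+

lemma sl2_invariant_swap:
  assumes "sl2_invariant p q r k" shows "sl2_invariant q p r (\<lambda>x y w. k y x w)"
proof (rule sl2_invariantI, goal_cases)
  case (1 x y w) then show ?case using sl2_invariantD(1)[OF assms, of y x w] by auto
next
  case 2 then show ?case using sl2_invariantD(2)[OF assms] by blast
next
  case (3 x y w) then show ?case using sl2_invariantD(3)[OF assms, of y x w] by (simp add: add.commute)
next
  case (4 x y w) then show ?case using sl2_invariantD(4)[OF assms, of y x w] by (simp add: add.commute)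
qed

lemma sl2_invariant_rotate:
  assumes "sl2_invariant p q r k" shows "sl2_invariant r p q (\<lambda>w x y. k x y w)"
proof (rule sl2_invariantI, goal_cases)
  case (1 w x y) then show ?case using sl2_invariantD(1)[OF assms, of x y w] by auto
next
  case 2 then show ?case using sl2_invariantD(2)[OF assms] by blast
next
  case (3 w x y) then show ?case using sl2_invariantD(3)[OF assms, of x y w] by (simp add: algebra_simps)
next
  case (4 w x y) then show ?case using sl2_invariantD(4)[OF assms, of x y w] by (simp add: algebra_simps)
qed

text \<open>Multiplication by the bracket \<open>a1 b2 - b1 a2\<close> of the first two pairs of
  variables, which is itself invariant.\<close>

lemma sl2_invariant_bracket:
  assumes k: "sl2_invariant p q r k"
  shows "sl2_invariant (Suc p) (Suc q) r (\<lambda>x y w. k (x - 1) y w - k x (y - 1) w)"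
proof (rule sl2_invariantI, goal_cases)
  case (1 x y w)
  then have "k (x - 1) y w \<noteq> 0 \<or> k x (y - 1) w \<noteq> 0" by auto
  then show ?case
    using sl2_invariantD(1)[OF k, of "x - 1" y w] sl2_invariantD(1)[OF k, of x "y - 1" w] by auto
next
  case 2
  show ?case
  proof (rule ccontr)
    assume "\<not> ?thesis"
    \<comment> \<open>If the product vanished, the array would be constant along
      \<open>(x + 1, y - 1)\<close>, and a nonzero entry would be carried out of the finite
      support.\<close>
    then have eq: "k (x - 1) y w = k x (y - 1) w" for x y w by auto
    obtain x y w where nz: "k x y w \<noteq> 0" using sl2_invariantD(2)[OF k] by blast
    have "k (x + int j) (y - int j) w \<noteq> 0" for j
    proof (induction j)
      case (Suc j)
      then show ?case using eq[of "x + int (Suc j)" "y - int j" w] by (simp add: algebra_simps)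
    qed (use nz in simp)
    from this[of "Suc p"] sl2_invariantD(1)[OF k, of "x + int (Suc p)" "y - int (Suc p)" w]
      sl2_invariantD(1)[OF k nz] show False by auto
  qed
next
  case (3 x y w)
  have "(of_int (int (Suc p) - x) + 1) * (k (x - 1 - 1) y w - k (x - 1) (y - 1) w)
      + (of_int (int (Suc q) - y) + 1) * (k (x - 1) (y - 1) w - k x (y - 1 - 1) w)
      + (of_int (int r - w) + 1) * (k (x - 1) y (w - 1) - k x (y - 1) (w - 1))
    = ((of_int (int p - (x - 1)) + 1) * k (x - 1 - 1) y w + (of_int (int q - y) + 1) * k (x - 1) (y - 1) w
        + (of_int (int r - w) + 1) * k (x - 1) y (w - 1))
    - ((of_int (int p - x) + 1) * k (x - 1) (y - 1) w + (of_int (int q - (y - 1)) + 1) * k x (y - 1 - 1) w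
        + (of_int (int r - w) + 1) * k x (y - 1) (w - 1))"
    by (simp add: algebra_simps)
  then show ?case using sl2_invariantD(3)[OF k, of "x - 1" y w] sl2_invariantD(3)[OF k, of x "y - 1" w] by simp
next
  case (4 x y w)
  have "(of_int x + 1) * (k (x + 1 - 1) y w - k (x + 1) (y - 1) w)
      + (of_int y + 1) * (k (x - 1) (y + 1) w - k x (y + 1 - 1) w)
      + (of_int w + 1) * (k (x - 1) y (w + 1) - k x (y - 1) (w + 1))
    = ((of_int (x - 1) + 1) * k (x - 1 + 1) y w + (of_int y + 1) * k (x - 1) (y + 1) w
        + (of_int w + 1) * k (x - 1) y (w + 1))
    - ((of_int x + 1) * k (x + 1) (y - 1) w + (of_int (y - 1) + 1) * k x (y - 1 + 1) w
        + (of_int w + 1) * k x (y - 1) (w + 1))"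
    by (simp add: algebra_simps)
  then show ?case using sl2_invariantD(4)[OF k, of "x - 1" y w] sl2_invariantD(4)[OF k, of x "y - 1" w] by simp
qed

text \<open>The invariant is the product of brackets \<open>[12]^a [13]^b [23]^c\<close>. Three
  degrees have this form exactly when their sum is even and they satisfy the triangle
  inequalities.\<close>

lemma sl2_invariant_exists: "\<exists>k. sl2_invariant (a + b) (a + c) (b + c) k"
proof -
  have "\<exists>k. sl2_invariant a a 0 k"
  proof (induction a)
    case 0
    show ?case
      by (rule exI[of _ "\<lambda>x y w. if x = 0 \<and> y = 0 \<and> w = 0 then 1 else 0"])
        (auto simp: sl2_invariant_def)
  next
    case (Suc a)
    then show ?case using sl2_invariant_bracket by blast
  qed
  then have "\<exists>k. sl2_invariant (a + b) a b k"
  proof (induction b)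
    case (Suc b)
    then obtain k where "sl2_invariant (a + b) a b k" by blast
    note sl2_invariant_bracket[OF sl2_invariant_rotate[OF this]]
    from sl2_invariant_rotate[OF sl2_invariant_rotate[OF this]]
    show ?case unfolding add_Suc_right by blast
  qed simp
  then show ?thesis
  proof (induction c)
    case (Suc c)
    then obtain k where "sl2_invariant (a + b) (a + c) (b + c) k" by blast
    note sl2_invariant_bracket[OF sl2_invariant_rotate[OF sl2_invariant_rotate[OF this]]]
    from sl2_invariant_rotate[OF this] show ?case unfolding add_Suc_right by blast
  qed simp
qed

section \<open>Invariant norms and uniform marginals\<close>

text \<open>Up to a constant factor, the squared length of \<open>a^x b^(p-x)\<close> for the
  SU(2)-invariant inner product.\<close>

definition monomial_norm :: "nat \<Rightarrow> int \<Rightarrow> real" where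
  "monomial_norm p x = fact (nat x) * fact (nat (int p - x))"

lemma monomial_norm_pos: "monomial_norm p x > 0"
  by (simp add: monomial_norm_def)

lemma monomial_norm_Suc:
  assumes "0 \<le> x" "x < int p"
  shows "of_int (int p - x) * monomial_norm p (x + 1) = (of_int x + 1) * monomial_norm p x"
proof -
  have "nat (int p - x) = Suc (nat (int p - (x + 1)))" "nat (x + 1) = Suc (nat x)" using assms by auto
  moreover have "real (Suc (nat (int p - (x + 1)))) = of_int (int p - x)" "real (Suc (nat x)) = of_int x + 1"
    using assms by auto
  ultimately show ?thesis unfolding monomial_norm_def fact_Suc by (simp only: of_nat_mult) (simp add: mult_ac)
qed

text \<open>Adjointness in one tensor factor, as a summation by parts. \<open>G\<close> stands for
  the product of two arrays, one of them shifted, and the two vanishing conditions remove the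
  boundary terms.\<close>

lemma sum_shift_monomial_norm:
  assumes "G (-1) = 0" "G (int q) = 0"
  shows "(\<Sum>y\<in>{0..int q}. (of_int (int q - y) + 1) * G (y - 1) * monomial_norm q y)
       = (\<Sum>y\<in>{0..int q}. (of_int y + 1) * G y * monomial_norm q y)"
proof -
  have "(\<Sum>y\<in>{0..int q}. (of_int (int q - y) + 1) * G (y - 1) * monomial_norm q y)
      = (\<Sum>y\<in>{1..int q}. (of_int (int q - y) + 1) * G (y - 1) * monomial_norm q y)"
  proof (intro sum.mono_neutral_right ballI)
    fix y assume "y \<in> {0..int q} - {1..int q}"
    then have "y = 0" by auto
    then show "(of_int (int q - y) + 1) * G (y - 1) * monomial_norm q y = 0" using assms by simp
  qed auto
  also have "\<dots> = (\<Sum>y\<in>{0..<int q}. of_int (int q - y) * G y * monomial_norm q (y + 1))"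
    by (rule sum.reindex_bij_witness[of _ "\<lambda>y. y + 1" "\<lambda>y. y - 1"]) auto
  also have "\<dots> = (\<Sum>y\<in>{0..<int q}. (of_int y + 1) * G y * monomial_norm q y)"
  proof (rule sum.cong[OF refl])
    fix y assume "y \<in> {0..<int q}"
    then have "of_int (int q - y) * monomial_norm q (y + 1) = (of_int y + 1) * monomial_norm q y"
      by (intro monomial_norm_Suc) auto
    then show "of_int (int q - y) * G y * monomial_norm q (y + 1) = (of_int y + 1) * G y * monomial_norm q y"
      by algebra
  qed
  also have "\<dots> = (\<Sum>y\<in>{0..int q}. (of_int y + 1) * G y * monomial_norm q y)"
    using assms by (intro sum.mono_neutral_left) auto
  finally show ?thesis .
qed

text \<open>Raising and lowering operators are adjoint for the norms \<open>x! (p - x)!\<close> of the monomials, so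
  all slices of an invariant have the same norm.\<close>

lemma sl2_invariant_slice:
  assumes k: "sl2_invariant p q r k" and x: "x \<in> {0..int p}"
  defines "R \<equiv> \<lambda>x. \<Sum>y\<in>{0..int q}. \<Sum>w\<in>{0..int r}.
      (k x y w)\<^sup>2 * monomial_norm p x * monomial_norm q y * monomial_norm r w"
  shows "R x = R 0"
proof -
  define S where "S = (\<lambda>x. \<Sum>y\<in>{0..int q}. \<Sum>w\<in>{0..int r}. (k x y w)\<^sup>2 * monomial_norm q y * monomial_norm r w)"
  have RS: "R x = monomial_norm p x * S x" for x
    by (simp add: R_def S_def sum_distrib_left mult_ac)
  have z: "k x y w = 0" if "\<not> (y \<in> {0..int q} \<and> w \<in> {0..int r})" for x y w
    using sl2_invariantD(1)[OF k, of x y w] that by blast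
  \<comment> \<open>The lowering equation moves the operator from the first factor to the other two,
    adjointness turns it into raising there, and the raising equation returns it to the first
    factor.\<close>
  have S_Suc: "(of_int x + 1) * S (x + 1) = of_int (int p - x) * S x" for x
  proof -
    let ?n = "monomial_norm q" and ?l = "monomial_norm r"
    have "(of_int x + 1) * S (x + 1)
        = (\<Sum>y\<in>{0..int q}. \<Sum>w\<in>{0..int r}. ((of_int x + 1) * k (x + 1) y w) * k (x + 1) y w * ?n y * ?l w)"
      by (simp add: S_def sum_distrib_left mult_ac power2_eq_square)
    also have "\<dots> = (\<Sum>y\<in>{0..int q}. \<Sum>w\<in>{0..int r}.
        - ((of_int y + 1) * k x (y + 1) w * k (x + 1) y w * ?n y * ?l w)
        - (of_int w + 1) * k x y (w + 1) * k (x + 1) y w * ?n y * ?l w)"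
    proof (intro sum.cong refl)
      fix y w
      have e: "(of_int x + 1) * k (x + 1) y w = - (of_int y + 1) * k x (y + 1) w - (of_int w + 1) * k x y (w + 1)"
        using sl2_invariantD(4)[OF k, of x y w] by (simp add: algebra_simps)
      show "((of_int x + 1) * k (x + 1) y w) * k (x + 1) y w * ?n y * ?l w =
         - ((of_int y + 1) * k x (y + 1) w * k (x + 1) y w * ?n y * ?l w)
        - (of_int w + 1) * k x y (w + 1) * k (x + 1) y w * ?n y * ?l w"
        unfolding e by (simp add: algebra_simps)
    qed
    also have "\<dots> = - (\<Sum>w\<in>{0..int r}. \<Sum>y\<in>{0..int q}. (of_int y + 1) * (k x (y + 1) w * k (x + 1) y w * ?l w) * ?n y)
        - (\<Sum>y\<in>{0..int q}. \<Sum>w\<in>{0..int r}. (of_int w + 1) * (k x y (w + 1) * k (x + 1) y w * ?n y) * ?l w)"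
      by (subst (2) sum.swap) (simp add: sum_subtractf sum_negf mult_ac)
    also have "\<dots> = - (\<Sum>w\<in>{0..int r}. \<Sum>y\<in>{0..int q}. (of_int (int q - y) + 1) * (k x (y - 1 + 1) w * k (x + 1) (y - 1) w * ?l w) * ?n y)
        - (\<Sum>y\<in>{0..int q}. \<Sum>w\<in>{0..int r}. (of_int (int r - w) + 1) * (k x y (w - 1 + 1) * k (x + 1) y (w - 1) * ?n y) * ?l w)"
      using z by (subst (1 2) sum_shift_monomial_norm) auto
    also have "\<dots> = (\<Sum>y\<in>{0..int q}. \<Sum>w\<in>{0..int r}.
        - ((of_int (int q - y) + 1) * k (x + 1) (y - 1) w * k x y w * ?n y * ?l w)
        - (of_int (int r - w) + 1) * k (x + 1) y (w - 1) * k x y w * ?n y * ?l w)"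
      by (subst sum.swap) (simp add: sum_subtractf sum_negf mult_ac)
    also have "\<dots> = (\<Sum>y\<in>{0..int q}. \<Sum>w\<in>{0..int r}. (of_int (int p - x) * k x y w) * k x y w * ?n y * ?l w)"
    proof (intro sum.cong refl)
      fix y w
      have e: "of_int (int p - x) * k x y w
          = - (of_int (int q - y) + 1) * k (x + 1) (y - 1) w - (of_int (int r - w) + 1) * k (x + 1) y (w - 1)"
        using sl2_invariantD(3)[OF k, of "x + 1" y w] by (simp add: algebra_simps)
      show "- ((of_int (int q - y) + 1) * k (x + 1) (y - 1) w * k x y w * ?n y * ?l w)
        - (of_int (int r - w) + 1) * k (x + 1) y (w - 1) * k x y w * ?n y * ?l w
        = (of_int (int p - x) * k x y w) * k x y w * ?n y * ?l w"
        unfolding e by (simp add: algebra_simps)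
    qed
    also have "\<dots> = of_int (int p - x) * S x"
      by (simp add: S_def sum_distrib_left mult_ac power2_eq_square)
    finally show ?thesis .
  qed
  have "R (int j) = R 0" if "j \<le> p" for j
    using that
  proof (induction j)
    case (Suc j)
    let ?x = "int j"
    have p: "of_int (int p - ?x) > (0::real)" using Suc.prems by simp
    have "of_int (int p - ?x) * R (?x + 1) = (of_int (int p - ?x) * monomial_norm p (?x + 1)) * S (?x + 1)"
      by (simp add: RS mult_ac)
    also have "\<dots> = ((of_int ?x + 1) * S (?x + 1)) * monomial_norm p ?x"
      using Suc.prems by (subst monomial_norm_Suc) auto
    also have "\<dots> = of_int (int p - ?x) * R ?x"
      unfolding S_Suc RS by (simp add: mult_ac)
    finally have "R (?x + 1) = R ?x" using p by (simp del: of_int_diff)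
    then show ?case using Suc by (simp add: add.commute)
  qed simp
  from this[of "nat x"] x show ?thesis by auto
qed

text \<open>The squared coefficients of an invariant form a coupling of three uniform distributions.\<close>

lemma three_uniform_coupling:
  fixes F G H :: "int \<Rightarrow> real"
  assumes le: "\<And>x y w. x \<in> {0..int (a + b)} \<Longrightarrow> y \<in> {0..int (a + c)} \<Longrightarrow> w \<in> {0..int (b + c)}
      \<Longrightarrow> x + y + w = int (a + b + c) \<Longrightarrow> F x + G y + H w \<le> C"
  shows "sum F {0..int (a + b)} / real (a + b + 1) + sum G {0..int (a + c)} / real (a + c + 1)
     + sum H {0..int (b + c)} / real (b + c + 1) \<le> C"
proof -
  let ?p = "a + b" and ?q = "a + c" and ?r = "b + c"
  obtain k where k: "sl2_invariant ?p ?q ?r k" using sl2_invariant_exists by blast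
  define P where "P = {0..int ?p}"
  define Q where "Q = {0..int ?q}"
  define R where "R = {0..int ?r}"
  define \<omega> where "\<omega> x y w = (k x y w)\<^sup>2 * monomial_norm ?p x * monomial_norm ?q y * monomial_norm ?r w" for x y w
  have \<omega>0: "\<omega> x y w \<ge> 0" for x y w by (simp add: \<omega>_def less_imp_le[OF monomial_norm_pos])
  define \<kappa>1 where "\<kappa>1 = (\<Sum>y\<in>Q. \<Sum>w\<in>R. \<omega> 0 y w)"
  define \<kappa>2 where "\<kappa>2 = (\<Sum>x\<in>P. \<Sum>w\<in>R. \<omega> x 0 w)"
  define \<kappa>3 where "\<kappa>3 = (\<Sum>x\<in>P. \<Sum>y\<in>Q. \<omega> x y 0)"
  have k1: "(\<Sum>y\<in>Q. \<Sum>w\<in>R. \<omega> x y w) = \<kappa>1" if "x \<in> P" for x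
    using sl2_invariant_slice[OF k, of x] that unfolding \<omega>_def P_def Q_def R_def \<kappa>1_def by simp
  have k2: "(\<Sum>x\<in>P. \<Sum>w\<in>R. \<omega> x y w) = \<kappa>2" if "y \<in> Q" for y
    using sl2_invariant_slice[OF sl2_invariant_swap[OF k], of y] that
    unfolding \<omega>_def P_def Q_def R_def \<kappa>2_def by (simp add: mult_ac)
  have k3: "(\<Sum>x\<in>P. \<Sum>y\<in>Q. \<omega> x y w) = \<kappa>3" if "w \<in> R" for w
    using sl2_invariant_slice[OF sl2_invariant_rotate[OF k], of w] that
    unfolding \<omega>_def P_def Q_def R_def \<kappa>3_def by (simp add: mult_ac)
  define T where "T = (\<Sum>x\<in>P. \<Sum>y\<in>Q. \<Sum>w\<in>R. \<omega> x y w)"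
  have T1: "T = real (?p + 1) * \<kappa>1" by (simp add: T_def k1) (simp add: P_def)
  have "T = (\<Sum>y\<in>Q. \<Sum>x\<in>P. \<Sum>w\<in>R. \<omega> x y w)" unfolding T_def by (rule sum.swap)
  then have T2: "T = real (?q + 1) * \<kappa>2" by (simp add: k2) (simp add: Q_def)
  have sw: "(\<Sum>x\<in>P. \<Sum>y\<in>Q. \<Sum>w\<in>R. f x y w) = (\<Sum>w\<in>R. \<Sum>x\<in>P. \<Sum>y\<in>Q. f x y w)" for f :: "int \<Rightarrow> int \<Rightarrow> int \<Rightarrow> real"
  proof -
    have "(\<Sum>x\<in>P. \<Sum>y\<in>Q. \<Sum>w\<in>R. f x y w) = (\<Sum>x\<in>P. \<Sum>w\<in>R. \<Sum>y\<in>Q. f x y w)"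
      by (rule sum.cong[OF refl]) (rule sum.swap)
    also have "\<dots> = (\<Sum>w\<in>R. \<Sum>x\<in>P. \<Sum>y\<in>Q. f x y w)" by (rule sum.swap)
    finally show ?thesis .
  qed
  then have "T = (\<Sum>w\<in>R. \<Sum>x\<in>P. \<Sum>y\<in>Q. \<omega> x y w)" unfolding T_def by simp
  then have T3: "T = real (?r + 1) * \<kappa>3" by (simp add: k3) (simp add: R_def)
  obtain x y w where nz: "k x y w \<noteq> 0" using sl2_invariantD(2)[OF k] by blast
  have mem: "x \<in> P" "y \<in> Q" "w \<in> R" using sl2_invariantD(1)[OF k nz] unfolding P_def Q_def R_def by auto
  have fin: "finite P" "finite Q" "finite R" by (auto simp: P_def Q_def R_def)
  have "0 < \<omega> x y w" using nz by (simp add: \<omega>_def monomial_norm_pos)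
  also have "\<dots> \<le> (\<Sum>w\<in>R. \<omega> x y w)" using mem fin \<omega>0 by (intro member_le_sum) auto
  also have "\<dots> \<le> (\<Sum>y\<in>Q. \<Sum>w\<in>R. \<omega> x y w)"
    using mem fin \<omega>0 by (intro member_le_sum[of y Q "\<lambda>y. \<Sum>w\<in>R. \<omega> x y w"]) (auto intro: sum_nonneg)
  also have "\<dots> = \<kappa>1" using k1 mem by simp
  finally have "\<kappa>1 > 0" .
  then have T: "T > 0" unfolding T1 by simp
  have eF: "(\<Sum>x\<in>P. \<Sum>y\<in>Q. \<Sum>w\<in>R. \<omega> x y w * F x) = \<kappa>1 * sum F P"
    by (simp add: sum_distrib_right[symmetric] k1) (simp add: sum_distrib_left)
  have "(\<Sum>x\<in>P. \<Sum>y\<in>Q. \<Sum>w\<in>R. \<omega> x y w * G y) = (\<Sum>y\<in>Q. \<Sum>x\<in>P. \<Sum>w\<in>R. \<omega> x y w * G y)"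
    by (rule sum.swap)
  also have "\<dots> = \<kappa>2 * sum G Q"
    by (simp add: sum_distrib_right[symmetric] k2) (simp add: sum_distrib_left)
  finally have eG: "(\<Sum>x\<in>P. \<Sum>y\<in>Q. \<Sum>w\<in>R. \<omega> x y w * G y) = \<kappa>2 * sum G Q" .
  have "(\<Sum>x\<in>P. \<Sum>y\<in>Q. \<Sum>w\<in>R. \<omega> x y w * H w) = (\<Sum>w\<in>R. \<Sum>x\<in>P. \<Sum>y\<in>Q. \<omega> x y w * H w)"
    by (rule sw)
  also have "\<dots> = \<kappa>3 * sum H R"
    by (simp add: sum_distrib_right[symmetric] k3) (simp add: sum_distrib_left)
  finally have eH: "(\<Sum>x\<in>P. \<Sum>y\<in>Q. \<Sum>w\<in>R. \<omega> x y w * H w) = \<kappa>3 * sum H R" .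
  have "\<kappa>1 * sum F P + \<kappa>2 * sum G Q + \<kappa>3 * sum H R
      = (\<Sum>x\<in>P. \<Sum>y\<in>Q. \<Sum>w\<in>R. \<omega> x y w * (F x + G y + H w))"
    unfolding eF[symmetric] eG[symmetric] eH[symmetric] by (simp add: sum.distrib distrib_left)
  also have "\<dots> \<le> (\<Sum>x\<in>P. \<Sum>y\<in>Q. \<Sum>w\<in>R. \<omega> x y w * C)"
  proof (intro sum_mono)
    fix x y w assume m: "x \<in> P" "y \<in> Q" "w \<in> R"
    show "\<omega> x y w * (F x + G y + H w) \<le> \<omega> x y w * C"
    proof (cases "k x y w = 0")
      case True then show ?thesis by (simp add: \<omega>_def)
    next
      case False
      then have "x + y + w = int (a + b + c)" using sl2_invariantD(1)[OF k False] by simp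
      then have "F x + G y + H w \<le> C" using m le unfolding P_def Q_def R_def by blast
      then show ?thesis using \<omega>0 mult_left_mono by blast
    qed
  qed
  also have "\<dots> = T * C" by (simp add: T_def sum_distrib_right)
  finally have main: "\<kappa>1 * sum F P + \<kappa>2 * sum G Q + \<kappa>3 * sum H R \<le> T * C" .
  have "\<kappa>1 = T / real (?p + 1)" "\<kappa>2 = T / real (?q + 1)" "\<kappa>3 = T / real (?r + 1)"
    using T1 T2 T3 by (auto simp: field_simps)
  then have "T * (sum F P / real (?p + 1) + sum G Q / real (?q + 1) + sum H R / real (?r + 1)) \<le> T * C"
    using main by (simp add: distrib_left)
  then show ?thesis using T unfolding P_def Q_def R_def by simp
qed

section \<open>Couplings of intervals\<close>

text \<open>The values that one coordinate can take in a pair from \<open>{0..n}\<close> with sum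
  \<open>s\<close>.\<close>

definition segment :: "nat \<Rightarrow> nat \<Rightarrow> nat set" where
  "segment n s = {a. a \<le> n \<and> a \<le> s \<and> s - a \<le> n}"

lemma segment_eq: "segment n s = {s - n..min s n}"
  by (auto simp: segment_def)

text \<open>Reflecting the third variable turns a constant sum \<open>x + y + w\<close> into
  \<open>z = x + y\<close>. As \<open>w\<close> runs over \<open>{0..b + c}\<close>, this
  \<open>z\<close> starts at \<open>i + j + a\<close>.\<close>

lemma three_interval_coupling:
  fixes f g h :: "nat \<Rightarrow> real"
  assumes le: "\<And>x y. x \<in> {i..i + a + b} \<Longrightarrow> y \<in> {j..j + a + c} \<Longrightarrow> x + y \<in> {i + j + a..i + j + a + b + c}
      \<Longrightarrow> f x + g y + h (x + y) \<le> C"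
  shows "sum f {i..i + a + b} / card {i..i + a + b} + sum g {j..j + a + c} / card {j..j + a + c}
     + sum h {i + j + a..i + j + a + b + c} / card {i + j + a..i + j + a + b + c} \<le> C"
proof -
  define F where "F x = f (i + nat x)" for x
  define G where "G y = g (j + nat y)" for y
  define H where "H w = h (i + j + a + b + c - nat w)" for w
  have "sum F {0..int (a + b)} / real (a + b + 1) + sum G {0..int (a + c)} / real (a + c + 1)
     + sum H {0..int (b + c)} / real (b + c + 1) \<le> C"
  proof (rule three_uniform_coupling)
    fix x y w
    assume m: "x \<in> {0..int (a + b)}" "y \<in> {0..int (a + c)}" "w \<in> {0..int (b + c)}" "x + y + w = int (a + b + c)"
    then have "i + j + a + b + c - nat w = (i + nat x) + (j + nat y)" by auto
    moreover have "f (i + nat x) + g (j + nat y) + h ((i + nat x) + (j + nat y)) \<le> C"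
      using m by (intro le) auto
    ultimately show "F x + G y + H w \<le> C" by (simp add: F_def G_def H_def)
  qed
  moreover have "sum F {0..int (a + b)} = sum f {i..i + a + b}"
    unfolding F_def by (rule sum.reindex_bij_witness[of _ "\<lambda>x. int x - int i" "\<lambda>x. i + nat x"]) auto
  moreover have "sum G {0..int (a + c)} = sum g {j..j + a + c}"
    unfolding G_def by (rule sum.reindex_bij_witness[of _ "\<lambda>x. int x - int j" "\<lambda>x. j + nat x"]) auto
  moreover have "sum H {0..int (b + c)} = sum h {i + j + a..i + j + a + b + c}"
    unfolding H_def
    by (rule sum.reindex_bij_witness[of _ "\<lambda>x. int (i + j + a + b + c) - int x" "\<lambda>w. i + j + a + b + c - nat w"]) auto
  ultimately show ?thesis by simp
qed

text \<open>The lengths of the three segments satisfy the triangle inequality; which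
  \<open>a\<close>, \<open>b\<close>, \<open>c\<close> realise them depends on which of
  \<open>s\<close>, \<open>t\<close>, \<open>s + t\<close> exceed \<open>n\<close>.\<close>

lemma segment_coupling:
  fixes f g h :: "nat \<Rightarrow> real"
  assumes st: "s + t \<le> 2 * n"
    and le: "\<And>x y. x \<in> segment n s \<Longrightarrow> y \<in> segment n t \<Longrightarrow> x + y \<in> segment n (s + t) \<Longrightarrow> f x + g y + h (x + y) \<le> C"
  shows "sum f (segment n s) / card (segment n s) + sum g (segment n t) / card (segment n t)
     + sum h (segment n (s + t)) / card (segment n (s + t)) \<le> C"
proof -
  have "\<exists>i j a b c. segment n s = {i..i + a + b} \<and> segment n t = {j..j + a + c} \<and>
      segment n (s + t) = {i + j + a..i + j + a + b + c}"
  proof -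
    consider "s + t \<le> n" | "s \<le> n" "t \<le> n" "n < s + t" | "n < s" | "n < t" by linarith
    then show ?thesis
    proof cases
      case 1
      have "segment n s = {0..0 + (0) + (s)}" "segment n t = {0..0 + (0) + (t)}"
        "segment n (s + t) = {0 + (0) + (0)..0 + (0) + (0) + (s) + (t)}"
        using 1 st by (auto simp: segment_def)
      then show ?thesis by blast
    next
      case 2
      have "segment n s = {0..0 + (s + t - n) + (n - t)}" "segment n t = {0..0 + (s + t - n) + (n - s)}"
        "segment n (s + t) = {0 + (0) + (s + t - n)..0 + (0) + (s + t - n) + (n - t) + (n - s)}"
        using 2 st by (auto simp: segment_def)
      then show ?thesis by blast
    next
      case 3
      have "segment n s = {s - n..s - n + (t) + (2 * n - s - t)}" "segment n t = {0..0 + (t) + (0)}"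
        "segment n (s + t) = {s - n + (0) + (t)..s - n + (0) + (t) + (2 * n - s - t) + (0)}"
        using 3 st by (auto simp: segment_def)
      then show ?thesis by blast
    next
      case 4
      have "segment n s = {0..0 + (s) + (0)}" "segment n t = {t - n..t - n + (s) + (2 * n - s - t)}"
        "segment n (s + t) = {0 + (t - n) + (s)..0 + (t - n) + (s) + (0) + (2 * n - s - t)}"
        using 4 st by (auto simp: segment_def)
      then show ?thesis by blast
    qed
  qed
  then obtain i j a b c where eq: "segment n s = {i..i + a + b}" "segment n t = {j..j + a + c}"
      "segment n (s + t) = {i + j + a..i + j + a + b + c}" by blast
  show ?thesis unfolding eq by (rule three_interval_coupling) (use le eq in auto)
qed

section \<open>Averages over levels\<close>

text \<open>Points are functions on the whole type that vanish outside \<open>J\<close>, so a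
  coordinate can be split off or added by function update.\<close>

definition box_on :: "'a set \<Rightarrow> nat \<Rightarrow> ('a \<Rightarrow> nat) set" where
  "box_on J n = {x. (\<forall>i\<in>J. x i \<le> n) \<and> (\<forall>i. i \<notin> J \<longrightarrow> x i = 0)}"

definition level :: "'a set \<Rightarrow> nat \<Rightarrow> nat \<Rightarrow> ('a \<Rightarrow> nat) set" where
  "level J n k = {x \<in> box_on J n. sum x J = k}"

lemma finite_box_on: "finite J \<Longrightarrow> finite (box_on J n)"
proof -
  assume J: "finite J"
  have "box_on J n = {f. \<forall>x. (x \<in> J \<longrightarrow> f x \<in> {..n}) \<and> (x \<notin> J \<longrightarrow> f x = 0)}"
    unfolding box_on_def by auto
  then show ?thesis using finite_set_of_finite_funs[OF J, of "{..n}" 0] by simp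
qed

lemma finite_level: "finite J \<Longrightarrow> finite (level J n k)"
  unfolding level_def by (rule finite_subset[OF _ finite_box_on]) auto

lemma sum_fun_upd2:
  fixes x :: "'a \<Rightarrow> nat"
  assumes "finite J" "i \<in> J" "j \<in> J" "i \<noteq> j"
  shows "sum x J = x i + x j + sum x (J - {i, j})" "sum (x(i := a, j := b)) J = a + b + sum x (J - {i, j})"
proof -
  have *: "sum f J = f i + (f j + sum f (J - {i} - {j}))" for f :: "'a \<Rightarrow> nat"
    using assms by (simp add: sum.remove[of J i] sum.remove[of "J - {i}" j])
  have e: "J - {i} - {j} = J - {i, j}" by auto
  show "sum x J = x i + x j + sum x (J - {i, j})" using *[of x] e by simp
  have "sum (x(i := a, j := b)) (J - {i, j}) = sum x (J - {i, j})" by (rule sum.cong) auto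
  then show "sum (x(i := a, j := b)) J = a + b + sum x (J - {i, j})"
    using *[of "x(i := a, j := b)"] e assms by simp
qed

lemma exists_below_with_sum:
  fixes z :: "'a \<Rightarrow> nat"
  assumes "finite J" "k \<le> sum z J"
  shows "\<exists>x. (\<forall>i. x i \<le> z i) \<and> (\<forall>i. i \<notin> J \<longrightarrow> x i = 0) \<and> sum x J = k"
  using assms
proof (induction J arbitrary: k rule: finite_induct)
  case (insert j J)
  define a where "a = min k (z j)"
  have "k - a \<le> sum z J" using insert by (auto simp: a_def min_def)
  then obtain x where x: "\<forall>i. x i \<le> z i" "\<forall>i. i \<notin> J \<longrightarrow> x i = 0" "sum x J = k - a" using insert.IH by blast
  have "sum (x(j := a)) J = sum x J" using insert by (intro sum.cong) auto
  then show ?case using x insert by (intro exI[of _ "x(j := a)"]) (auto simp: a_def)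
qed auto

section \<open>Averaging over one pair of coordinates\<close>

definition transfer :: "'a \<Rightarrow> 'a \<Rightarrow> ('a \<Rightarrow> nat) \<Rightarrow> nat \<Rightarrow> 'a \<Rightarrow> nat" where
  "transfer i j x a = x(i := a, j := x i + x j - a)"

text \<open>On a level with uniform measure this is the conditional expectation that forgets how
  \<open>x i + x j\<close> is split, hence an orthogonal projection.\<close>

definition pair_mean :: "nat \<Rightarrow> 'a \<Rightarrow> 'a \<Rightarrow> (('a \<Rightarrow> nat) \<Rightarrow> real) \<Rightarrow> ('a \<Rightarrow> nat) \<Rightarrow> real" where
  "pair_mean n i j f x = (\<Sum>a\<in>segment n (x i + x j). f (transfer i j x a)) / card (segment n (x i + x j))"

lemma finite_segment: "finite (segment n s)" by (simp add: segment_eq)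

context
  fixes J :: "'a set" and n :: nat and i j :: 'a
  assumes J: "finite J" and ij: "i \<in> J" "j \<in> J" "i \<noteq> j"
begin

lemma transfer_mem: "x \<in> level J n k \<Longrightarrow> a \<in> segment n (x i + x j) \<Longrightarrow> transfer i j x a \<in> level J n k"
  using sum_fun_upd2[OF J ij, of x] ij
  unfolding level_def box_on_def transfer_def segment_def by auto

lemma transfer_self: "transfer i j x (x i) = x"
  by (auto simp: transfer_def fun_eq_iff)

lemma mem_segment_self: "x \<in> level J n k \<Longrightarrow> x i \<in> segment n (x i + x j)"
  using ij unfolding level_def box_on_def segment_def by auto

lemma transfer_transfer:
  assumes "a \<in> segment n (x i + x j)"
  shows "transfer i j x a i + transfer i j x a j = x i + x j"
    and "transfer i j (transfer i j x a) b = transfer i j x b"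
    and "transfer i j x a i = a" "a + transfer i j x a j = x i + x j"
  using assms ij by (auto simp: transfer_def segment_def fun_eq_iff)

lemma pair_mean_transfer:
  "a \<in> segment n (x i + x j) \<Longrightarrow> pair_mean n i j f (transfer i j x a) = pair_mean n i j f x"
  using transfer_transfer[of a x] unfolding pair_mean_def by simp

lemma pair_mean_self_adjoint:
  "(\<Sum>x\<in>level J n k. pair_mean n i j f x * g x) = (\<Sum>x\<in>level J n k. f x * pair_mean n i j g x)"
proof -
  let ?L = "level J n k" and ?c = "\<lambda>x. real (card (segment n (x i + x j)))"
  let ?S = "Sigma ?L (\<lambda>x. segment n (x i + x j))"
  have "(\<Sum>x\<in>?L. pair_mean n i j f x * g x) = (\<Sum>(x, a)\<in>?S. f (transfer i j x a) * g x / ?c x)"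
    by (simp add: pair_mean_def sum_divide_distrib sum_distrib_right sum.Sigma finite_level J finite_segment)
  also have "\<dots> = (\<Sum>(x, a)\<in>?S. f x * g (transfer i j x a) / ?c x)"
    \<comment> \<open>Exchanging a point with its redistribution is an involution that keeps the
      pair sum, and so keeps the denominator.\<close>
    by (rule sum.reindex_bij_witness[of _ "\<lambda>(x, a). (transfer i j x a, x i)" "\<lambda>(x, a). (transfer i j x a, x i)"])
      (auto simp: transfer_transfer transfer_self transfer_mem mem_segment_self)
  also have "\<dots> = (\<Sum>x\<in>?L. f x * pair_mean n i j g x)"
    by (simp add: pair_mean_def sum_divide_distrib sum_distrib_left sum.Sigma finite_level J finite_segment)
  finally show ?thesis .
qed

lemma card_segment_pos: "x \<in> level J n k \<Longrightarrow> card (segment n (x i + x j)) > 0"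
  using mem_segment_self finite_segment card_gt_0_iff by blast

lemma pair_mean_const: "x \<in> level J n k \<Longrightarrow> pair_mean n i j (\<lambda>_. c) x = c"
  using card_segment_pos[of x k] by (simp add: pair_mean_def)

lemma pair_mean_sum: "(\<Sum>x\<in>level J n k. pair_mean n i j f x) = (\<Sum>x\<in>level J n k. f x)"
  using pair_mean_self_adjoint[where g = "\<lambda>_. 1" and f = f and k = k] by (simp add: pair_mean_const)

lemma pair_mean_idem: "x \<in> level J n k \<Longrightarrow> pair_mean n i j (pair_mean n i j f) x = pair_mean n i j f x"
  using card_segment_pos[of x k] unfolding pair_mean_def[of n i j "pair_mean n i j f"]
  by (simp add: pair_mean_transfer)

text \<open>Pythagoras for the projection.\<close>

lemma pair_mean_energy:
  "(\<Sum>x\<in>level J n k. (f x - pair_mean n i j f x)\<^sup>2)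
    = (\<Sum>x\<in>level J n k. (f x)\<^sup>2) - (\<Sum>x\<in>level J n k. (pair_mean n i j f x)\<^sup>2)"
proof -
  let ?L = "level J n k" and ?A = "pair_mean n i j"
  have "(\<Sum>x\<in>?L. ?A f x * ?A f x) = (\<Sum>x\<in>?L. f x * ?A (?A f) x)" by (rule pair_mean_self_adjoint)
  also have "\<dots> = (\<Sum>x\<in>?L. f x * ?A f x)" by (simp add: pair_mean_idem)
  finally have "(\<Sum>x\<in>?L. (?A f x)\<^sup>2) = (\<Sum>x\<in>?L. f x * ?A f x)" by (simp add: power2_eq_square)
  moreover have "(\<Sum>x\<in>?L. (f x - ?A f x)\<^sup>2) = (\<Sum>x\<in>?L. (f x)\<^sup>2) - 2 * (\<Sum>x\<in>?L. f x * ?A f x) + (\<Sum>x\<in>?L. (?A f x)\<^sup>2)"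
    by (simp add: power2_diff sum.distrib sum_subtractf sum_distrib_left mult_ac)
  ultimately show ?thesis by simp
qed

text \<open>Coupled redistributions of \<open>q\<close>, \<open>r\<close> and \<open>q + r\<close>
  inside the coordinates \<open>i\<close>, \<open>j\<close> again form an additive triple. Since the
  coupling has uniform marginals, the constraint survives replacing each of the three functions by
  its own pair mean.\<close>

lemma pair_mean_triple:
  assumes le: "\<And>q r. q \<in> level J n k \<Longrightarrow> r \<in> level J n l \<Longrightarrow> (\<lambda>i. q i + r i) \<in> level J n (k + l)
      \<Longrightarrow> f q + g r + h (\<lambda>i. q i + r i) \<le> C"
    and q: "q \<in> level J n k" and r: "r \<in> level J n l" and z: "(\<lambda>i. q i + r i) \<in> level J n (k + l)"
  shows "pair_mean n i j f q + pair_mean n i j g r + pair_mean n i j h (\<lambda>i. q i + r i) \<le> C"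
proof -
  let ?z = "\<lambda>i. q i + r i"
  have s: "?z i + ?z j = (q i + q j) + (r i + r j)" by simp
  have "q i + r i \<le> n" "q j + r j \<le> n" using z ij unfolding level_def box_on_def by auto
  then have "(q i + q j) + (r i + r j) \<le> 2 * n" by simp
  moreover have "f (transfer i j q x) + g (transfer i j r y) + h (transfer i j ?z (x + y)) \<le> C"
    if "x \<in> segment n (q i + q j)" "y \<in> segment n (r i + r j)" "x + y \<in> segment n ((q i + q j) + (r i + r j))" for x y
  proof -
    have "transfer i j ?z (x + y) = (\<lambda>i'. transfer i j q x i' + transfer i j r y i')"
      using that ij by (auto simp: transfer_def segment_def fun_eq_iff)
    moreover have "transfer i j ?z (x + y) \<in> level J n (k + l)" using that(3) z unfolding s[symmetric] by (intro transfer_mem)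
    ultimately show ?thesis using le[of "transfer i j q x" "transfer i j r y"] transfer_mem q r that by simp
  qed
  ultimately show ?thesis unfolding pair_mean_def s by (rule segment_coupling)
qed

end

text \<open>Two points of a level are joined by unit transfers between two coordinates, each
  lowering the distance by 2. Both ends of a transfer have the same pair mean, so \<open>f\<close>
  changes by at most \<open>2 * \<epsilon>\<close> along it.\<close>

lemma nearly_invariant_nearly_constant:
  assumes J: "finite J" and \<epsilon>: "\<epsilon> \<ge> 0"
    and inv: "\<And>i j x. i \<in> J \<Longrightarrow> j \<in> J \<Longrightarrow> i \<noteq> j \<Longrightarrow> x \<in> level J n k \<Longrightarrow> \<bar>f x - pair_mean n i j f x\<bar> \<le> \<epsilon>"
    and x: "x \<in> level J n k" and y: "y \<in> level J n k"
  shows "\<bar>f x - f y\<bar> \<le> 2 * \<epsilon> * (\<Sum>i\<in>J. \<bar>real (x i) - real (y i)\<bar>)"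
proof -
  define D where "D x = (\<Sum>i\<in>J. nat \<bar>int (x i) - int (y i)\<bar>)" for x
  have "\<bar>f x - f y\<bar> \<le> 2 * \<epsilon> * real (D x)"
    using x
  proof (induction "D x" arbitrary: x rule: less_induct)
    case less
    show ?case
    proof (cases "x = y")
      case False
      have sums: "sum x J = sum y J" using less.prems y by (simp add: level_def)
      have out: "x i = y i" if "i \<notin> J" for i using less.prems y that by (simp add: level_def box_on_def)
      have "\<exists>i\<in>J. x i < y i"
      proof (rule ccontr)
        assume "\<not> ?thesis"
        then have ge: "\<forall>i\<in>J. y i \<le> x i" by (auto simp: not_less)
        obtain i where "x i \<noteq> y i" using False by blast
        then have "i \<in> J" "y i < x i" using out ge le_neq_implies_less by metis+
        then have "sum y J < sum x J" using ge J by (intro sum_strict_mono_ex1) auto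
        then show False using sums by simp
      qed
      then obtain i where i: "i \<in> J" "x i < y i" by blast
      have "\<exists>j\<in>J. y j < x j"
      proof (rule ccontr)
        assume "\<not> ?thesis"
        then have "\<forall>i\<in>J. x i \<le> y i" by (auto simp: not_less)
        then have "sum x J < sum y J" using i J by (intro sum_strict_mono_ex1) auto
        then show False using sums by simp
      qed
      then obtain j where j: "j \<in> J" "y j < x j" by blast
      have ij: "i \<noteq> j" using i j by auto
      note * = J i(1) j(1) ij
      have seg: "x i + 1 \<in> segment n (x i + x j)"
        using i j less.prems y unfolding segment_def level_def box_on_def by fastforce
      define x' where "x' = transfer i j x (x i + 1)"
      have x': "x' \<in> level J n k" unfolding x'_def by (rule transfer_mem[OF * less.prems seg])
      have x'_eq: "x' = x(i := x i + 1, j := x j - 1)" using j by (auto simp: x'_def transfer_def)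
      have sp: "(\<Sum>i\<in>J. F i) = F i + F j + (\<Sum>i\<in>J - {i, j}. F i)" for F :: "'a \<Rightarrow> nat"
        using sum_fun_upd2(1)[OF *] .
      have rest: "(\<Sum>i'\<in>J - {i, j}. nat \<bar>int (x' i') - int (y i')\<bar>) = (\<Sum>i'\<in>J - {i, j}. nat \<bar>int (x i') - int (y i')\<bar>)"
        by (rule sum.cong) (auto simp: x'_eq)
      have D: "D x = D x' + 2" unfolding D_def sp rest using i j ij by (simp add: x'_eq)
      have "\<bar>f x - f x'\<bar> \<le> 2 * \<epsilon>"
        using inv[OF i(1) j(1) ij less.prems] inv[OF i(1) j(1) ij x'] pair_mean_transfer[OF * seg, of f]
        unfolding x'_def by linarith
      moreover have "\<bar>f x' - f y\<bar> \<le> 2 * \<epsilon> * real (D x')" using less.hyps[of x'] D x' by simp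
      ultimately have "\<bar>f x - f y\<bar> \<le> 2 * \<epsilon> * (real (D x') + 1)" by (simp add: algebra_simps)
      also have "\<dots> \<le> 2 * \<epsilon> * real (D x)" using D \<epsilon> by (intro mult_left_mono) auto
      finally show ?thesis .
    qed (simp add: \<epsilon>)
  qed
  moreover have "real (D x) = (\<Sum>i\<in>J. \<bar>real (x i) - real (y i)\<bar>)"
    unfolding D_def of_nat_sum by (rule sum.cong) auto
  ultimately show ?thesis by simp
qed

text \<open>Pair means preserve the constraint and the three sums, and lower the energy by exactly
  the squared distance moved. A triple of functions of nearly minimal energy is therefore nearly
  fixed by every pair mean, hence nearly constant on its levels, and the constraint at a single
  triple of points bounds the three means. Working with near-minimisers replaces any convergence
  argument for iterated averaging.\<close>

theorem level_triple_mean: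
  fixes f g h :: "('a \<Rightarrow> nat) \<Rightarrow> real"
  assumes J: "finite J" and kl: "k + l \<le> n * card J"
    and le: "\<And>q r. q \<in> level J n k \<Longrightarrow> r \<in> level J n l \<Longrightarrow> (\<lambda>i. q i + r i) \<in> level J n (k + l)
      \<Longrightarrow> f q + g r + h (\<lambda>i. q i + r i) \<le> C"
  shows "sum f (level J n k) / card (level J n k) + sum g (level J n l) / card (level J n l)
    + sum h (level J n (k + l)) / card (level J n (k + l)) \<le> C"
proof -
  let ?K = "level J n k" and ?L = "level J n l" and ?M = "level J n (k + l)"
  have "k + l \<le> sum (\<lambda>_. n) J" using kl by (simp add: mult.commute)
  from exists_below_with_sum[OF J this]
  obtain z where z': "\<forall>i. z i \<le> n" "\<forall>i. i \<notin> J \<longrightarrow> z i = 0" "sum z J = k + l" by blast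
  then have z: "z \<in> ?M" by (simp add: level_def box_on_def)
  then have "k \<le> sum z J" by (simp add: level_def)
  from exists_below_with_sum[OF J this] obtain q
    where q: "\<forall>i. q i \<le> z i" "\<forall>i. i \<notin> J \<longrightarrow> q i = 0" "sum q J = k" by blast
  define r where "r i = z i - q i" for i
  have zqr: "(\<lambda>i. q i + r i) = z" using q by (auto simp: r_def fun_eq_iff)
  have "sum z J = sum q J + sum r J" unfolding zqr[symmetric] by (simp add: sum.distrib)
  then have "sum r J = l" using z q by (simp add: level_def)
  moreover have "q i \<le> n" "r i \<le> n" if "i \<in> J" for i
  proof -
    have "z i \<le> n" "q i \<le> z i" using z q that by (auto simp: level_def box_on_def)
    then show "q i \<le> n" "r i \<le> n" by (auto simp: r_def)
  qed
  moreover have "r i = 0" if "i \<notin> J" for i using z that by (simp add: r_def level_def box_on_def)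
  ultimately have qL: "q \<in> ?K" and rL: "r \<in> ?L" using q by (auto simp: level_def box_on_def)
  define D where "D = real (n * card J)"
  have dist: "(\<Sum>i\<in>J. \<bar>real (x i) - real (y i)\<bar>) \<le> D" if "x \<in> level J n a" "y \<in> level J n a" for x y a
  proof -
    have "(\<Sum>i\<in>J. \<bar>real (x i) - real (y i)\<bar>) \<le> real (card J) * real n"
    proof (rule sum_bounded_above)
      fix i assume "i \<in> J"
      then have "x i \<le> n" "y i \<le> n" using that by (auto simp: level_def box_on_def)
      then show "\<bar>real (x i) - real (y i)\<bar> \<le> real n" by linarith
    qed
    then show ?thesis by (simp add: D_def mult.commute)
  qed
  define X where "X = (\<lambda>(f', g', h').
     (\<forall>q\<in>?K. \<forall>r\<in>?L. (\<lambda>i. q i + r i) \<in> ?M \<longrightarrow> f' q + g' r + h' (\<lambda>i. q i + r i) \<le> C) \<and>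
     sum f' ?K = sum f ?K \<and> sum g' ?L = sum g ?L \<and> sum h' ?M = sum h ?M)"
  define \<Phi> :: "(('a \<Rightarrow> nat) \<Rightarrow> real) \<times> (('a \<Rightarrow> nat) \<Rightarrow> real) \<times> (('a \<Rightarrow> nat) \<Rightarrow> real) \<Rightarrow> real"
    where "\<Phi> = (\<lambda>(f', g', h'). (\<Sum>x\<in>?K. (f' x)\<^sup>2) + (\<Sum>x\<in>?L. (g' x)\<^sup>2) + (\<Sum>x\<in>?M. (h' x)\<^sup>2))"
  have bdd: "bdd_below (\<Phi> ` Collect X)"
    by (rule bdd_belowI[of _ 0]) (auto simp: \<Phi>_def intro!: add_nonneg_nonneg sum_nonneg)
  have X0: "X (f, g, h)" using le by (auto simp: X_def)
  have "sum f ?K / card ?K + sum g ?L / card ?L + sum h ?M / card ?M \<le> C + \<delta>" if \<delta>: "\<delta> > 0" for \<delta>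
  proof -
    \<comment> \<open>Each of the three means exceeds the value at its chosen point by at most
      \<open>2 * \<epsilon> * D\<close>, in total \<open>6 * \<epsilon> * D\<close>; the summand 6
      keeps the denominator positive.\<close>
    define \<epsilon> where "\<epsilon> = \<delta> / (6 * D + 6)"
    have D0: "D \<ge> 0" by (simp add: D_def)
    have \<epsilon>: "\<epsilon> > 0" using \<delta> D0 by (simp add: \<epsilon>_def)
    have "Inf (\<Phi> ` Collect X) < Inf (\<Phi> ` Collect X) + \<epsilon>\<^sup>2" using \<epsilon> by simp
    then obtain t where t: "X t" "\<Phi> t < Inf (\<Phi> ` Collect X) + \<epsilon>\<^sup>2"
      using cInf_lessD[of "\<Phi> ` Collect X"] X0 by blast
    obtain f' g' h' where t_eq: "t = (f', g', h')" by (cases t)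
    have inv: "\<bar>f' x - pair_mean n i j f' x\<bar> \<le> \<epsilon> \<and> \<bar>g' y - pair_mean n i j g' y\<bar> \<le> \<epsilon>
        \<and> \<bar>h' w - pair_mean n i j h' w\<bar> \<le> \<epsilon>"
      if ij: "i \<in> J" "j \<in> J" "i \<noteq> j" and m: "x \<in> ?K" "y \<in> ?L" "w \<in> ?M" for i j x y w
    proof -
      let ?A = "pair_mean n i j"
      note * = J ij
      have "X (?A f', ?A g', ?A h')"
        using t(1) pair_mean_triple[OF *, where k = k and l = l and f = f' and g = g' and h = h' and C = C]
        unfolding X_def t_eq by (simp add: pair_mean_sum[OF *])
      then have "Inf (\<Phi> ` Collect X) \<le> \<Phi> (?A f', ?A g', ?A h')"
        by (intro cInf_lower bdd) auto
      then have "\<Phi> (f', g', h') - \<Phi> (?A f', ?A g', ?A h') \<le> \<epsilon>\<^sup>2" using t(2) t_eq by simp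
      then have s: "(\<Sum>x\<in>?K. (f' x - ?A f' x)\<^sup>2) + (\<Sum>x\<in>?L. (g' x - ?A g' x)\<^sup>2) + (\<Sum>x\<in>?M. (h' x - ?A h' x)\<^sup>2) \<le> \<epsilon>\<^sup>2"
        by (simp add: \<Phi>_def pair_mean_energy[OF *])
      have one: "(u x - ?A u x)\<^sup>2 \<le> (\<Sum>x\<in>level J n a. (u x - ?A u x)\<^sup>2)" if "x \<in> level J n a" for u x a
        using that finite_level[OF J] by (intro member_le_sum[of x _ "\<lambda>x. (u x - ?A u x)\<^sup>2"]) auto
      have nn: "0 \<le> (\<Sum>x\<in>level J n a. (u x - ?A u x)\<^sup>2)" for u a by (intro sum_nonneg) auto
      have "(f' x - ?A f' x)\<^sup>2 \<le> \<epsilon>\<^sup>2" "(g' y - ?A g' y)\<^sup>2 \<le> \<epsilon>\<^sup>2" "(h' w - ?A h' w)\<^sup>2 \<le> \<epsilon>\<^sup>2"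
        using one[OF m(1), of f'] one[OF m(2), of g'] one[OF m(3), of h'] nn[of f' k] nn[of g' l] nn[of h' "k + l"] s
        by linarith+
      then show ?thesis using \<epsilon> by (auto simp: abs_le_square_iff[symmetric])
    qed
    have mean: "sum u (level J n a) / card (level J n a) \<le> u x + 2 * \<epsilon> * D"
      if x: "x \<in> level J n a" and u: "\<And>i j x. i \<in> J \<Longrightarrow> j \<in> J \<Longrightarrow> i \<noteq> j \<Longrightarrow> x \<in> level J n a \<Longrightarrow> \<bar>u x - pair_mean n i j u x\<bar> \<le> \<epsilon>" for u x a
    proof -
      have "u y \<le> u x + 2 * \<epsilon> * D" if y: "y \<in> level J n a" for y
      proof -
        have "\<bar>u y - u x\<bar> \<le> 2 * \<epsilon> * (\<Sum>i\<in>J. \<bar>real (y i) - real (x i)\<bar>)"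
          using \<epsilon> by (intro nearly_invariant_nearly_constant[OF J _ u y x]) auto
        also have "\<dots> \<le> 2 * \<epsilon> * D" using \<epsilon> dist[OF y x] by (intro mult_left_mono) auto
        finally show ?thesis by linarith
      qed
      then have "sum u (level J n a) \<le> real (card (level J n a)) * (u x + 2 * \<epsilon> * D)"
        by (intro sum_bounded_above) auto
      moreover have "card (level J n a) > 0" using x finite_level[OF J] card_gt_0_iff by blast
      ultimately show ?thesis by (simp add: field_simps)
    qed
    have zM: "(\<lambda>i. q i + r i) \<in> ?M" using z zqr by simp
    have "sum f ?K / card ?K + sum g ?L / card ?L + sum h ?M / card ?M
        = sum f' ?K / card ?K + sum g' ?L / card ?L + sum h' ?M / card ?M"
      using t(1) by (simp add: X_def t_eq)
    also have "\<dots> \<le> (f' q + 2 * \<epsilon> * D) + (g' r + 2 * \<epsilon> * D) + (h' (\<lambda>i. q i + r i) + 2 * \<epsilon> * D)"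
      using inv qL rL zM by (intro add_mono mean) blast+
    also have "\<dots> \<le> C + 6 * \<epsilon> * D"
    proof -
      have "f' q + g' r + h' (\<lambda>i. q i + r i) \<le> C" using t(1) qL rL zM unfolding X_def t_eq by blast
      then show ?thesis by linarith
    qed
    also have "6 * \<epsilon> * D \<le> \<delta>" using D0 \<delta> by (simp add: \<epsilon>_def field_simps)
    finally show ?thesis by simp
  qed
  then show ?thesis by (rule field_le_epsilon)
qed

section \<open>Counting lattice points by level\<close>

text \<open>The coefficient of \<open>z^k\<close> in \<open>(1 + z + ... + z^n)^d\<close>. With an
  integer argument all shifted identities hold without side conditions.\<close>

primrec level_count :: "nat \<Rightarrow> nat \<Rightarrow> int \<Rightarrow> real" where
  "level_count n 0 k = (if k = 0 then 1 else 0)"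
| "level_count n (Suc d) k = (\<Sum>s\<in>{0..n}. level_count n d (k - int s))"

lemma level_count_nonneg: "level_count n d k \<ge> 0"
  by (induction d arbitrary: k) (auto intro: sum_nonneg)

lemma level_count_neg: "k < 0 \<Longrightarrow> level_count n d k = 0"
  by (induction d arbitrary: k) auto

lemma level_count_sym: "level_count n d (int (n * d) - k) = level_count n d k"
proof (induction d arbitrary: k)
  case (Suc d)
  have "level_count n (Suc d) (int (n * Suc d) - k) = (\<Sum>s\<in>{0..n}. level_count n d (int (n * d) - (k - int (n - s))))"
    by (auto intro!: sum.cong simp: algebra_simps of_nat_diff)
  also have "\<dots> = (\<Sum>s\<in>{0..n}. level_count n d (k - int (n - s)))" by (simp only: Suc.IH)
  also have "\<dots> = level_count n (Suc d) k"
    by (simp, rule sum.reindex_bij_witness[of _ "\<lambda>s. n - s" "\<lambda>s. n - s"]) auto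
  finally show ?case .
qed auto

lemma level_count_big: "k > int (n * d) \<Longrightarrow> level_count n d k = 0"
  using level_count_sym[of n d k] level_count_neg[of "int (n * d) - k" n d] by simp

text \<open>Multiplication of the generating function by \<open>1 - z\<close>.\<close>

lemma level_count_diff:
  "level_count n (Suc d) k - level_count n (Suc d) (k - 1) = level_count n d k - level_count n d (k - int n - 1)"
proof -
  define f where "f s = level_count n d (k - int s)" for s
  have "level_count n (Suc d) (k - 1) = (\<Sum>s\<in>{0..n}. f (Suc s))"
    by (auto intro!: sum.cong simp: f_def algebra_simps)
  also have "\<dots> = sum f {0..n} - f 0 + f (Suc n)"
    using sum.atLeast0_atMost_Suc_shift[of f n] sum.atLeast0_atMost_Suc[of f n] by (simp add: atLeast0AtMost)
  finally show ?thesis by (simp add: f_def algebra_simps)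
qed

text \<open>By symmetry the \<open>Suc d\<close> coordinates have equal means on a level, and these
  means add up to \<open>k\<close>.\<close>

lemma level_count_moment:
  "real (Suc d) * (\<Sum>s\<in>{0..n}. real s * level_count n d (k - int s)) = of_int k * level_count n (Suc d) k"
proof (induction d arbitrary: k)
  case 0
  have "(\<Sum>s\<in>{0..n}. real s * level_count n 0 (k - int s)) = (\<Sum>s\<in>{0..n}. of_int k * level_count n 0 (k - int s))"
    by (rule sum.cong) auto
  then show ?case by (simp add: sum_distrib_left)
next
  case (Suc d)
  have "of_int k * level_count n (Suc (Suc d)) k
      = (\<Sum>s\<in>{0..n}. real s * level_count n (Suc d) (k - int s)) + (\<Sum>s\<in>{0..n}. of_int (k - int s) * level_count n (Suc d) (k - int s))"
    by (simp add: sum_distrib_left sum.distrib[symmetric] algebra_simps del: level_count.simps(2)) (simp add: sum_distrib_left)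
  also have "(\<Sum>s\<in>{0..n}. of_int (k - int s) * level_count n (Suc d) (k - int s))
      = (\<Sum>s\<in>{0..n}. real (Suc d) * (\<Sum>t\<in>{0..n}. real t * level_count n d (k - int s - int t)))"
    by (simp only: Suc.IH)
  also have "\<dots> = real (Suc d) * (\<Sum>t\<in>{0..n}. \<Sum>s\<in>{0..n}. real t * level_count n d (k - int t - int s))"
    by (subst sum.swap) (simp add: sum_distrib_left algebra_simps)
  also have "\<dots> = real (Suc d) * (\<Sum>t\<in>{0..n}. real t * level_count n (Suc d) (k - int t))"
    by (simp add: sum_distrib_left)
  finally show ?case by (simp add: algebra_simps)
qed

text \<open>The discrete form of the B-spline recurrence. It comes from taking differences in
  \<open>k\<close> of the moment identity and removing the count at \<open>k - 1\<close> by
  \<open>level_count_diff\<close>.\<close>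

lemma level_count_rec:
  "real d * level_count n (Suc d) k
    = (of_int k + real d) * level_count n d k + (real (n * Suc d) + 1 - of_int k) * level_count n d (k - int n - 1)"
proof -
  let ?c = "level_count n (Suc d)" and ?N = "level_count n d"
  define M where "M k = (\<Sum>s\<in>{0..n}. real s * ?N (k - int s))" for k
  have "M (k - 1) = (\<Sum>s\<in>{0..n}. (real (Suc s) - 1) * ?N (k - int (Suc s)))"
    unfolding M_def by (rule sum.cong) (auto simp: algebra_simps)
  also have "\<dots> = (\<Sum>s\<in>{0..Suc n}. (real s - 1) * ?N (k - int s)) + ?N k"
    using sum.atLeast0_atMost_Suc_shift[of "\<lambda>s. (real s - 1) * ?N (k - int s)" n] by simp
  also have "\<dots> = M k - ?c k + real n * ?N (k - int n - 1) + ?N k"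
    by (simp add: M_def sum_subtractf algebra_simps)
  finally have "M k - M (k - 1) = ?c k - ?N k - real n * ?N (k - int n - 1)" by simp
  moreover have "real (Suc d) * M k = of_int k * ?c k" "real (Suc d) * M (k - 1) = of_int (k - 1) * ?c (k - 1)"
    unfolding M_def by (rule level_count_moment)+
  ultimately have "of_int k * ?c k - of_int (k - 1) * ?c (k - 1) = real (Suc d) * (?c k - ?N k - real n * ?N (k - int n - 1))"
    by (metis right_diff_distrib)
  moreover have "?c (k - 1) = ?c k - ?N k + ?N (k - int n - 1)" using level_count_diff[of n d k] by simp
  ultimately have "of_int k * ?c k - of_int (k - 1) * (?c k - ?N k + ?N (k - int n - 1))
      = real (Suc d) * (?c k - ?N k - real n * ?N (k - int n - 1))" by simp
  then show ?thesis by (simp del: level_count.simps add: algebra_simps)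
qed

text \<open>Together the hypotheses say that \<open>k\<close> is in the lower half and
  \<open>l\<close> is no farther than \<open>k\<close> from the centre, so unimodality and symmetry
  are covered at once. By \<open>level_count_diff\<close> a unit step compares two levels in one
  dimension less.\<close>

lemma level_count_mono: "k \<le> l \<Longrightarrow> k + l \<le> int (n * d) \<Longrightarrow> level_count n d k \<le> level_count n d l"
proof (induction d arbitrary: k l)
  case 0 then show ?case by auto
next
  case (Suc d)
  have step: "level_count n (Suc d) k \<le> level_count n (Suc d) (k + 1)" if "2 * k + 1 \<le> int (n * Suc d)" for k
  proof -
    have "level_count n d (k - int n) \<le> level_count n d (k + 1)"
      using that by (intro Suc.IH) (auto simp: algebra_simps)
    then show ?thesis using level_count_diff[of n d "k + 1"] by (simp del: level_count.simps)
  qed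
  have chain: "level_count n (Suc d) k \<le> level_count n (Suc d) (k + int j)" if "2 * (k + int j) \<le> int (n * Suc d) + 1" for k j
    using that
  proof (induction j)
    case (Suc j)
    have "level_count n (Suc d) k \<le> level_count n (Suc d) (k + int j)" using Suc.prems by (intro Suc.IH) simp
    also have "\<dots> \<le> level_count n (Suc d) (k + int j + 1)" using Suc.prems by (intro step) simp
    finally show ?case by (simp add: algebra_simps)
  qed simp
  show ?case
  proof (cases "2 * l \<le> int (n * Suc d) + 1")
    case True
    then show ?thesis using chain[of k "nat (l - k)"] Suc.prems(1) by simp
  next
    case False
    have e: "k + int (nat (int (n * Suc d) - l - k)) = int (n * Suc d) - l" using Suc.prems(2) by simp
    have arith: "\<not> 2 * l \<le> M + 1 \<Longrightarrow> 2 * (M - l) \<le> M + 1" for M l :: int by presburger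
    have "level_count n (Suc d) k \<le> level_count n (Suc d) (int (n * Suc d) - l)"
      by (rule chain[of k "nat (int (n * Suc d) - l - k)", unfolded e]) (rule arith[OF False])
    then show ?thesis by (simp only: level_count_sym)
  qed
qed

lemma level_count_le: "level_count n (Suc d) k \<le> real (Suc n) ^ d"
proof (induction d arbitrary: k)
  case 0
  have "level_count n (Suc 0) k \<le> (\<Sum>s\<in>{0..n}. if s = nat k then 1 else 0)"
    unfolding level_count.simps by (rule sum_mono) auto
  also have "\<dots> \<le> 1" by simp
  finally show ?case by simp
next
  case (Suc d)
  have "level_count n (Suc (Suc d)) k \<le> real (card {0..n}) * real (Suc n) ^ d"
    unfolding level_count.simps(2)[of n "Suc d"] by (rule sum_bounded_above) (rule Suc.IH)
  then show ?case by simp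
qed

lemma level_count_lipschitz:
  "\<bar>level_count n (Suc (Suc d)) k - level_count n (Suc (Suc d)) (k - 1)\<bar> \<le> real (Suc n) ^ d"
  unfolding level_count_diff
  using level_count_le[of n d k] level_count_le[of n d "k - int n - 1"]
    level_count_nonneg[of n "Suc d" k] level_count_nonneg[of n "Suc d" "k - int n - 1"] by linarith

lemma level_count_pos: "0 \<le> k \<Longrightarrow> k \<le> int (n * d) \<Longrightarrow> level_count n d k > 0"
proof (induction d arbitrary: k)
  case (Suc d)
  define s where "s = min n (nat k)"
  have "0 \<le> k - int s" "k - int s \<le> int (n * d)" using Suc.prems by (auto simp: s_def min_def algebra_simps)
  then have "0 < level_count n d (k - int s)" by (rule Suc.IH)
  also have "\<dots> \<le> level_count n (Suc d) k"
    using level_count_nonneg by (simp, intro member_le_sum[of s _ "\<lambda>s. level_count n d (k - int s)"]) (auto simp: s_def)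
  finally show ?case .
qed auto

lemma level_count_log_concave:
  assumes "i \<le> j" "s \<ge> 0"
  shows "level_count n d (i - s) * level_count n d (j + s) \<le> level_count n d i * level_count n d j"
  using assms
proof (induction d arbitrary: i j s)
  case 0
  then show ?case by auto
next
  case (Suc d)
  let ?g = "level_count n (Suc d)" and ?f = "level_count n d"
  have one: "?g (i - 1) * ?g (j + 1) \<le> ?g i * ?g j" if ij: "i \<le> j" for i j
  proof -
    have a: "?g (i - 1) = ?g i - ?f i + ?f (i - int n - 1)" using level_count_diff[of n d i] by simp
    have b: "?g j = ?g (j + 1) - ?f (j + 1) + ?f (j - int n)" using level_count_diff[of n d "j + 1"] by simp
    \<comment> \<open>After substituting \<open>a\<close> and \<open>b\<close> the claim is the sum
      of two inequalities, each of which holds term by term by the induction hypothesis.\<close>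
    have "?f (j + 1) * ?g i \<le> ?f i * ?g (j + 1)"
      unfolding level_count.simps(2) sum_distrib_left
    proof (rule sum_mono)
      fix t assume "t \<in> {0..n}"
      show "?f (j + 1) * ?f (i - int t) \<le> ?f i * ?f (j + 1 - int t)"
      proof (cases "i \<le> j + 1 - int t")
        case True
        then show ?thesis using Suc.IH[of i "j + 1 - int t" "int t"] by (simp add: mult.commute)
      next
        case False
        then show ?thesis using Suc.IH[of "j + 1 - int t" i "j + 1 - i"] ij by (simp add: mult.commute)
      qed
    qed
    moreover have "?f (i - int n - 1) * ?g (j + 1) \<le> ?f (j - int n) * ?g i"
      unfolding level_count.simps(2) sum_distrib_left
    proof (rule sum_mono)
      fix t assume t: "t \<in> {0..n}"
      show "?f (i - int n - 1) * ?f (j + 1 - int t) \<le> ?f (j - int n) * ?f (i - int t)"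
      proof (cases "j - int n \<le> i - int t")
        case True
        then show ?thesis using Suc.IH[of "j - int n" "i - int t" "j - i + 1"] ij by (simp add: algebra_simps)
      next
        case False
        then show ?thesis using Suc.IH[of "i - int t" "j - int n" "int n - int t + 1"] t by (simp add: algebra_simps)
      qed
    qed
    ultimately show ?thesis unfolding a b by (simp add: algebra_simps del: level_count.simps)
  qed
  have "?g (i - int s) * ?g (j + int s) \<le> ?g i * ?g j" for s
  proof (induction s)
    case (Suc s)
    have "?g (i - int s - 1) * ?g (j + int s + 1) \<le> ?g (i - int s) * ?g (j + int s)"
      using \<open>i \<le> j\<close> by (intro one) simp
    then show ?case using Suc.IH by (simp add: algebra_simps del: level_count.simps)
  qed (simp del: level_count.simps)
  from this[of "nat s"] \<open>s \<ge> 0\<close> show ?case by (simp del: level_count.simps)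
qed

lemma sum_level_insert:
  fixes f :: "('a \<Rightarrow> nat) \<Rightarrow> real"
  assumes J: "finite J" and j: "j \<notin> J"
  shows "sum f (level (insert j J) n k) = (\<Sum>s\<in>{s\<in>{0..n}. s \<le> k}. \<Sum>x\<in>level J n (k - s). f (x(j := s)))"
proof -
  have upd: "sum (x(j := s)) J = sum x J" for x :: "'a \<Rightarrow> nat" and s
    using j by (intro sum.cong) auto
  have upd': "(\<Sum>i\<in>J. if i = j then s else x i) = sum x J" for x :: "'a \<Rightarrow> nat" and s
    using j by (intro sum.cong) auto
  have "(\<Sum>s\<in>{s\<in>{0..n}. s \<le> k}. \<Sum>x\<in>level J n (k - s). f (x(j := s)))
      = (\<Sum>(s, x)\<in>Sigma {s\<in>{0..n}. s \<le> k} (\<lambda>s. level J n (k - s)). f (x(j := s)))"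
    using J by (intro sum.Sigma) (auto simp: finite_level)
  also have "\<dots> = sum f (level (insert j J) n k)"
    by (rule sum.reindex_bij_witness[of _ "\<lambda>x. (x j, x(j := 0))" "\<lambda>(s, x). x(j := s)"])
      (use J j in \<open>auto simp: level_def box_on_def upd upd' fun_eq_iff\<close>)
  finally show ?thesis by simp
qed

lemma card_level:
  fixes J :: "'a set"
  shows "finite J \<Longrightarrow> real (card (level J n k)) = level_count n (card J) (int k)"
proof (induction J arbitrary: k rule: finite_induct)
  case empty
  have "level ({} :: 'a set) n k = (if k = 0 then {\<lambda>_. 0} else {})" by (auto simp: level_def box_on_def)
  then show ?case by simp
next
  case (insert j J)
  have "real (card (level (insert j J) n k)) = (\<Sum>s\<in>{s\<in>{0..n}. s \<le> k}. \<Sum>x\<in>level J n (k - s). 1)"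
    using sum_level_insert[OF insert.hyps, of "\<lambda>_. 1" n k] by simp
  also have "\<dots> = (\<Sum>s\<in>{s\<in>{0..n}. s \<le> k}. level_count n (card J) (int k - int s))"
    by (rule sum.cong) (auto simp: insert.IH of_nat_diff)
  also have "\<dots> = (\<Sum>s\<in>{0..n}. level_count n (card J) (int k - int s))"
    by (rule sum.mono_neutral_left) (auto intro!: level_count_neg)
  finally show ?case using insert.hyps by simp
qed

lemma sum_fibres_le:
  fixes f :: "'b \<Rightarrow> real"
  assumes "finite K" "finite Y" "g ` K \<subseteq> Y" "\<And>y. y \<in> Y \<Longrightarrow> f y \<ge> 0"
    and "\<And>y. y \<in> Y \<Longrightarrow> card {x \<in> K. g x = y} \<le> c"
  shows "(\<Sum>x\<in>K. f (g x)) \<le> real c * sum f Y"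
proof -
  have "(\<Sum>x\<in>K. f (g x)) = (\<Sum>y\<in>Y. \<Sum>x\<in>{x \<in> K. g x = y}. f (g x))"
    by (rule sum.group[OF assms(1-3), symmetric])
  also have "\<dots> = (\<Sum>y\<in>Y. real (card {x \<in> K. g x = y}) * f y)"
    by (rule sum.cong) auto
  also have "\<dots> \<le> (\<Sum>y\<in>Y. real c * f y)"
    using assms by (intro sum_mono mult_right_mono) auto
  finally show ?thesis by (simp add: sum_distrib_left)
qed

lemma card_half_fibres:
  fixes y :: int
  shows "card {x \<in> K. x div 2 = y} \<le> 2" "card {x \<in> K. (x + 1) div 2 = y} \<le> 2"
    "card {x \<in> K. a + (x + 1) div 2 = y} \<le> 2" "card {x \<in> K. a - x div 2 = y} \<le> 2"
proof -
  have two: "card A \<le> 2" if "A \<subseteq> {i, j}" for A and i j :: int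
    using card_mono[OF _ that] card_insert_le_m1[of 2 "{j}" i] by (simp add: le_trans)
  show "card {x \<in> K. x div 2 = y} \<le> 2" by (rule two[of _ "2 * y" "2 * y + 1"]) auto
  show "card {x \<in> K. (x + 1) div 2 = y} \<le> 2" by (rule two[of _ "2 * y - 1" "2 * y"]) auto
  show "card {x \<in> K. a + (x + 1) div 2 = y} \<le> 2" by (rule two[of _ "2 * (y - a) - 1" "2 * (y - a)"]) auto
  show "card {x \<in> K. a - x div 2 = y} \<le> 2" by (rule two[of _ "2 * (a - y)" "2 * (a - y) + 1"]) auto
qed

section \<open>From level inequalities to the slab bound\<close>

text \<open>Expand each \<open>W\<close>-count into \<open>N\<close>-counts. A middle level is
  counted \<open>n + 1\<close> times; the levels near \<open>u\<close> and \<open>2 * u\<close> are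
  counted along ramps, and the ramp sums are first moments, known from
  \<open>level_count_moment\<close>. The last term vanishes at the stationary point.\<close>

lemma slab_count_formula:
  fixes u :: int
  assumes "int n < u"
  shows "(\<Sum>k\<in>{u..2 * u - 1}. level_count n (Suc D) k)
    = real (Suc n) * level_count n (Suc D) u + real (Suc n) * (\<Sum>k\<in>{u + 1..2 * u - int n - 1}. level_count n D k)
      - of_int u / real (Suc D) * (level_count n (Suc D) u - 2 * level_count n (Suc D) (2 * u))"
proof -
  let ?N = "level_count n D" and ?W = "level_count n (Suc D)"
  define mid where "mid = (\<Sum>k\<in>{u + 1..2 * u - int n - 1}. ?N k)"
  have part: "(\<Sum>k\<in>{u..2 * u - 1}. ?N (k - int s))
      = (\<Sum>t\<in>{0..n}. (if t \<le> s then ?N (u - int t) else 0)) + mid + (\<Sum>t\<in>{0..n}. (if s < t then ?N (2 * u - int t) else 0))"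
    if s: "s \<in> {0..n}" for s
  proof -
    have "(\<Sum>k\<in>{u..2 * u - 1}. ?N (k - int s)) = (\<Sum>x\<in>{u - int s..2 * u - 1 - int s}. ?N x)"
      by (rule sum.reindex_bij_witness[of _ "\<lambda>x. x + int s" "\<lambda>k. k - int s"]) auto
    also have "{u - int s..2 * u - 1 - int s} = {u - int s..u} \<union> {u + 1..2 * u - int n - 1} \<union> {2 * u - int n..2 * u - 1 - int s}"
      using s assms by auto
    also have "(\<Sum>x\<in>\<dots>. ?N x) = (\<Sum>x\<in>{u - int s..u}. ?N x) + mid + (\<Sum>x\<in>{2 * u - int n..2 * u - 1 - int s}. ?N x)"
      unfolding mid_def using s assms by (subst sum.union_disjoint; (subst sum.union_disjoint)?) auto
    also have "(\<Sum>x\<in>{u - int s..u}. ?N x) = (\<Sum>t\<in>{t \<in> {0..n}. t \<le> s}. ?N (u - int t))"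
      by (rule sum.reindex_bij_witness[of _ "\<lambda>t. u - int t" "\<lambda>x. nat (u - x)"]) (use s in auto)
    also have "\<dots> = (\<Sum>t\<in>{0..n}. (if t \<le> s then ?N (u - int t) else 0))" by (rule sum.inter_filter) simp
    also have "(\<Sum>x\<in>{2 * u - int n..2 * u - 1 - int s}. ?N x) = (\<Sum>t\<in>{t \<in> {0..n}. s < t}. ?N (2 * u - int t))"
      by (rule sum.reindex_bij_witness[of _ "\<lambda>t. 2 * u - int t" "\<lambda>x. nat (2 * u - x)"]) (use s in auto)
    also have "\<dots> = (\<Sum>t\<in>{0..n}. (if s < t then ?N (2 * u - int t) else 0))" by (rule sum.inter_filter) simp
    finally show ?thesis .
  qed
  have "(\<Sum>k\<in>{u..2 * u - 1}. ?W k) = (\<Sum>s\<in>{0..n}. \<Sum>k\<in>{u..2 * u - 1}. ?N (k - int s))"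
    unfolding level_count.simps by (rule sum.swap)
  also have "\<dots> = (\<Sum>s\<in>{0..n}. \<Sum>t\<in>{0..n}. (if t \<le> s then ?N (u - int t) else 0)) + real (Suc n) * mid
      + (\<Sum>s\<in>{0..n}. \<Sum>t\<in>{0..n}. (if s < t then ?N (2 * u - int t) else 0))"
    by (simp add: part sum.distrib)
  also have "(\<Sum>s\<in>{0..n}. \<Sum>t\<in>{0..n}. (if t \<le> s then ?N (u - int t) else 0))
      = (\<Sum>t\<in>{0..n}. \<Sum>s\<in>{s \<in> {0..n}. t \<le> s}. ?N (u - int t))"
    by (subst sum.swap) (simp only: sum.inter_filter finite_atLeastAtMost)
  also have "\<dots> = (\<Sum>t\<in>{0..n}. (real (Suc n) - real t) * ?N (u - int t))"
  proof (rule sum.cong[OF refl])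
    fix t assume t: "t \<in> {0..n}"
    have "{s \<in> {0..n}. t \<le> s} = {t..n}" by auto
    then show "(\<Sum>s\<in>{s \<in> {0..n}. t \<le> s}. ?N (u - int t)) = (real (Suc n) - real t) * ?N (u - int t)"
      using t by (simp add: of_nat_diff)
  qed
  also have "\<dots> = real (Suc n) * ?W u - (\<Sum>t\<in>{0..n}. real t * ?N (u - int t))"
    by (simp add: left_diff_distrib sum_subtractf sum_distrib_left)
  also have "(\<Sum>s\<in>{0..n}. \<Sum>t\<in>{0..n}. (if s < t then ?N (2 * u - int t) else 0))
      = (\<Sum>t\<in>{0..n}. \<Sum>s\<in>{s \<in> {0..n}. s < t}. ?N (2 * u - int t))"
    by (subst sum.swap) (simp only: sum.inter_filter finite_atLeastAtMost)
  also have "\<dots> = (\<Sum>t\<in>{0..n}. real t * ?N (2 * u - int t))"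
  proof (rule sum.cong[OF refl])
    fix t assume t: "t \<in> {0..n}"
    have "{s \<in> {0..n}. s < t} = {..<t}" using t by auto
    then show "(\<Sum>s\<in>{s \<in> {0..n}. s < t}. ?N (2 * u - int t)) = real t * ?N (2 * u - int t)" by simp
  qed
  finally have V: "(\<Sum>k\<in>{u..2 * u - 1}. ?W k) = real (Suc n) * ?W u - (\<Sum>t\<in>{0..n}. real t * ?N (u - int t))
      + real (Suc n) * mid + (\<Sum>t\<in>{0..n}. real t * ?N (2 * u - int t))" .
  have M: "(\<Sum>t\<in>{0..n}. real t * ?N (k - int t)) = of_int k / real (Suc D) * ?W k" for k
    using level_count_moment[of D n k] by (simp add: field_simps del: level_count.simps of_nat_Suc)
  show ?thesis unfolding V M mid_def by (simp add: algebra_simps del: level_count.simps of_nat_Suc)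
qed

text \<open>Here \<open>\<sigma> k\<close> stands for the total size of the fibres over base level
  \<open>k\<close>. Levels \<open>u + 1\<close> to \<open>2 * u - n - 1\<close> are the middle ones;
  the windows \<open>{u - n..u}\<close> and \<open>{2 * u - n..2 * u}\<close> are handled by
  \<open>sum2\<close>; the levels below and above these are charged to the middle by
  \<open>sum1\<close>, and \<open>C1\<close>, \<open>C2\<close> say that the middle can bear the
  charge.\<close>

lemma level_bound:
  fixes \<sigma> :: "int \<Rightarrow> real" and u :: int and n D :: nat
  defines "T \<equiv> int (n * D)" and "m \<equiv> real (Suc n)" and "N \<equiv> level_count n D" and "W \<equiv> level_count n (Suc D)"
  assumes D: "D \<ge> 2" and n: "n \<ge> 9"
    and \<sigma>0: "\<And>k. 0 \<le> \<sigma> k" and \<sigma>1: "\<And>k. \<sigma> k \<le> m * N k"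
    and sum1: "\<And>j k. 0 \<le> j \<Longrightarrow> 0 \<le> k \<Longrightarrow> j + k \<le> T \<Longrightarrow> \<sigma> j / N j + \<sigma> k / N k + \<sigma> (j + k) / N (j + k) \<le> 2 * m"
    and sum2: "2 * (\<Sum>s\<in>{0..n}. \<sigma> (u - int s)) / W u + (\<Sum>s\<in>{0..n}. \<sigma> (2 * u - int s)) / W (2 * u) \<le> 2 * m"
    and u1: "T + int n \<le> 3 * u" and u2: "2 * u \<le> T + int n" and u3: "int n < u"
    and C1: "\<And>y. u + 1 \<le> y \<Longrightarrow> y \<le> 2 * u - int n - 1 \<Longrightarrow> 2 * N (u - int n) \<le> N y"
    and C2: "\<And>y. u + 1 \<le> y \<Longrightarrow> y \<le> (T + 1) div 2 \<Longrightarrow> 2 * N (u - int n) + 4 * N (2 * u) \<le> N y"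
    and C3: "2 * W (2 * u) \<le> W u" "W u \<le> 2 * W (2 * u) + 5 * m ^ (D - 1)"
  shows "(\<Sum>k\<in>{0..T}. \<sigma> k) \<le> (\<Sum>k\<in>{u..2 * u - 1}. W k) + 8 * m ^ D"
proof -
  obtain D' where D': "D = Suc (Suc D')" using D by (metis add_2_eq_Suc le_Suc_ex)
  have Tge: "int c * int n \<le> T" if "c \<le> D" for c
    using that unfolding T_def by (metis mult.commute mult_le_mono1 of_nat_le_iff of_nat_mult)
  have T2: "2 * int n \<le> T" using Tge[of 2] D by simp
  have un: "int n \<le> u" using u3 by simp
  have m1: "m \<ge> 1" by (simp add: m_def)
  have N0: "N k \<ge> 0" for k unfolding N_def by (rule level_count_nonneg)
  have Nle: "m * N k \<le> m ^ D" for k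
  proof -
    have "N k \<le> m ^ Suc D'" unfolding N_def D' m_def by (rule level_count_le)
    then have "m * N k \<le> m * m ^ Suc D'" using m1 by (intro mult_left_mono) auto
    then show ?thesis by (simp add: D')
  qed
  have Npos: "N k > 0" if "0 \<le> k" "k \<le> T" for k using that unfolding N_def T_def by (rule level_count_pos)
  have \<sigma>z: "\<sigma> k = 0" if "k < 0 \<or> k > T" for k
  proof -
    have "N k = 0" using that level_count_neg level_count_big unfolding N_def T_def by blast
    then show ?thesis using \<sigma>0[of k] \<sigma>1[of k] by simp
  qed
  \<comment> \<open>The mean amount by which a fibre over level \<open>k\<close> falls short of full
    size. A triple inequality then bounds one level by the shortfalls of the other two.\<close>
  define \<mu> where "\<mu> k = m - \<sigma> k / N k" for k
  have \<mu>0: "\<mu> k \<ge> 0" if "0 \<le> k" "k \<le> T" for k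
    using \<sigma>1[of k] Npos[OF that] by (simp add: \<mu>_def field_simps)
  have \<sigma>\<mu>: "\<sigma> k = N k * (m - \<mu> k)" if "0 \<le> k" "k \<le> T" for k
    using Npos[OF that] by (simp add: \<mu>_def)
  have tri: "\<sigma> a \<le> N a * (\<mu> b + \<mu> c)" if "0 \<le> a" "a \<le> T" "a + b = c \<or> b + c = a" "0 \<le> b" "0 \<le> c" "c \<le> T" for a b c
  proof -
    have "\<sigma> a / N a + \<sigma> b / N b + \<sigma> c / N c \<le> 2 * m"
      using that sum1[of a b] sum1[of b c] by auto
    then have "\<sigma> a / N a \<le> \<mu> b + \<mu> c" by (simp add: \<mu>_def)
    then show ?thesis using Npos[of a] that by (simp add: field_simps)
  qed
  define e where "e = u - int n - 1"
  have midT: "2 * u - int n - 1 \<le> T" using u2 by linarith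
  define I1 where "I1 = {u + 1..u + e div 2}"
  define I2 where "I2 = {u + e - (e - 1) div 2..u + e}"
  define I3 where "I3 = {u + 1..(T + 1) div 2}"
  define mid where "mid = {u + 1..2 * u - int n - 1}"
  have mid_eq: "mid = {u + 1..u + e}" by (simp add: mid_def e_def)
  have I12: "I1 \<inter> I2 = {}" unfolding I1_def I2_def by auto
  \<comment> \<open>Level \<open>e - \<kappa>\<close> is the difference of the middle levels
    \<open>u + e - \<kappa> div 2\<close> and \<open>u + (\<kappa> + 1) div 2\<close>. Spreading
    both ends at half speed uses no middle level more than twice. The extreme levels 0 and
    \<open>e\<close> get the trivial bound \<open>m ^ D\<close>.\<close>
  have low: "(\<Sum>k\<in>{0..e}. \<sigma> k) \<le> 2 * m ^ D + 2 * N (u - int n) * (sum \<mu> I1 + sum \<mu> I2)"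
  proof (cases "e \<ge> 1")
    case True
    have "{0..e} = {0, e} \<union> {1..e - 1}" using True by auto
    then have "(\<Sum>k\<in>{0..e}. \<sigma> k) = (\<Sum>k\<in>{0, e}. \<sigma> k) + (\<Sum>k\<in>{1..e - 1}. \<sigma> k)"
      by (simp only:) (rule sum.union_disjoint; auto)
    moreover have "(\<Sum>k\<in>{0, e}. \<sigma> k) \<le> 2 * m ^ D"
      using \<sigma>1[of 0] \<sigma>1[of e] Nle[of 0] Nle[of e] True by simp
    moreover have "(\<Sum>k\<in>{1..e - 1}. \<sigma> k) = (\<Sum>\<kappa>\<in>{1..e - 1}. \<sigma> (e - \<kappa>))"
      by (rule sum.reindex_bij_witness[of _ "\<lambda>k. e - k" "\<lambda>k. e - k"]) auto
    moreover have "(\<Sum>\<kappa>\<in>{1..e - 1}. \<sigma> (e - \<kappa>))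
        \<le> (\<Sum>\<kappa>\<in>{1..e - 1}. N (u - int n) * (\<mu> (u + (\<kappa> + 1) div 2) + \<mu> (u + e - \<kappa> div 2)))"
    proof (rule sum_mono)
      fix \<kappa> assume \<kappa>: "\<kappa> \<in> {1..e - 1}"
      have e1: "e - \<kappa> + (u + (\<kappa> + 1) div 2) = u + e - \<kappa> div 2" by presburger
      have r: "0 \<le> u + (\<kappa> + 1) div 2" "u + (\<kappa> + 1) div 2 \<le> T" "0 \<le> u + e - \<kappa> div 2" "u + e - \<kappa> div 2 \<le> T"
        "0 \<le> e - \<kappa>" "e - \<kappa> \<le> T"
        using \<kappa> un midT unfolding e_def by (auto simp: divide_simps) 
      have "\<sigma> (e - \<kappa>) \<le> N (e - \<kappa>) * (\<mu> (u + (\<kappa> + 1) div 2) + \<mu> (u + e - \<kappa> div 2))"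
        using r e1 by (intro tri) auto
      also have "\<dots> \<le> N (u - int n) * (\<mu> (u + (\<kappa> + 1) div 2) + \<mu> (u + e - \<kappa> div 2))"
      proof (rule mult_right_mono)
        have "e - \<kappa> + (u - int n) \<le> T" using \<kappa> u2 n T2 unfolding e_def by auto
        then show "N (e - \<kappa>) \<le> N (u - int n)"
          unfolding N_def T_def using \<kappa> by (intro level_count_mono) (auto simp: e_def)
        show "0 \<le> \<mu> (u + (\<kappa> + 1) div 2) + \<mu> (u + e - \<kappa> div 2)" using \<mu>0 r by (intro add_nonneg_nonneg) auto
      qed
      finally show "\<sigma> (e - \<kappa>) \<le> \<dots>" .
    qed
    moreover have "\<dots> = N (u - int n) * ((\<Sum>\<kappa>\<in>{1..e - 1}. \<mu> (u + (\<kappa> + 1) div 2)) + (\<Sum>\<kappa>\<in>{1..e - 1}. \<mu> (u + e - \<kappa> div 2)))"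
      by (simp only: sum.distrib[symmetric] sum_distrib_left)
    moreover have "\<dots> \<le> N (u - int n) * (2 * sum \<mu> I1 + 2 * sum \<mu> I2)"
    proof (intro mult_left_mono add_mono N0)
      have "(\<Sum>\<kappa>\<in>{1..e - 1}. \<mu> (u + (\<kappa> + 1) div 2)) \<le> real 2 * sum \<mu> I1"
      proof (rule sum_fibres_le[OF _ _ _ _ card_half_fibres(3)])
        show "(\<lambda>\<kappa>. u + (\<kappa> + 1) div 2) ` {1..e - 1} \<subseteq> I1" unfolding I1_def by auto
        show "\<And>y. y \<in> I1 \<Longrightarrow> 0 \<le> \<mu> y" using un midT True unfolding I1_def e_def by (intro \<mu>0) auto
      qed (auto simp: I1_def)
      then show "(\<Sum>\<kappa>\<in>{1..e - 1}. \<mu> (u + (\<kappa> + 1) div 2)) \<le> 2 * sum \<mu> I1" by simp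
      have "(\<Sum>\<kappa>\<in>{1..e - 1}. \<mu> (u + e - \<kappa> div 2)) \<le> real 2 * sum \<mu> I2"
      proof (rule sum_fibres_le[OF _ _ _ _ card_half_fibres(4)])
        show "(\<lambda>\<kappa>. u + e - \<kappa> div 2) ` {1..e - 1} \<subseteq> I2" unfolding I2_def by auto
        show "\<And>y. y \<in> I2 \<Longrightarrow> 0 \<le> \<mu> y" using un midT True unfolding I2_def e_def by (intro \<mu>0) auto
      qed (auto simp: I2_def)
      then show "(\<Sum>\<kappa>\<in>{1..e - 1}. \<mu> (u + e - \<kappa> div 2)) \<le> 2 * sum \<mu> I2" by simp
    qed
    ultimately show ?thesis by (simp add: algebra_simps)
  next
    case False
    then have "{0..e} \<subseteq> {0}" by auto
    then have "(\<Sum>k\<in>{0..e}. \<sigma> k) \<le> \<sigma> 0" using sum_mono2[of "{0}" "{0..e}" \<sigma>] \<sigma>0 by simp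
    then have "(\<Sum>k\<in>{0..e}. \<sigma> k) \<le> 2 * m ^ D" using \<sigma>1[of 0] Nle[of 0] m1 by (smt (verit) zero_le_power)
    moreover have "I1 = {}" "I2 = {}" using False unfolding I1_def I2_def by auto
    ultimately show ?thesis by simp
  qed
  \<comment> \<open>For \<open>D = 2\<close> at most the level \<open>2 * u + 1\<close> can lie
    above the upper window, so \<open>I3\<close> is not charged. For \<open>D \<ge> 3\<close>, the
    bounds \<open>T \<ge> 3 * n\<close> and \<open>3 * u \<ge> T + n\<close> leave a margin of
    \<open>n / 6 - 3 / 2\<close>, which is where \<open>n \<ge> 9\<close> comes from.\<close>
  have I3mid: "I3 \<subseteq> mid \<or> T < 2 * u + 2"
  proof (cases "D = 2")
    case True
    then have "T = 2 * int n" by (simp add: T_def)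
    then show ?thesis using un by linarith
  next
    case False
    then have "3 * int n \<le> T" using D Tge[of 3] by simp
    then have "(T + 1) div 2 \<le> 2 * u - int n - 1" using u1 n by linarith
    then show ?thesis unfolding I3_def mid_def by auto
  qed
  have T4: "T \<le> 4 * u" using u1 un by linarith
  \<comment> \<open>A level \<open>k\<close> above the window is the sum of its two halves, and over
    all \<open>k\<close> each level of \<open>I3\<close> occurs at most four times as a half. The
    level \<open>2 * u + 1\<close> is bounded trivially because its lower half \<open>u\<close> is
    not a middle level.\<close>
  have high: "(\<Sum>k\<in>{2 * u + 1..T}. \<sigma> k) \<le> m ^ D + 4 * N (2 * u) * (if T < 2 * u + 2 then 0 else sum \<mu> I3)"
  proof (cases "T < 2 * u + 2")
    case True
    then have "{2 * u + 1..T} \<subseteq> {2 * u + 1}" by auto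
    then have "(\<Sum>k\<in>{2 * u + 1..T}. \<sigma> k) \<le> \<sigma> (2 * u + 1)"
      using sum_mono2[of "{2 * u + 1}" "{2 * u + 1..T}" \<sigma>] \<sigma>0 by simp
    then show ?thesis using \<sigma>1[of "2 * u + 1"] Nle[of "2 * u + 1"] True by simp
  next
    case False
    have "{2 * u + 1..T} = {2 * u + 1} \<union> {2 * u + 2..T}" using False by auto
    then have "(\<Sum>k\<in>{2 * u + 1..T}. \<sigma> k) = \<sigma> (2 * u + 1) + (\<Sum>k\<in>{2 * u + 2..T}. \<sigma> k)" by simp
    moreover have "\<sigma> (2 * u + 1) \<le> m ^ D" using \<sigma>1[of "2 * u + 1"] Nle[of "2 * u + 1"] by simp
    moreover have "(\<Sum>k\<in>{2 * u + 2..T}. \<sigma> k) \<le> (\<Sum>k\<in>{2 * u + 2..T}. N (2 * u) * (\<mu> (k div 2) + \<mu> ((k + 1) div 2)))"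
    proof (rule sum_mono)
      fix k assume k: "k \<in> {2 * u + 2..T}"
      have r: "0 \<le> k div 2" "0 \<le> (k + 1) div 2" "k div 2 \<le> T" "(k + 1) div 2 \<le> T" using k un T2 n by auto
      have "\<sigma> k \<le> N k * (\<mu> (k div 2) + \<mu> ((k + 1) div 2))"
      proof (rule tri)
        show "k + k div 2 = (k + 1) div 2 \<or> k div 2 + (k + 1) div 2 = k" by presburger
      qed (use r k un in auto)
      also have "\<dots> \<le> N (2 * u) * (\<mu> (k div 2) + \<mu> ((k + 1) div 2))"
      proof (rule mult_right_mono)
        have "T - k \<le> T - 2 * u" "(T - k) + (T - 2 * u) \<le> T" using k T4 by auto
        then have "level_count n D (T - k) \<le> level_count n D (T - 2 * u)"
          unfolding T_def by (rule level_count_mono)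
        then show "N k \<le> N (2 * u)" unfolding N_def T_def by (simp only: level_count_sym)
        show "0 \<le> \<mu> (k div 2) + \<mu> ((k + 1) div 2)" using \<mu>0 r by (intro add_nonneg_nonneg) auto
      qed
      finally show "\<sigma> k \<le> \<dots>" .
    qed
    moreover have "\<dots> = N (2 * u) * ((\<Sum>k\<in>{2 * u + 2..T}. \<mu> (k div 2)) + (\<Sum>k\<in>{2 * u + 2..T}. \<mu> ((k + 1) div 2)))"
      by (simp only: sum.distrib[symmetric] sum_distrib_left)
    moreover have "\<dots> \<le> N (2 * u) * (2 * sum \<mu> I3 + 2 * sum \<mu> I3)"
    proof (intro mult_left_mono add_mono N0)
      have nn: "\<And>y. y \<in> I3 \<Longrightarrow> 0 \<le> \<mu> y" using un T2 n unfolding I3_def by (intro \<mu>0) auto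
      have "(\<Sum>k\<in>{2 * u + 2..T}. \<mu> (k div 2)) \<le> real 2 * sum \<mu> I3"
      proof (rule sum_fibres_le[OF _ _ _ nn card_half_fibres(1)])
        show "(\<lambda>k. k div 2) ` {2 * u + 2..T} \<subseteq> I3" unfolding I3_def by auto
      qed (auto simp: I3_def)
      then show "(\<Sum>k\<in>{2 * u + 2..T}. \<mu> (k div 2)) \<le> 2 * sum \<mu> I3" by simp
      have "(\<Sum>k\<in>{2 * u + 2..T}. \<mu> ((k + 1) div 2)) \<le> real 2 * sum \<mu> I3"
      proof (rule sum_fibres_le[OF _ _ _ nn card_half_fibres(2)])
        show "(\<lambda>k. (k + 1) div 2) ` {2 * u + 2..T} \<subseteq> I3" unfolding I3_def by auto
      qed (auto simp: I3_def)
      then show "(\<Sum>k\<in>{2 * u + 2..T}. \<mu> ((k + 1) div 2)) \<le> 2 * sum \<mu> I3" by simp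
    qed
    ultimately show ?thesis using False by (simp add: algebra_simps)
  qed
  have \<mu>mid: "\<mu> y \<ge> 0" if "y \<in> mid" for y using that un midT unfolding mid_def by (intro \<mu>0) auto
  have demand: "2 * N (u - int n) * (sum \<mu> I1 + sum \<mu> I2) + 4 * N (2 * u) * (if T < 2 * u + 2 then 0 else sum \<mu> I3)
      \<le> (\<Sum>y\<in>mid. N y * \<mu> y)"
  proof -
    \<comment> \<open>\<open>c y\<close> is the total charge against the shortfall at level
      \<open>y\<close>; it has to stay below \<open>N y\<close>, the loss that this shortfall causes
      at level \<open>y\<close> itself.\<close>
    define c where "c y = (if y \<in> I1 \<union> I2 then 2 * N (u - int n) else 0) + (if T \<ge> 2 * u + 2 \<and> y \<in> I3 then 4 * N (2 * u) else 0)" for y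
    have sub: "I1 \<union> I2 \<subseteq> mid"
      unfolding mid_eq I1_def I2_def by auto
    have fin: "finite mid" by (simp add: mid_def)
    have ind: "sum \<mu> A = (\<Sum>y\<in>mid. if y \<in> A then \<mu> y else 0)" if "A \<subseteq> mid" for A
      using fin that by (simp add: sum.If_cases Int_absorb1)
    have "2 * N (u - int n) * (sum \<mu> I1 + sum \<mu> I2) = (\<Sum>y\<in>mid. (if y \<in> I1 \<union> I2 then 2 * N (u - int n) else 0) * \<mu> y)"
    proof -
      have "sum \<mu> I1 + sum \<mu> I2 = sum \<mu> (I1 \<union> I2)" using I12 by (subst sum.union_disjoint) (auto simp: I1_def I2_def)
      also have "\<dots> = (\<Sum>y\<in>mid. if y \<in> I1 \<union> I2 then \<mu> y else 0)"
        by (rule ind[OF sub])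
      finally show ?thesis by (simp only: sum_distrib_left) (rule sum.cong; simp)
    qed
    moreover have "4 * N (2 * u) * (if T < 2 * u + 2 then 0 else sum \<mu> I3)
        = (\<Sum>y\<in>mid. (if T \<ge> 2 * u + 2 \<and> y \<in> I3 then 4 * N (2 * u) else 0) * \<mu> y)"
    proof (cases "T < 2 * u + 2")
      case False
      then have "I3 \<subseteq> mid" using I3mid by blast
      then have "sum \<mu> I3 = (\<Sum>y\<in>mid. if y \<in> I3 then \<mu> y else 0)"
        by (rule ind)
      then show ?thesis using False by (auto simp: sum_distrib_left intro!: sum.cong)
    qed auto
    ultimately have "2 * N (u - int n) * (sum \<mu> I1 + sum \<mu> I2) + 4 * N (2 * u) * (if T < 2 * u + 2 then 0 else sum \<mu> I3)
        = (\<Sum>y\<in>mid. c y * \<mu> y)"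
      by (simp only: c_def distrib_right sum.distrib)
    also have "\<dots> \<le> (\<Sum>y\<in>mid. N y * \<mu> y)"
    proof (intro sum_mono mult_right_mono \<mu>mid)
      fix y assume y: "y \<in> mid"
      show "c y \<le> N y"
        using C1[of y] C2[of y] y N0[of "u - int n"] N0[of "2 * u"] N0[of y] unfolding c_def mid_def I3_def by auto
    qed
    finally show ?thesis .
  qed
  have mids: "(\<Sum>k\<in>mid. \<sigma> k) = m * (\<Sum>k\<in>mid. N k) - (\<Sum>k\<in>mid. N k * \<mu> k)"
  proof -
    have "(\<Sum>k\<in>mid. \<sigma> k) = (\<Sum>k\<in>mid. N k * (m - \<mu> k))"
      by (rule sum.cong[OF refl], rule \<sigma>\<mu>) (use un midT in \<open>auto simp: mid_def\<close>)
    then show ?thesis by (simp add: right_diff_distrib sum_subtractf sum_distrib_left mult.commute)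
  qed
  have Q: "(\<Sum>s\<in>{0..n}. \<sigma> (v - int s)) = sum \<sigma> {v - int n..v}" for v
    by (rule sum.reindex_bij_witness[of _ "\<lambda>x. nat (v - x)" "\<lambda>s. v - int s"]) auto
  have W2: "W (2 * u) > 0"
    using u2 un unfolding W_def T_def by (intro level_count_pos) (auto simp: algebra_simps)
  \<comment> \<open>Scaling \<open>sum2\<close> by \<open>W u / 2\<close> gives the lower window
    weight 1 and, since \<open>2 * W (2 * u) \<le> W u\<close>, the upper window weight at least
    1.\<close>
  have QP: "sum \<sigma> {u - int n..u} + sum \<sigma> {2 * u - int n..2 * u} \<le> m * W u"
  proof -
    define A where "A = sum \<sigma> {u - int n..u}"
    define B where "B = sum \<sigma> {2 * u - int n..2 * u}"
    have AB: "A \<ge> 0" "B \<ge> 0" unfolding A_def B_def by (auto intro: sum_nonneg \<sigma>0)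
    have Wu: "W u > 0" using C3 W2 by linarith
    have "B \<le> W u / 2 * (B / W (2 * u))"
    proof -
      have "B * (2 * W (2 * u)) \<le> B * W u" using AB C3 by (intro mult_left_mono) auto
      then show ?thesis using W2 by (simp add: field_simps)
    qed
    then have "A + B \<le> W u / 2 * (2 * A / W u + B / W (2 * u))" using Wu by (simp add: algebra_simps)
    also have "\<dots> \<le> W u / 2 * (2 * m)" using sum2 Wu unfolding Q A_def B_def by (intro mult_left_mono) auto
    finally show ?thesis unfolding A_def B_def by (simp add: mult.commute)
  qed
  have split: "(\<Sum>k\<in>{0..T}. \<sigma> k) \<le> sum \<sigma> {0..e} + sum \<sigma> {u - int n..u} + sum \<sigma> mid + sum \<sigma> {2 * u - int n..2 * u} + sum \<sigma> {2 * u + 1..T}"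
  proof -
    have "{0..T} \<subseteq> {0..e} \<union> {u - int n..u} \<union> mid \<union> {2 * u - int n..2 * u} \<union> {2 * u + 1..T}"
      unfolding mid_def e_def by auto
    then have "(\<Sum>k\<in>{0..T}. \<sigma> k) \<le> sum \<sigma> ({0..e} \<union> {u - int n..u} \<union> mid \<union> {2 * u - int n..2 * u} \<union> {2 * u + 1..T})"
      by (intro sum_mono2) (auto simp: mid_def \<sigma>0)
    also have "\<dots> \<le> sum \<sigma> {0..e} + sum \<sigma> {u - int n..u} + sum \<sigma> mid + sum \<sigma> {2 * u - int n..2 * u} + sum \<sigma> {2 * u + 1..T}"
    proof -
      have un_le: "sum \<sigma> (A \<union> B) \<le> sum \<sigma> A + sum \<sigma> B" if "finite A" "finite B" for A B
        using sum.union_inter[OF that, of \<sigma>] sum_nonneg[of "A \<inter> B" \<sigma>, OF \<sigma>0] by linarith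
      show ?thesis by (intro order_trans[OF un_le] add_mono order_refl) (auto simp: mid_def)
    qed
    finally show ?thesis .
  qed
  \<comment> \<open>The three levels bounded trivially cost \<open>3 * m ^ D\<close>; the inexact
    stationarity in \<open>C3\<close> costs another \<open>5 * m ^ D\<close>.\<close>
  have "(\<Sum>k\<in>{0..T}. \<sigma> k) \<le> m * W u + m * (\<Sum>k\<in>mid. N k) + 3 * m ^ D"
    using split low high demand mids QP by linarith
  also have "\<dots> \<le> (\<Sum>k\<in>{u..2 * u - 1}. W k) + 8 * m ^ D"
  proof -
    have "of_int u / real (Suc D) * (W u - 2 * W (2 * u)) \<le> real n * (5 * m ^ (D - 1))"
    proof (rule mult_mono)
      have "u \<le> int n * int (Suc D)" using u2 T2 un unfolding T_def by (simp add: algebra_simps)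
      then have "real_of_int u \<le> real n * real (Suc D)" by (metis of_int_le_iff of_int_mult of_int_of_nat_eq)
      then show "of_int u / real (Suc D) \<le> real n" by (simp add: divide_le_eq del: of_nat_Suc)
    qed (use C3 in auto)
    also have "\<dots> \<le> m * (5 * m ^ (D - 1))" using m1 by (intro mult_right_mono) (auto simp: m_def)
    also have "\<dots> = 5 * m ^ D" by (simp add: D')
    finally show ?thesis
      using slab_count_formula[OF u3, of D] unfolding m_def[symmetric] N_def[symmetric] W_def[symmetric] mid_def
      by linarith
  qed
  finally show ?thesis .
qed

section \<open>Fibres of sum-free sets\<close>

text \<open>The reflection of \<open>B\<close> in \<open>c\<close> is disjoint from
  \<open>A\<close>.\<close>

lemma card_sum_avoid:
  fixes A B :: "nat set"
  assumes "\<And>a b. a \<in> A \<Longrightarrow> b \<in> B \<Longrightarrow> a + b \<noteq> c"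
  shows "card (A \<inter> {..c}) + card (B \<inter> {..c}) \<le> c + 1"
proof -
  have "card (B \<inter> {..c}) = card ((\<lambda>b. c - b) ` (B \<inter> {..c}))"
    by (rule card_image[symmetric]) (auto simp: inj_on_def)
  moreover have "(A \<inter> {..c}) \<inter> (\<lambda>b. c - b) ` (B \<inter> {..c}) = {}"
    using assms by fastforce
  then have "card (A \<inter> {..c}) + card ((\<lambda>b. c - b) ` (B \<inter> {..c})) = card ((A \<inter> {..c}) \<union> (\<lambda>b. c - b) ` (B \<inter> {..c}))"
    by (intro card_Un_disjoint[symmetric]) auto
  moreover have "\<dots> \<le> card {..c}" by (intro card_mono) auto
  ultimately show ?thesis by simp
qed

text \<open>Let \<open>c = Max C\<close>. Up to \<open>c\<close> the sets \<open>A\<close> and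
  \<open>B\<close> share \<open>c + 1\<close> elements by \<open>card_sum_avoid\<close>, above
  \<open>c\<close> each has at most \<open>n - c\<close>, and \<open>C\<close> has at most
  \<open>c + 1\<close>, so that \<open>c\<close> cancels.\<close>

lemma card_sum_free_triple:
  fixes A B C :: "nat set"
  assumes sub: "A \<subseteq> {..n}" "B \<subseteq> {..n}" "C \<subseteq> {..n}"
    and avoid: "\<And>a b. a \<in> A \<Longrightarrow> b \<in> B \<Longrightarrow> a + b \<notin> C"
  shows "card A + card B + card C \<le> 2 * (n + 1)"
proof -
  have fin: "finite A" "finite B" "finite C" using sub by (auto intro: finite_subset)
  have le: "card X \<le> n + 1" if "X \<subseteq> {..n}" for X using card_mono[OF _ that] by simp
  show ?thesis
  proof (cases "C = {}")
    case True then show ?thesis using le[OF sub(1)] le[OF sub(2)] by simp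
  next
    case False
    define c where "c = Max C"
    have c: "c \<in> C" "C \<subseteq> {..c}" using False fin by (auto simp: c_def)
    have "c \<le> n" using c sub by auto
    have part: "card X \<le> card (X \<inter> {..c}) + (n - c)" if X: "X \<subseteq> {..n}" for X
    proof -
      have "X \<subseteq> (X \<inter> {..c}) \<union> {c<..n}" using X by auto
      then have "card X \<le> card ((X \<inter> {..c}) \<union> {c<..n})" by (intro card_mono) auto
      also have "\<dots> \<le> card (X \<inter> {..c}) + card {c<..n}" by (rule card_Un_le)
      finally show ?thesis by simp
    qed
    have "card (A \<inter> {..c}) + card (B \<inter> {..c}) \<le> c + 1" using avoid c by (intro card_sum_avoid) auto
    moreover have "card C \<le> c + 1" using card_mono[OF _ c(2)] by simp
    moreover obtain e where "n = c + e" using \<open>c \<le> n\<close> le_Suc_ex by blast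
    ultimately show ?thesis using part[OF sub(1)] part[OF sub(2)] by simp
  qed
qed

definition fibre :: "('a \<Rightarrow> nat) set \<Rightarrow> 'a \<Rightarrow> ('a \<Rightarrow> nat) \<Rightarrow> nat set" where
  "fibre S i q = {s. q(i := s) \<in> S}"

lemma fibre_subset: "S \<subseteq> box_on (insert i J) n \<Longrightarrow> fibre S i q \<subseteq> {..n}"
  unfolding fibre_def box_on_def by force

lemma card_eq_sum_fibres:
  assumes S: "S \<subseteq> box_on (insert i J) n" and J: "finite J" "i \<notin> J"
  shows "card S = (\<Sum>q\<in>box_on J n. card (fibre S i q))"
proof -
  have "(\<Sum>q\<in>box_on J n. card (fibre S i q)) = card (Sigma (box_on J n) (fibre S i))"
    using fibre_subset[OF S] finite_subset J finite_box_on
    by (intro card_SigmaI[symmetric]) (blast intro: finite_subset[OF _ finite_atMost])+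
  also have "\<dots> = card S"
  proof (rule bij_betw_same_card)
    show "bij_betw (\<lambda>(q, s). q(i := s)) (Sigma (box_on J n) (fibre S i)) S"
    proof (rule bij_betw_byWitness[where f' = "\<lambda>x. (x(i := 0), x i)"])
      show "\<forall>a\<in>Sigma (box_on J n) (fibre S i). (\<lambda>x. (x(i := 0), x i)) ((\<lambda>(q, s). q(i := s)) a) = a"
        using J by (auto simp: box_on_def fun_eq_iff)
      show "(\<lambda>x. (x(i := 0), x i)) ` S \<subseteq> Sigma (box_on J n) (fibre S i)"
        using S J by (auto simp: box_on_def fibre_def subset_iff)
    qed (auto simp: fibre_def)
  qed
  finally show ?thesis by simp
qed

theorem card_sum_free_le_slab_count:
  fixes S :: "('a \<Rightarrow> nat) set" and u :: int and n D :: nat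
  defines "T \<equiv> int (n * D)" and "m \<equiv> real (Suc n)" and "N \<equiv> level_count n D" and "W \<equiv> level_count n (Suc D)"
  assumes J: "finite J" "i \<notin> J" "card J = D" and S: "S \<subseteq> box_on (insert i J) n"
    and sum_free: "\<And>x y. x \<in> S \<Longrightarrow> y \<in> S \<Longrightarrow> (\<lambda>i. x i + y i) \<notin> S"
    and D: "D \<ge> 2" and n: "n \<ge> 9"
    and u: "T + int n \<le> 3 * u" "2 * u \<le> T + int n" "int n < u"
    and C1: "\<And>y. u + 1 \<le> y \<Longrightarrow> y \<le> 2 * u - int n - 1 \<Longrightarrow> 2 * N (u - int n) \<le> N y"
    and C2: "\<And>y. u + 1 \<le> y \<Longrightarrow> y \<le> (T + 1) div 2 \<Longrightarrow> 2 * N (u - int n) + 4 * N (2 * u) \<le> N y"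
    and C3: "2 * W (2 * u) \<le> W u" "W u \<le> 2 * W (2 * u) + 5 * m ^ (D - 1)"
  shows "real (card S) \<le> (\<Sum>k\<in>{u..2 * u - 1}. W k) + 8 * m ^ D"
proof -
  define a where "a q = real (card (fibre S i q))" for q
  define \<sigma> where "\<sigma> k = (\<Sum>q\<in>{q \<in> box_on J n. int (sum q J) = k}. a q)" for k
  have fin: "finite (box_on J n)" using J by (intro finite_box_on)
  have \<sigma>_int: "\<sigma> (int k) = sum a (level J n k)" for k
    unfolding \<sigma>_def level_def by (simp del: of_nat_sum)
  have \<sigma>_neg: "\<sigma> k = 0" if "k < 0" for k
  proof -
    have "{q \<in> box_on J n. int (sum q J) = k} = {}" using that by (auto simp del: of_nat_sum)
    then show ?thesis by (simp only: \<sigma>_def sum.empty)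
  qed
  have a0: "0 \<le> a q" for q by (simp add: a_def)
  have am: "a q \<le> m" for q
    using card_mono[OF _ fibre_subset[OF S, of q]] by (simp add: a_def m_def)
  have tri: "a q + a r + a (\<lambda>i. q i + r i) \<le> 2 * m" if "q \<in> box_on J n" "r \<in> box_on J n" for q r
  proof -
    have "card (fibre S i q) + card (fibre S i r) + card (fibre S i (\<lambda>i. q i + r i)) \<le> 2 * (n + 1)"
    proof (rule card_sum_free_triple)
      fix s t assume st: "s \<in> fibre S i q" "t \<in> fibre S i r"
      have "(\<lambda>i'. (q(i := s)) i' + (r(i := t)) i') \<notin> S"
        using sum_free[of "q(i := s)" "r(i := t)"] st unfolding fibre_def by blast
      moreover have "(\<lambda>i'. (q(i := s)) i' + (r(i := t)) i') = (\<lambda>i. q i + r i)(i := s + t)" by auto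
      ultimately show "s + t \<notin> fibre S i (\<lambda>i. q i + r i)" by (simp add: fibre_def)
    qed (rule fibre_subset[OF S])+
    then have "real (card (fibre S i q) + card (fibre S i r) + card (fibre S i (\<lambda>i. q i + r i))) \<le> real (2 * (n + 1))"
      by (simp only: of_nat_le_iff)
    then show ?thesis by (simp add: a_def m_def)
  qed
  have N_eq: "N (int k) = real (card (level J n k))" for k
    unfolding N_def J(3)[symmetric] by (rule card_level[OF J(1), symmetric])
  have cJ: "card (insert i J) = Suc D" using J by simp
  have W_eq: "W (int k) = real (card (level (insert i J) n k))" for k
    unfolding W_def cJ[symmetric] by (rule card_level[symmetric]) (use J in simp)
  have "real (card S) = (\<Sum>q\<in>box_on J n. a q)"
    using card_eq_sum_fibres[OF S J(1,2)] by (simp add: a_def)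
  also have "\<dots> = (\<Sum>k\<in>{0..T}. \<sigma> k)"
    unfolding \<sigma>_def
  proof (rule sum.group[symmetric, OF fin])
    have "sum q J \<le> n * D" if "q \<in> box_on J n" for q
      using sum_bounded_above[of J q n] that J by (auto simp: box_on_def mult.commute)
    then show "(\<lambda>q. int (sum q J)) ` box_on J n \<subseteq> {0..T}" by (auto simp: T_def simp del: of_nat_mult of_nat_sum)
  qed simp
  also have "\<dots> \<le> (\<Sum>k\<in>{u..2 * u - 1}. W k) + 8 * m ^ D"
    unfolding T_def m_def W_def
  proof (rule level_bound)
    show "0 \<le> \<sigma> k" for k unfolding \<sigma>_def by (intro sum_nonneg a0)
    show "\<sigma> k \<le> real (Suc n) * level_count n D k" for k
    proof (cases "k < 0")
      case False
      then have "\<sigma> k = sum a (level J n (nat k))" using \<sigma>_int[of "nat k"] by simp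
      also have "\<dots> \<le> real (card (level J n (nat k))) * m" by (intro sum_bounded_above am)
      also have "\<dots> = m * N k" using False N_eq[of "nat k"] by simp
      finally show ?thesis by (simp add: m_def N_def)
    qed (simp add: \<sigma>_neg level_count_neg)
    show "\<sigma> j / level_count n D j + \<sigma> k / level_count n D k + \<sigma> (j + k) / level_count n D (j + k) \<le> 2 * real (Suc n)"
      if "0 \<le> j" "0 \<le> k" "j + k \<le> int (n * D)" for j k
    proof -
      define j' k' where "j' = nat j" and "k' = nat k"
      have jk: "j = int j'" "k = int k'" "j + k = int (j' + k')" using that by (auto simp: j'_def k'_def)
      have "j' + k' \<le> n * card J" using that J jk by (metis of_nat_le_iff)
      then have "sum a (level J n j') / card (level J n j') + sum a (level J n k') / card (level J n k')
          + sum a (level J n (j' + k')) / card (level J n (j' + k')) \<le> 2 * m"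
        by (rule level_triple_mean[OF J(1)]) (rule tri; unfold level_def; blast)
      then have "\<sigma> (int j') / N (int j') + \<sigma> (int k') / N (int k') + \<sigma> (int (j' + k')) / N (int (j' + k')) \<le> 2 * m"
        by (simp only: \<sigma>_int N_eq)
      then show ?thesis by (simp only: jk(3)) (simp only: jk(1,2) N_def m_def)
    qed
    show "2 * (\<Sum>s = 0..n. \<sigma> (u - int s)) / level_count n (Suc D) u
        + (\<Sum>s = 0..n. \<sigma> (2 * u - int s)) / level_count n (Suc D) (2 * u) \<le> 2 * real (Suc n)"
    proof -
      \<comment> \<open>Regarded as a function on the full box that ignores coordinate
        \<open>i\<close>, the fibre size sums over a full level to the total of
        \<open>\<sigma>\<close> over \<open>n + 1\<close> consecutive base levels.\<close>
      define b where "b x = a (x(i := 0))" for x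
      define u' where "u' = nat u"
      have u': "u = int u'" "2 * u = int (u' + u')" using u by (auto simp: u'_def)
      have sums: "sum b (level (insert i J) n k) = (\<Sum>s = 0..n. \<sigma> (int k - int s))" for k
      proof -
        have "sum b (level (insert i J) n k) = (\<Sum>s\<in>{s \<in> {0..n}. s \<le> k}. \<Sum>x\<in>level J n (k - s). b (x(i := s)))"
          by (rule sum_level_insert[OF J(1,2)])
        also have "\<dots> = (\<Sum>s\<in>{s \<in> {0..n}. s \<le> k}. \<sigma> (int k - int s))"
        proof (rule sum.cong[OF refl])
          fix s assume s: "s \<in> {s \<in> {0..n}. s \<le> k}"
          have "(\<Sum>x\<in>level J n (k - s). b (x(i := s))) = sum a (level J n (k - s))"
          proof (rule sum.cong[OF refl])
            fix x assume "x \<in> level J n (k - s)"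
            then have "x i = 0" using J by (simp add: level_def box_on_def)
            then show "b (x(i := s)) = a x" by (simp add: b_def fun_upd_idem)
          qed
          then show "(\<Sum>x\<in>level J n (k - s). b (x(i := s))) = \<sigma> (int k - int s)"
            using s \<sigma>_int[of "k - s"] by (simp add: of_nat_diff)
        qed
        also have "\<dots> = (\<Sum>s = 0..n. \<sigma> (int k - int s))"
          by (rule sum.mono_neutral_left) (auto intro!: \<sigma>_neg)
        finally show ?thesis .
      qed
      have drop: "x(i := 0) \<in> box_on J n" if "x \<in> level (insert i J) n k" for x k
        using that by (auto simp: level_def box_on_def)
      have "int (u' + u') \<le> int (n * D + n)" using u(2) unfolding T_def u'(2) of_nat_add[of "n * D" n] .
      then have "u' + u' \<le> n * card (insert i J)" unfolding cJ of_nat_le_iff by simp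
      then have "sum b (level (insert i J) n u') / card (level (insert i J) n u') + sum b (level (insert i J) n u') / card (level (insert i J) n u')
          + sum b (level (insert i J) n (u' + u')) / card (level (insert i J) n (u' + u')) \<le> 2 * m"
      proof (rule level_triple_mean[rotated])
        fix q r assume qr: "q \<in> level (insert i J) n u'" "r \<in> level (insert i J) n u'"
        have "a (q(i := 0)) + a (r(i := 0)) + a (\<lambda>i'. (q(i := 0)) i' + (r(i := 0)) i') \<le> 2 * m"
          using drop qr by (intro tri) auto
        moreover have "(\<lambda>i'. (q(i := 0)) i' + (r(i := 0)) i') = (\<lambda>i. q i + r i)(i := 0)" by auto
        ultimately show "b q + b r + b (\<lambda>i. q i + r i) \<le> 2 * m" by (simp add: b_def)
      qed (use J in simp)
      then have "2 * (\<Sum>s = 0..n. \<sigma> (int u' - int s)) / W (int u')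
        + (\<Sum>s = 0..n. \<sigma> (int (u' + u') - int s)) / W (int (u' + u')) \<le> 2 * m"
        unfolding sums W_eq by simp
      then show ?thesis unfolding u'(2) unfolding u'(1) W_def m_def .
    qed
  qed (fact D n u[unfolded T_def] C1[unfolded N_def] C2[unfolded N_def T_def] C3[unfolded W_def m_def])+
  finally show ?thesis .
qed

section \<open>Cardinal B-splines\<close>

text \<open>The cardinal B-spline of order \<open>e + 2\<close>, that is, the density of a sum of
  \<open>e + 2\<close> independent uniform variables on \<open>[0, 1]\<close>, given by the Cox-de
  Boor recurrence. Starting from the hat function instead of an indicator keeps all members
  continuous, so that limits of counts exist at every point.\<close>

primrec spline :: "nat \<Rightarrow> real \<Rightarrow> real" where
  "spline 0 x = max 0 (min x (2 - x))"
| "spline (Suc e) x = (x * spline e x + (real e + 3 - x) * spline e (x - 1)) / (real e + 2)"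

lemma spline_outside: "x \<le> 0 \<or> real e + 2 \<le> x \<Longrightarrow> spline e x = 0"
proof (induction e arbitrary: x)
  case (Suc e)
  show ?case
  proof (cases "x \<le> 0")
    case True then show ?thesis using Suc.IH[of x] Suc.IH[of "x - 1"] by simp
  next
    case False
    then have "real e + 3 \<le> x" using Suc.prems by simp
    then show ?thesis using Suc.IH[of x] Suc.IH[of "x - 1"] by simp
  qed
qed auto

lemma spline_nonneg: "spline e x \<ge> 0"
proof (induction e arbitrary: x)
  case (Suc e)
  show ?case
  proof (cases "x \<le> 0 \<or> real (Suc e) + 2 \<le> x")
    case True then show ?thesis by (simp only: spline_outside)
  next
    case False
    then show ?thesis using Suc.IH by (auto intro!: divide_nonneg_nonneg add_nonneg_nonneg mult_nonneg_nonneg)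
  qed
qed auto

lemma spline_pos: "0 < x \<Longrightarrow> x < real e + 2 \<Longrightarrow> spline e x > 0"
proof (induction e arbitrary: x)
  case (Suc e)
  have "0 < x * spline e x + (real e + 3 - x) * spline e (x - 1)"
  proof (cases "x < real e + 2")
    case True
    then have "0 < x * spline e x" using Suc by simp
    moreover have "0 \<le> (real e + 3 - x) * spline e (x - 1)" using True spline_nonneg by (intro mult_nonneg_nonneg) auto
    ultimately show ?thesis by simp
  next
    case False
    then have "0 < (real e + 3 - x) * spline e (x - 1)" using Suc.prems by (intro mult_pos_pos Suc.IH) auto
    moreover have "0 \<le> x * spline e x" using Suc.prems spline_nonneg by (intro mult_nonneg_nonneg) auto
    ultimately show ?thesis by simp
  qed
  then show ?case by (simp add: add_pos_pos)
qed auto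

lemma level_count_1: "level_count n (Suc 0) k = (if 0 \<le> k \<and> k \<le> int n then 1 else 0)"
proof (cases "0 \<le> k \<and> k \<le> int n")
  case True
  have "level_count n (Suc 0) k = (\<Sum>s\<in>{0..n}. if s = nat k then 1 else 0)"
    unfolding level_count.simps using True by (intro sum.cong) auto
  also have "\<dots> = 1" using True nat_le_iff[of k n] by (simp add: sum.delta' nat_le_iff)
  finally show ?thesis using True by (simp del: level_count.simps)
next
  case False
  then show ?thesis by (auto simp: level_count_neg level_count_big simp del: level_count.simps)
qed

lemma level_count_2: "0 \<le> k \<Longrightarrow> k \<le> int n \<Longrightarrow> level_count n (Suc (Suc 0)) k = of_int k + 1"
proof -
  assume k: "0 \<le> k" "k \<le> int n"
  have "level_count n (Suc (Suc 0)) k = (\<Sum>s\<in>{0..n}. if s \<in> {0..nat k} then 1 else 0)"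
    unfolding level_count.simps(2)[of n "Suc 0"] level_count_1 using k by (intro sum.cong) auto
  also have "\<dots> = (\<Sum>s\<in>{0..nat k}. 1)" using k by (intro sum.mono_neutral_cong_right) auto
  finally show ?thesis using k by simp
qed

lemma level_count_2_eq:
  "level_count n (Suc (Suc 0)) k = max 0 (min (of_int k + 1) (2 * real n + 1 - of_int k))"
proof -
  consider "k < 0" | "0 \<le> k" "k \<le> int n" | "int n < k" "k \<le> 2 * int n" | "2 * int n < k" by linarith
  then show ?thesis
  proof cases
    case 1 then show ?thesis by (simp add: level_count_neg del: level_count.simps)
  next
    case 2
    then have "of_int k \<le> real n" by linarith
    then show ?thesis using level_count_2[OF 2] 2 by simp
  next
    case 3
    have "real n < of_int k" using 3 by linarith
    moreover have "of_int k \<le> 2 * real n" using 3 by linarith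
    moreover have "level_count n (Suc (Suc 0)) k = of_int (2 * int n - k) + 1"
      using level_count_2[of "2 * int n - k" n] level_count_sym[of n "Suc (Suc 0)" k] 3
      by (simp add: mult.commute del: level_count.simps)
    ultimately show ?thesis by simp
  next
    case 4
    then have "2 * real n + 1 \<le> of_int k" by linarith
    then show ?thesis using 4 by (simp add: level_count_big del: level_count.simps)
  qed
qed

text \<open>\<open>level_count_rec\<close>, rescaled, tends to the spline recurrence. Through this
  limit the splines inherit monotonicity and log-concavity from the counts.\<close>

lemma level_count_tendsto:
  assumes "(\<lambda>n. of_int (k n) / real n) \<longlonglongrightarrow> x"
  shows "(\<lambda>n. level_count n (e + 2) (k n) / real n ^ (e + 1)) \<longlonglongrightarrow> spline e x"
  using assms
proof (induction e arbitrary: k x)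
  case 0
  have "(\<lambda>n. max 0 (min (of_int (k n) / real n + 1 / real n) (2 + 1 / real n - of_int (k n) / real n))) \<longlonglongrightarrow> max 0 (min (x + 0) (2 + 0 - x))"
    by (intro tendsto_intros tendsto_max tendsto_min 0 lim_1_over_n)
  moreover have "\<forall>\<^sub>F n in sequentially. max 0 (min (of_int (k n) / real n + 1 / real n) (2 + 1 / real n - of_int (k n) / real n))
      = level_count n (0 + 2) (k n) / real n ^ (0 + 1)"
    using eventually_gt_at_top[of 0]
  proof eventually_elim
    case (elim n)
    have "max 0 (min (of_int (k n) + 1) (2 * real n + 1 - of_int (k n))) / real n
      = max 0 (min ((of_int (k n) + 1) / real n) ((2 * real n + 1 - of_int (k n)) / real n))"
      using elim by (simp add: max_divide_distrib_right min_divide_distrib_right)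
    also have "\<dots> = max 0 (min (of_int (k n) / real n + 1 / real n) (2 + 1 / real n - of_int (k n) / real n))"
      using elim by (simp add: add_divide_distrib diff_divide_distrib)
    finally show ?case unfolding add_0 numeral_2_eq_2 level_count_2_eq by simp
  qed
  ultimately have "(\<lambda>n. level_count n (0 + 2) (k n) / real n ^ (0 + 1)) \<longlonglongrightarrow> max 0 (min (x + 0) (2 + 0 - x))"
    by (rule Lim_transform_eventually)
  then show ?case by (simp del: level_count.simps)
next
  case (Suc e)
  let ?d = "e + 2"
  have lim1: "(\<lambda>n. 1 / real n) \<longlonglongrightarrow> 0" by (rule lim_1_over_n)
  have "(\<lambda>n. of_int (k n) / real n - 1 - 1 / real n) \<longlonglongrightarrow> x - 1 - 0"
    by (intro tendsto_intros Suc.prems lim1)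
  moreover have "\<forall>\<^sub>F n in sequentially. of_int (k n) / real n - 1 - 1 / real n = of_int (k n - int n - 1) / real n"
    using eventually_gt_at_top[of 0] by eventually_elim (simp add: field_simps)
  ultimately have "(\<lambda>n. of_int (k n - int n - 1) / real n) \<longlonglongrightarrow> x - 1 - 0"
    by (rule Lim_transform_eventually)
  then have k': "(\<lambda>n. of_int (k n - int n - 1) / real n) \<longlonglongrightarrow> x - 1" by simp
  have "(\<lambda>n. ((of_int (k n) / real n + real ?d * (1 / real n)) * (level_count n (e + 2) (k n) / real n ^ (e + 1))
       + (real (Suc ?d) + 1 / real n - of_int (k n) / real n) * (level_count n (e + 2) (k n - int n - 1) / real n ^ (e + 1))) / real ?d)
     \<longlonglongrightarrow> ((x + real ?d * 0) * spline e x + (real (Suc ?d) + 0 - x) * spline e (x - 1)) / real ?d"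
    by (intro tendsto_intros Suc lim1 k') simp
  moreover have "\<forall>\<^sub>F n in sequentially. ((of_int (k n) / real n + real ?d * (1 / real n)) * (level_count n (e + 2) (k n) / real n ^ (e + 1))
       + (real (Suc ?d) + 1 / real n - of_int (k n) / real n) * (level_count n (e + 2) (k n - int n - 1) / real n ^ (e + 1))) / real ?d
     = level_count n (Suc e + 2) (k n) / real n ^ (Suc e + 1)"
    using eventually_gt_at_top[of 0]
  proof eventually_elim
    case (elim n)
    define A where "A = level_count n (e + 2) (k n)"
    define B where "B = level_count n (e + 2) (k n - int n - 1)"
    have "real ?d * level_count n (Suc ?d) (k n) = (of_int (k n) + real ?d) * A + (real (n * Suc ?d) + 1 - of_int (k n)) * B"
      unfolding A_def B_def by (rule level_count_rec)
    then have X: "(of_int (k n) + real ?d) * A + (real (n * Suc ?d) + 1 - of_int (k n)) * B = real ?d * level_count n (Suc e + 2) (k n)"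
      by (simp del: level_count.simps)
    have c: "of_int (k n) / real n + real ?d * (1 / real n) = (of_int (k n) + real ?d) / real n"
      "real (Suc ?d) + 1 / real n - of_int (k n) / real n = (real (n * Suc ?d) + 1 - of_int (k n)) / real n"
      using elim by (simp_all add: add_divide_distrib diff_divide_distrib)
    have "(of_int (k n) + real ?d) / real n * (A / real n ^ (e + 1))
        + (real (n * Suc ?d) + 1 - of_int (k n)) / real n * (B / real n ^ (e + 1))
        = ((of_int (k n) + real ?d) * A + (real (n * Suc ?d) + 1 - of_int (k n)) * B) / (real n * real n ^ (e + 1))"
      by (simp only: times_divide_times_eq add_divide_distrib[symmetric])
    also have "\<dots> = real ?d * level_count n (Suc e + 2) (k n) / real n ^ (Suc e + 1)"
      unfolding X by simp
    finally show ?case unfolding A_def[symmetric] B_def[symmetric] c by (simp del: level_count.simps)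
  qed
  ultimately have "(\<lambda>n. level_count n (Suc e + 2) (k n) / real n ^ (Suc e + 1)) \<longlonglongrightarrow> ((x + real ?d * 0) * spline e x + (real (Suc ?d) + 0 - x) * spline e (x - 1)) / real ?d"
    by (rule Lim_transform_eventually)
  then show ?case by (simp add: algebra_simps del: level_count.simps)
qed

lemma floor_mult_tendsto: "(\<lambda>n. of_int \<lfloor>x * real n\<rfloor> / real n) \<longlonglongrightarrow> (x::real)"
proof (rule tendsto_sandwich)
  show "\<forall>\<^sub>F n in sequentially. x - 1 / real n \<le> of_int \<lfloor>x * real n\<rfloor> / real n"
    using eventually_gt_at_top[of 0] 
  proof eventually_elim
    case (elim n)
    have "(x - 1 / real n) * real n = x * real n - 1" using elim by (simp add: algebra_simps)
    also have "\<dots> \<le> of_int \<lfloor>x * real n\<rfloor>" by linarith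
    finally show ?case using elim by (simp add: pos_le_divide_eq)
  qed
  show "\<forall>\<^sub>F n in sequentially. of_int \<lfloor>x * real n\<rfloor> / real n \<le> x"
    using eventually_gt_at_top[of 0] by eventually_elim (simp add: field_simps)
  have "(\<lambda>n. x - 1 / real n) \<longlonglongrightarrow> x - 0" by (intro tendsto_intros lim_1_over_n)
  then show "(\<lambda>n. x - 1 / real n) \<longlonglongrightarrow> x" by simp
qed simp

section \<open>Monotonicity, log-concavity and ratio bounds for splines\<close>

lemma spline_mono:
  assumes "x \<le> y" "x + y \<le> real e + 2" shows "spline e x \<le> spline e y"
proof (rule LIMSEQ_le[OF level_count_tendsto[OF floor_mult_tendsto] level_count_tendsto[OF floor_mult_tendsto]])
  have "level_count n (e + 2) \<lfloor>x * real n\<rfloor> \<le> level_count n (e + 2) \<lfloor>y * real n\<rfloor>" for n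
  proof (rule level_count_mono)
    show "\<lfloor>x * real n\<rfloor> \<le> \<lfloor>y * real n\<rfloor>" using assms by (intro floor_mono mult_right_mono) auto
    have "(x + y) * real n \<le> (real e + 2) * real n" using assms by (intro mult_right_mono) auto
    then have "of_int (\<lfloor>x * real n\<rfloor> + \<lfloor>y * real n\<rfloor>) \<le> real (n * (e + 2))"
      by (simp add: algebra_simps) linarith
    then show "\<lfloor>x * real n\<rfloor> + \<lfloor>y * real n\<rfloor> \<le> int (n * (e + 2))" by linarith
  qed
  then show "\<exists>N. \<forall>n\<ge>N. level_count n (e + 2) \<lfloor>x * real n\<rfloor> / real n ^ (e + 1) \<le> level_count n (e + 2) \<lfloor>y * real n\<rfloor> / real n ^ (e + 1)"
    by (intro exI allI impI divide_right_mono) auto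
qed

lemma spline_log_concave:
  assumes "x \<le> y" "s \<ge> 0" shows "spline e (x - s) * spline e (y + s) \<le> spline e x * spline e y"
proof -
  let ?k = "\<lambda>z n. \<lfloor>z * real n\<rfloor>"
  have minus: "(\<lambda>n. of_int (?k x n - ?k s n) / real n) \<longlonglongrightarrow> x - s"
    using tendsto_diff[OF floor_mult_tendsto[of x] floor_mult_tendsto[of s]] by (simp add: diff_divide_distrib)
  have plus: "(\<lambda>n. of_int (?k y n + ?k s n) / real n) \<longlonglongrightarrow> y + s"
    using tendsto_add[OF floor_mult_tendsto[of y] floor_mult_tendsto[of s]] by (simp add: add_divide_distrib)
  show ?thesis
  proof (rule LIMSEQ_le[OF tendsto_mult[OF level_count_tendsto[OF minus] level_count_tendsto[OF plus]]
        tendsto_mult[OF level_count_tendsto[OF floor_mult_tendsto] level_count_tendsto[OF floor_mult_tendsto]]])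
    have "level_count n (e + 2) (?k x n - ?k s n) * level_count n (e + 2) (?k y n + ?k s n)
        \<le> level_count n (e + 2) (?k x n) * level_count n (e + 2) (?k y n)" for n
      using assms by (intro level_count_log_concave floor_mono mult_right_mono) auto
    then show "\<exists>N. \<forall>n\<ge>N. level_count n (e + 2) (?k x n - ?k s n) / real n ^ (e + 1) * (level_count n (e + 2) (?k y n + ?k s n) / real n ^ (e + 1))
        \<le> level_count n (e + 2) (?k x n) / real n ^ (e + 1) * (level_count n (e + 2) (?k y n) / real n ^ (e + 1))"
      by (intro exI allI impI) (simp add: divide_right_mono del: level_count.simps)
  qed
qed

text \<open>The exponent 3 is the one of the Gaussian limit: with \<open>d = e + 2\<close> the
  variance is \<open>d / 12\<close>, so at distance \<open>t\<close> below the centre a unit step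
  changes the density by about \<open>exp (- 12 * t / d)\<close>, which is also the size of
  \<open>(x / (d - x)) ^ 3\<close>. In the induction the recurrence combines the bounds at
  \<open>x\<close> and at \<open>x - 1\<close>.\<close>

lemma spline_cubic:
  assumes "0 \<le> x" "2 * x \<le> real e + 2"
  shows "(real e + 2 - x) ^ 3 * spline e (x - 1) \<le> x ^ 3 * spline e x"
  using assms
proof (induction e arbitrary: x)
  case 0
  then have "spline 0 (x - 1) = 0" by (intro spline_outside) auto
  then show ?case using 0 spline_nonneg[of 0 x] by simp
next
  case (Suc e)
  show ?case
  proof (cases "x < 1")
    case True
    then have "spline (Suc e) (x - 1) = 0" by (intro spline_outside) auto
    then show ?thesis using Suc.prems spline_nonneg[of "Suc e" x] by (simp del: spline.simps)
  next
    case False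
    define B where "B = real e + 3 - x"
    have B: "x \<le> B" "1 < B" using Suc.prems by (auto simp: B_def)
    let ?N = "spline e"
    \<comment> \<open>\<open>x\<close> may lie beyond the centre of the spline of index
      \<open>e\<close> by up to 1/2; there \<open>B - 1 \<le> x\<close> and monotonicity replaces
      the induction hypothesis.\<close>
    have n1: "(B - 1) ^ 3 * ?N (x - 1) \<le> x ^ 3 * ?N x"
    proof (cases "2 * x \<le> real e + 2")
      case True
      then show ?thesis using Suc.IH[of x] Suc.prems by (simp add: B_def algebra_simps)
    next
      case False
      have "(B - 1) ^ 3 \<le> x ^ 3" using False B by (intro power_mono) (auto simp: B_def)
      moreover have "?N (x - 1) \<le> ?N x" using Suc.prems by (intro spline_mono) auto
      ultimately show ?thesis using spline_nonneg B Suc.prems by (intro mult_mono) auto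
    qed
    have n2: "B ^ 3 * ?N (x - 2) \<le> (x - 1) ^ 3 * ?N (x - 1)"
      using Suc.IH[of "x - 1"] Suc.prems False by (simp add: B_def algebra_simps)
    have "B ^ 3 * ((x - 1) * ?N (x - 1) + (B + 1) * ?N (x - 2))
        = B ^ 3 * (x - 1) * ?N (x - 1) + (B + 1) * (B ^ 3 * ?N (x - 2))" by (simp add: algebra_simps)
    also have "\<dots> \<le> B ^ 3 * (x - 1) * ?N (x - 1) + (B + 1) * ((x - 1) ^ 3 * ?N (x - 1))"
      using n2 B False by (intro add_mono mult_left_mono) auto
    also have "\<dots> = (B ^ 3 * (x - 1) + (B + 1) * (x - 1) ^ 3) * ?N (x - 1)" by (simp add: algebra_simps)
    also have "\<dots> \<le> (x * (B - 1) ^ 3 + x ^ 3 * B) * ?N (x - 1)"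
    proof (rule mult_right_mono[OF _ spline_nonneg])
      have "x * (B - 1) ^ 3 + x ^ 3 * B - (B ^ 3 * (x - 1) + (B + 1) * (x - 1) ^ 3)
          = (B - x) ^ 3 + (B - x) + (3 * x * (x - 1) + 1)" by (simp add: power3_eq_cube algebra_simps)
      also have "\<dots> \<ge> 0" using B False by (intro add_nonneg_nonneg) auto
      finally show "B ^ 3 * (x - 1) + (B + 1) * (x - 1) ^ 3 \<le> x * (B - 1) ^ 3 + x ^ 3 * B" by simp
    qed
    also have "\<dots> = x * ((B - 1) ^ 3 * ?N (x - 1)) + x ^ 3 * B * ?N (x - 1)" by (simp add: algebra_simps)
    also have "\<dots> \<le> x * (x ^ 3 * ?N x) + x ^ 3 * B * ?N (x - 1)"
      using n1 Suc.prems B by (intro add_mono mult_left_mono) auto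
    also have "\<dots> = x ^ 3 * (x * ?N x + B * ?N (x - 1))" by (simp add: algebra_simps)
    finally have *: "B ^ 3 * ((x - 1) * ?N (x - 1) + (B + 1) * ?N (x - 2)) \<le> x ^ 3 * (x * ?N x + B * ?N (x - 1))" .
    have "spline (Suc e) (x - 1) = ((x - 1) * ?N (x - 1) + (B + 1) * ?N (x - 2)) / (real e + 2)"
      "spline (Suc e) x = (x * ?N x + B * ?N (x - 1)) / (real e + 2)"
      by (simp_all add: B_def algebra_simps)
    then show ?thesis using divide_right_mono[OF *, of "real e + 2"] by (simp add: B_def algebra_simps)
  qed
qed

text \<open>The cubic bound compares the two points at distance 1/2 on either side of
  \<open>x\<close>, and log-concavity places the value at \<open>x\<close> above their geometric
  mean. This suffices because \<open>(3/5) ^ 3 = 27/125 < 1/4\<close>.\<close>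

lemma spline_half_step:
  assumes "0 < x" "2 * x + 1 \<le> real e + 2" "x + 1/2 \<le> 3/5 * (real e + 3/2 - x)"
  shows "2 * spline e (x - 1/2) < spline e x"
proof -
  define B where "B = real e + 3/2 - x"
  let ?h = "spline e (x - 1/2)" and ?g = "spline e (x + 1/2)"
  have B: "0 < B" using assms by (simp add: B_def)
  have "B ^ 3 * ?h \<le> (x + 1/2) ^ 3 * ?g"
    using spline_cubic[of "x + 1/2" e] assms by (simp add: B_def algebra_simps)
  also have "\<dots> \<le> (3/5 * B) ^ 3 * ?g"
    using assms by (intro mult_right_mono power_mono spline_nonneg) (auto simp: B_def)
  also have "\<dots> = B ^ 3 * (27/125 * ?g)" by (simp add: power_mult_distrib power3_eq_cube)
  finally have hg: "?h \<le> 27/125 * ?g" using B by simp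
  have "?h ^ 2 \<le> ?h * (27/125 * ?g)" unfolding power2_eq_square using hg by (intro mult_left_mono spline_nonneg)
  also have "\<dots> \<le> 27/125 * spline e x ^ 2"
    using spline_log_concave[of x x "1/2" e] by (simp add: power2_eq_square)
  also have "\<dots> < (spline e x / 2) ^ 2"
    using spline_pos[of x e] assms by (simp add: power2_eq_square field_simps)
  finally have "?h < spline e x / 2"
    by (rule power2_less_imp_less) (simp add: spline_nonneg)
  then show ?thesis by simp
qed

text \<open>By log-concavity \<open>f x / f (x - 5/6)\<close> is at least the fifth power of \<open>f (x + 1/6) / f x\<close>,
  which turns the cubic bound for a unit step into a bound for a step of length \<open>5/6\<close>.\<close>

lemma spline_large:
  assumes e: "e \<ge> 38"
  defines "x \<equiv> (2 * real e + 6) / 6"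
  shows "2 * spline e (x - 5/6) + 4 * spline e (x - 1) < spline e x"
proof -
  let ?f = "spline e x" and ?g = "spline e (x + 1/6)" and ?h = "spline e (x - 5/6)"
  have e': "real e \<ge> 38" using e by simp
  have f: "0 < ?f" using e' by (intro spline_pos) (auto simp: x_def)
  have h0: "0 \<le> ?h" and g0: "0 \<le> ?g" by (rule spline_nonneg)+
  define B where "B = real e + 2 - x"
  \<comment> \<open>82/158 and 83/157 are the ratios \<open>x / B\<close> and
    \<open>(x + 1/6) / (B - 1/6)\<close> at \<open>e = 38\<close>; both decrease with
    \<open>e\<close>. They lead to the bounds 14/100 and 21/100 below, and
    \<open>2 * 21/100 + 4 * 14/100 = 98/100 < 1\<close>.\<close>
  have B: "0 < B" "x \<le> 82/158 * B" "x + 1/6 \<le> 83/157 * (B - 1/6)" "0 < x" "1 < B" using e' by (auto simp: B_def x_def field_simps)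
  have "B ^ 3 * spline e (x - 1) \<le> x ^ 3 * ?f"
    using spline_cubic[of x e] e' by (simp add: B_def x_def)
  also have "\<dots> \<le> (82/158 * B) ^ 3 * ?f"
    using B f by (intro mult_right_mono power_mono) auto
  also have "\<dots> = B ^ 3 * ((82/158) ^ 3 * ?f)" by (simp only: power_mult_distrib mult_ac)
  finally have "spline e (x - 1) \<le> (82/158) ^ 3 * ?f" using B by simp
  also have "\<dots> \<le> 14/100 * ?f" using f by (intro mult_right_mono) (auto simp: power3_eq_cube)
  finally have one: "spline e (x - 1) \<le> 14/100 * ?f" .
  have "(B - 1/6) ^ 3 * ?h \<le> (x + 1/6) ^ 3 * ?g"
  proof -
    have "x + 1/6 - 1 = x - 5/6" "real e + 2 - (x + 1/6) = B - 1/6" by (simp_all add: B_def)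
    moreover have "2 * (x + 1/6) \<le> real e + 2" "0 \<le> x + 1/6" using e' by (auto simp: x_def field_simps)
    ultimately show ?thesis using spline_cubic[of "x + 1/6" e] by (simp only:)
  qed
  also have "\<dots> \<le> (83/157 * (B - 1/6)) ^ 3 * ?g"
    using B g0 by (intro mult_right_mono power_mono) auto
  also have "\<dots> = (B - 1/6) ^ 3 * ((83/157) ^ 3 * ?g)" by (simp only: power_mult_distrib mult_ac)
  finally have "?h \<le> (83/157) ^ 3 * ?g" using B by simp
  also have "\<dots> \<le> 148/1000 * ?g" using g0 by (intro mult_right_mono) (auto simp: power3_eq_cube)
  finally have hg: "?h \<le> 148/1000 * ?g" .
  have pow: "?g ^ j * spline e (x - real j / 6) \<le> ?f ^ Suc j" for j
  proof (induction j)
    case (Suc j)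
    have *: "spline e (x - real (Suc j) / 6) * ?g \<le> spline e (x - real j / 6) * ?f"
      using spline_log_concave[of "x - real j / 6" x "1/6" e] by (simp add: algebra_simps add_divide_distrib diff_divide_distrib)
    have "?g ^ Suc j * spline e (x - real (Suc j) / 6) \<le> ?g ^ j * (spline e (x - real j / 6) * ?f)"
      using mult_left_mono[OF *, of "?g ^ j"] g0 by (simp add: mult_ac del: of_nat_Suc)
    also have "\<dots> \<le> ?f ^ Suc j * ?f" using mult_right_mono[OF Suc.IH, of ?f] f by (simp add: mult_ac)
    finally show ?case by (simp add: mult_ac)
  qed simp
  have "?h ^ 6 = ?h ^ 5 * ?h" by (simp add: eval_nat_numeral)
  also have "\<dots> \<le> (148/1000 * ?g) ^ 5 * ?h" using hg h0 by (intro mult_right_mono power_mono) auto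
  also have "\<dots> = (148/1000) ^ 5 * (?g ^ 5 * ?h)" by (simp only: power_mult_distrib mult_ac)
  also have "\<dots> \<le> (148/1000) ^ 5 * ?f ^ 6" using pow[of 5] by simp
  also have "\<dots> \<le> (21/100) ^ 6 * ?f ^ 6" using f by (intro mult_right_mono) (auto simp: eval_nat_numeral)
  also have "\<dots> = (21/100 * ?f) ^ 6" by (simp only: power_mult_distrib)
  finally have "?h ^ Suc 5 \<le> (21/100 * ?f) ^ Suc 5" by simp
  then have "?h \<le> 21/100 * ?f" by (rule power_le_imp_le_base) (use f in simp)
  then show ?thesis using one f by simp
qed

text \<open>\<open>spline_num e y\<close> is \<open>6 ^ (e + 1) * fact (e + 1) * spline e (y / 6)\<close>.\<close>

primrec spline_num :: "nat \<Rightarrow> int \<Rightarrow> int" where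
  "spline_num 0 y = max 0 (min y (12 - y))"
| "spline_num (Suc e) y = y * spline_num e y + (6 * (int e + 3) - y) * spline_num e (y - 6)"

lemma spline_eq_num: "6 ^ (e + 1) * fact (e + 1) * spline e (of_int y / 6) = of_int (spline_num e y)"
proof (induction e arbitrary: y)
  case 0
  show ?case by (simp add: max_def min_def) 
next
  case (Suc e)
  have m: "of_int y / 6 - 1 = (of_int (y - 6) / 6 :: real)" by (simp add: diff_divide_distrib)
  define P where "P = (6 ^ (e + 1) * fact (e + 1) :: real)"
  define X where "X = spline e (of_int y / 6)"
  define Y where "Y = spline e (of_int (y - 6) / 6)"
  have "6 ^ (Suc e + 1) * fact (Suc e + 1) = 6 * (real e + 2) * P"
    by (simp add: P_def algebra_simps)
  then have "6 ^ (Suc e + 1) * fact (Suc e + 1) * spline (Suc e) (of_int y / 6)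
      = (6 * (real e + 2) * P) * ((of_int y / 6 * X + (real e + 3 - of_int y / 6) * Y) / (real e + 2))"
    by (simp only: spline.simps m X_def Y_def)
  also have "\<dots> = of_int y * (P * X) + (6 * (real e + 3) - of_int y) * (P * Y)"
    by (simp add: field_simps)
  also have "\<dots> = of_int (spline_num (Suc e) y)"
    unfolding P_def X_def Y_def Suc.IH by simp
  finally show ?case .
qed

lemma spline_num_nonpos: "y \<le> 0 \<Longrightarrow> spline_num e y = 0"
  by (induction e arbitrary: y) auto

text \<open>One step of the recurrence on a whole table. The six zeros in front shift the argument
  by 6, the numerators vanishing at negative arguments.\<close>

definition num_step :: "int \<Rightarrow> int list \<Rightarrow> int list" where
  "num_step c xs = map (\<lambda>(y, x, p). y * x + (c - y) * p) (zip [0..83] (zip xs (replicate 6 0 @ xs)))"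

text \<open>The entries read off at stage \<open>e\<close> are the numerators at
  \<open>2 * e\<close> to \<open>2 * e + 6\<close>. The three comparisons are the inequalities
  required of the spline of index \<open>e\<close>.\<close>

primrec num_check :: "nat \<Rightarrow> nat \<Rightarrow> int list \<Rightarrow> bool" where
  "num_check 0 e xs = True"
| "num_check (Suc k) e xs = ((case drop (2 * e) xs of a # b # c # d # f # g # h # _ \<Rightarrow>
      2 * c < g \<and> 2 * b < f \<and> 2 * b + 4 * a < h | _ \<Rightarrow> False)
    \<and> num_check k (Suc e) (num_step (6 * (int e + 3)) xs))"

definition num_list :: "nat \<Rightarrow> int list" where
  "num_list e = map (\<lambda>i. spline_num e (int i)) [0..<84]"

lemma num_step_num_list: "num_step (6 * (int e + 3)) (num_list e) = num_list (Suc e)"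
proof (rule nth_equalityI)
  show "length (num_step (6 * (int e + 3)) (num_list e)) = length (num_list (Suc e))"
    by (simp add: num_step_def num_list_def)
next
  fix i assume "i < length (num_step (6 * (int e + 3)) (num_list e))"
  then have i: "i < 84" by (simp add: num_step_def num_list_def)
  have "spline_num e (int i - 6) = 0" if "i < 6" using that by (intro spline_num_nonpos) auto
  then have "(replicate 6 0 @ num_list e) ! i = spline_num e (int i - 6)"
    using i by (auto simp: nth_append num_list_def of_nat_diff)
  then show "num_step (6 * (int e + 3)) (num_list e) ! i = num_list (Suc e) ! i"
    using i by (simp add: num_step_def num_list_def nth_upto del: upto_rec_numeral)
qed

lemma num_checkD:
  "num_check k e (num_list e) \<Longrightarrow> i < k \<Longrightarrow> 2 * (e + i) + 6 < 84 \<Longrightarrow>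
    2 * spline_num (e + i) (2 * int (e + i) + 2) < spline_num (e + i) (2 * int (e + i) + 5) \<and>
    2 * spline_num (e + i) (2 * int (e + i) + 1) < spline_num (e + i) (2 * int (e + i) + 4) \<and>
    2 * spline_num (e + i) (2 * int (e + i) + 1) + 4 * spline_num (e + i) (2 * int (e + i)) < spline_num (e + i) (2 * int (e + i) + 6)"
proof (induction k arbitrary: e i)
  case (Suc k)
  show ?case
  proof (cases i)
    case 0
    have nth: "drop (2 * e) (num_list e) ! j = spline_num e (2 * int e + int j)" if "j \<le> 6" for j
      using that Suc.prems 0 by (simp add: num_list_def)
    from Suc.prems(1) obtain a b c d f g h r where
      "drop (2 * e) (num_list e) = a # b # c # d # f # g # h # r" and
      ineq: "2 * c < g" "2 * b < f" "2 * b + 4 * a < h"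
      by (auto split: list.splits)
    then show ?thesis using nth[of 0] nth[of 1] nth[of 2] nth[of 4] nth[of 5] nth[of 6] ineq 0 by simp
  next
    case (Suc i')
    have "num_check k (Suc e) (num_list (Suc e))"
      using Suc.prems(1) num_step_num_list[of e] by simp
    then show ?thesis using Suc.IH[of "Suc e" i'] Suc.prems Suc by simp
  qed
qed simp

text \<open>39 stages cover \<open>e \<le> 38\<close>, whose largest argument is
  \<open>2 * 38 + 6 = 82\<close>. An entry depends only on entries at the same or smaller arguments,
  so a table of length 84 is enough.\<close>

lemma num_check: "num_check 39 0 (map (\<lambda>i. max 0 (min i (12 - i))) [0..83])"
  by code_simp

lemma spline_num_ineqs:
  assumes "e < 39"
  shows "2 * spline_num e (2 * int e + 2) < spline_num e (2 * int e + 5)"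
    "2 * spline_num e (2 * int e + 1) < spline_num e (2 * int e + 4)"
    "2 * spline_num e (2 * int e + 1) + 4 * spline_num e (2 * int e) < spline_num e (2 * int e + 6)"
proof -
  have "num_list 0 = map (\<lambda>i. max 0 (min i (12 - i))) [0..83]"
    by (rule nth_equalityI) (simp_all add: num_list_def nth_upto del: upto_rec_numeral)
  then have "num_check 39 0 (num_list 0)" using num_check by (simp only:)
  then have "2 * spline_num (0 + e) (2 * int (0 + e) + 2) < spline_num (0 + e) (2 * int (0 + e) + 5) \<and>
    2 * spline_num (0 + e) (2 * int (0 + e) + 1) < spline_num (0 + e) (2 * int (0 + e) + 4) \<and>
    2 * spline_num (0 + e) (2 * int (0 + e) + 1) + 4 * spline_num (0 + e) (2 * int (0 + e)) < spline_num (0 + e) (2 * int (0 + e) + 6)"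
    by (rule num_checkD) (use assms in auto)
  then show "2 * spline_num e (2 * int e + 2) < spline_num e (2 * int e + 5)"
    "2 * spline_num e (2 * int e + 1) < spline_num e (2 * int e + 4)"
    "2 * spline_num e (2 * int e + 1) + 4 * spline_num e (2 * int e) < spline_num e (2 * int e + 6)"
    by (simp_all only: add_0)
qed

lemma spline_of_num: "spline e (of_int y / 6) = of_int (spline_num e y) / (6 ^ (e + 1) * fact (e + 1))"
  using spline_eq_num[of e y] by (simp add: field_simps del: spline.simps fact_Suc power_Suc)

lemma spline_ineq_small:
  assumes "a * spline_num e x + b * spline_num e y < spline_num e z"
  shows "of_int a * spline e (of_int x / 6) + of_int b * spline e (of_int y / 6) < spline e (of_int z / 6)"
proof -
  have "(of_int (a * spline_num e x + b * spline_num e y) :: real) < of_int (spline_num e z)"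
    using assms by (simp only: of_int_less_iff)
  then show ?thesis
    unfolding spline_of_num by (simp add: divide_strict_right_mono add_divide_distrib[symmetric] del: fact_Suc)
qed

section \<open>The three spline inequalities\<close>

text \<open>The limit of \<open>2 * W (2 * u) < W u\<close> at
  \<open>u = (2 * e + 7) / 6 * n\<close>: reflection in the centre sends \<open>2 * u\<close> to
  \<open>(2 * e + 4) / 6 * n\<close>.\<close>

lemma spline_ineq_1: "2 * spline (Suc e) ((2 * real e + 4) / 6) < spline (Suc e) ((2 * real e + 7) / 6)"
proof (cases "e < 38")
  case True
  then show ?thesis
    using spline_ineq_small[of 2 "Suc e" "2 * int (Suc e) + 2" 0 0 "2 * int (Suc e) + 5"] spline_num_ineqs(1)[of "Suc e"]
    by (simp add: algebra_simps del: spline.simps spline_num.simps)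
next
  case False
  have "(2 * real e + 7) / 6 - 1/2 = (2 * real e + 4) / 6" by (simp add: field_simps)
  moreover have "2 * spline (Suc e) ((2 * real e + 7) / 6 - 1/2) < spline (Suc e) ((2 * real e + 7) / 6)"
    using False by (intro spline_half_step) (auto simp: field_simps)
  ultimately show ?thesis by (simp only:)
qed

text \<open>For the same \<open>u\<close>, this compares \<open>u - n\<close> with the upper end
  \<open>2 * u - n\<close> of the middle levels, reflected to
  \<open>(2 * e + 4) / 6 * n\<close>.\<close>

lemma spline_ineq_2: "2 * spline e ((2 * real e + 1) / 6) < spline e ((2 * real e + 4) / 6)"
proof (cases "e < 38")
  case True
  then show ?thesis
    using spline_ineq_small[of 2 e "2 * int e + 1" 0 0 "2 * int e + 4"] spline_num_ineqs(2)[of e]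
    by (simp del: spline.simps spline_num.simps)
next
  case False
  have "(2 * real e + 4) / 6 - 1/2 = (2 * real e + 1) / 6" by (simp add: field_simps)
  moreover have "2 * spline (e) ((2 * real e + 4) / 6 - 1/2) < spline (e) ((2 * real e + 4) / 6)"
    using False by (intro spline_half_step) (auto simp: field_simps)
  ultimately show ?thesis by (simp only:)
qed

text \<open>The first term belongs to the largest admissible \<open>u\<close> and the other two to
  the smallest, \<open>(2 * e + 6) / 6 * n\<close>, so the inequality serves every \<open>u\<close>
  in between.\<close>

lemma spline_ineq_3:
  "2 * spline e ((2 * real e + 1) / 6) + 4 * spline e (2 * real e / 6) < spline e ((2 * real e + 6) / 6)"
proof (cases "e < 38")
  case True
  then show ?thesis
    using spline_ineq_small[of 2 e "2 * int e + 1" 4 "2 * int e" "2 * int e + 6"] spline_num_ineqs(3)[of e]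
    by (simp del: spline.simps spline_num.simps)
next
  case False
  have "(2 * real e + 6) / 6 - 5/6 = (2 * real e + 1) / 6" "(2 * real e + 6) / 6 - 1 = 2 * real e / 6"
    by (simp_all add: field_simps)
  then show ?thesis using spline_large[of e] False by (simp only: not_less)
qed

section \<open>Choice of the threshold for large \<open>n\<close>\<close>

lemma near_linear_tendsto:
  assumes "\<And>n. \<bar>of_int (k n) - x * real n\<bar> \<le> c"
  shows "(\<lambda>n. of_int (k n) / real n) \<longlonglongrightarrow> x"
proof (rule LIM_zero_cancel, rule Lim_null_comparison)
  show "\<forall>\<^sub>F n in sequentially. norm (of_int (k n) / real n - x) \<le> c * (1 / real n)"
    using eventually_gt_at_top[of 0]
  proof eventually_elim
    case (elim n)
    then have "of_int (k n) / real n - x = (of_int (k n) - x * real n) / real n" by (simp add: field_simps)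
    then show ?case using assms[of n] elim by (simp add: abs_divide divide_right_mono)
  qed
  show "(\<lambda>n. c * (1 / real n)) \<longlonglongrightarrow> 0"
    using tendsto_mult_left[OF lim_1_over_n, of c] by simp
qed

lemma eventually_less_of_tendsto:
  fixes f g :: "nat \<Rightarrow> real"
  assumes "(\<lambda>n. f n / real n ^ p) \<longlonglongrightarrow> a" "(\<lambda>n. g n / real n ^ p) \<longlonglongrightarrow> b" "a < b"
  shows "\<forall>\<^sub>F n in sequentially. f n < g n"
proof -
  obtain c where c: "a < c" "c < b" using assms(3) dense by blast
  show ?thesis
    using order_tendstoD(2)[OF assms(1) c(1)] order_tendstoD(1)[OF assms(2) c(2)] eventually_gt_at_top[of 0]
  proof eventually_elim
    case (elim n)
    then have "f n / real n ^ p < g n / real n ^ p" by linarith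
    then show ?case using elim by (simp add: divide_less_cancel)
  qed
qed

lemma exists_least_int_between:
  fixes a b :: int
  assumes "a \<le> b" "P b"
  shows "\<exists>u. a \<le> u \<and> u \<le> b \<and> P u \<and> (u = a \<or> \<not> P (u - 1))"
  using assms
proof (induction b rule: int_ge_induct)
  case (step b)
  show ?case
  proof (cases "P b")
    case True then show ?thesis using step by force
  next
    case False then show ?thesis using step by (intro exI[of _ "b + 1"]) auto
  qed
qed auto

lemma level_count_lipschitz_steps:
  "\<bar>level_count n (e + 3) k - level_count n (e + 3) (k - int j)\<bar> \<le> real j * real (Suc n) ^ (e + 1)"
proof (induction j)
  case (Suc j)
  have "\<bar>level_count n (e + 3) (k - int j) - level_count n (e + 3) (k - int j - 1)\<bar> \<le> real (Suc n) ^ (e + 1)"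
    using level_count_lipschitz[of n "e + 1" "k - int j"] by (simp add: numeral_3_eq_3 del: level_count.simps)
  moreover have "k - int (Suc j) = k - int j - 1" by simp
  moreover have "real (Suc j) * real (Suc n) ^ (e + 1) = real j * real (Suc n) ^ (e + 1) + real (Suc n) ^ (e + 1)"
    by (simp add: algebra_simps)
  ultimately show ?case using Suc.IH by (simp only:)
qed simp

text \<open>Near \<open>u0\<close> the levels \<open>u\<close> and \<open>2 * u\<close> are mirror
  images, so \<open>W u\<close> is about \<open>W (2 * u)\<close>; at \<open>u1\<close>, about
  \<open>n / 6\<close> higher, already \<open>2 * W (2 * u) < W u\<close>. The least
  \<open>u\<close> from \<open>u0\<close> to \<open>u1\<close> with
  \<open>2 * W (2 * u) \<le> W u\<close> nearly attains equality or is \<open>u0\<close> itself. The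
  conditions on \<open>N\<close> hold on the whole range by monotonicity from its ends.\<close>

lemma eventually_threshold:
  fixes e :: nat
  shows "\<forall>\<^sub>F n in sequentially. \<exists>u. 9 \<le> n \<and> int (n * (e + 2)) + int n \<le> 3 * u \<and> 2 * u \<le> int (n * (e + 2)) + int n \<and> int n < u
    \<and> (\<forall>y. u + 1 \<le> y \<longrightarrow> y \<le> 2 * u - int n - 1 \<longrightarrow> 2 * level_count n (e + 2) (u - int n) \<le> level_count n (e + 2) y)
    \<and> (\<forall>y. u + 1 \<le> y \<longrightarrow> y \<le> (int (n * (e + 2)) + 1) div 2 \<longrightarrow>
        2 * level_count n (e + 2) (u - int n) + 4 * level_count n (e + 2) (2 * u) \<le> level_count n (e + 2) y)
    \<and> 2 * level_count n (e + 3) (2 * u) \<le> level_count n (e + 3) u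
    \<and> level_count n (e + 3) u \<le> 2 * level_count n (e + 3) (2 * u) + 5 * real (Suc n) ^ (e + 1)"
proof -
  define T where "T n = int (n * (e + 2))" for n :: nat
  \<comment> \<open>The maximum secures \<open>n < u\<close> also for \<open>e = 0\<close>, where
    \<open>(T n + n) / 3 = n\<close>.\<close>
  define u0 where "u0 n = max ((T n + int n + 2) div 3) (int n + 1)" for n
  define u1 where "u1 n = ((2 * int e + 7) * int n) div 6" for n :: nat
  have Tr: "real_of_int (T n) = (real e + 2) * real n" for n by (simp add: T_def algebra_simps)
  have Tn: "2 * int n \<le> T n" for n by (simp add: T_def algebra_simps)
  have div3: "x \<le> 3 * ((x + 2) div 3)" "3 * ((x + 2) div 3) \<le> x + 2" for x :: int by presburger+
  have u0_lower: "T n + int n \<le> 3 * u0 n" "int n < u0 n" for n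
    using div3(1)[of "T n + int n"] by (auto simp: u0_def max_def)
  have u0_upper: "3 * u0 n \<le> T n + int n + 3" for n
    using Tn[of n] div3(2)[of "T n + int n"] by (auto simp: u0_def max_def)
  have u1_bounds: "6 * u1 n \<le> 2 * T n + 3 * int n" "2 * T n + 3 * int n \<le> 6 * u1 n + 5" for n
    unfolding u1_def T_def by (simp_all add: algebra_simps) presburger?
  have "\<bar>of_int (u0 n) - (2 * real e + 6) / 6 * real n\<bar> \<le> 1" for n
  proof -
    have "of_int (T n + int n) \<le> real_of_int (3 * u0 n)" "real_of_int (3 * u0 n) \<le> of_int (T n + int n + 3)"
      using u0_lower[of n] u0_upper[of n] by (simp_all only: of_int_le_iff)
    then show ?thesis by (simp add: Tr abs_le_iff field_simps)
  qed
  note u0_lim = near_linear_tendsto[OF this]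
  have "\<bar>of_int (T n - 2 * u0 n) - 2 * real e / 6 * real n\<bar> \<le> 2" for n
  proof -
    have "of_int (T n + int n) \<le> real_of_int (3 * u0 n)" "real_of_int (3 * u0 n) \<le> of_int (T n + int n + 3)"
      using u0_lower[of n] u0_upper[of n] by (simp_all only: of_int_le_iff)
    then show ?thesis by (simp add: Tr abs_le_iff field_simps)
  qed
  note T0_lim = near_linear_tendsto[OF this]
  have u1r: "real_of_int (6 * u1 n) \<le> of_int (2 * T n + 3 * int n)" "of_int (2 * T n + 3 * int n) \<le> real_of_int (6 * u1 n + 5)" for n
    using u1_bounds[of n] by (simp_all only: of_int_le_iff)
  have "\<bar>of_int (u1 n) - (2 * real e + 7) / 6 * real n\<bar> \<le> 1" for n
    using u1r[of n] by (simp add: Tr abs_le_iff field_simps)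
  note u1_lim = near_linear_tendsto[OF this]
  have "\<bar>of_int (u1 n - int n) - (2 * real e + 1) / 6 * real n\<bar> \<le> 1" for n
    using u1r[of n] by (simp add: Tr abs_le_iff field_simps)
  note u1n_lim = near_linear_tendsto[OF this]
  have "\<bar>of_int (T n + int n - 2 * u1 n) - (2 * real e + 4) / 6 * real n\<bar> \<le> 2" for n
    using u1r[of n] by (simp add: Tr abs_le_iff field_simps)
  note T1_lim = near_linear_tendsto[OF this]
  have ev1: "\<forall>\<^sub>F n in sequentially. 2 * level_count n (Suc e + 2) (T n + int n - 2 * u1 n) < level_count n (Suc e + 2) (u1 n)"
    by (rule eventually_less_of_tendsto[OF tendsto_mult_left[OF level_count_tendsto[OF T1_lim], unfolded times_divide_eq_right]
          level_count_tendsto[OF u1_lim] spline_ineq_1])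
  have ev2: "\<forall>\<^sub>F n in sequentially. 2 * level_count n (e + 2) (u1 n - int n) < level_count n (e + 2) (T n + int n - 2 * u1 n)"
    by (rule eventually_less_of_tendsto[OF tendsto_mult_left[OF level_count_tendsto[OF u1n_lim], unfolded times_divide_eq_right]
          level_count_tendsto[OF T1_lim] spline_ineq_2])
  have ev3: "\<forall>\<^sub>F n in sequentially. 2 * level_count n (e + 2) (u1 n - int n) + 4 * level_count n (e + 2) (T n - 2 * u0 n)
      < level_count n (e + 2) (u0 n)"
    by (rule eventually_less_of_tendsto[OF tendsto_add[OF tendsto_mult_left[OF level_count_tendsto[OF u1n_lim, of e]]
            tendsto_mult_left[OF level_count_tendsto[OF T0_lim, of e]], unfolded times_divide_eq_right add_divide_distrib[symmetric]]
          level_count_tendsto[OF u0_lim] spline_ineq_3])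
  show ?thesis
    using ev1 ev2 ev3 eventually_ge_at_top[of 20]
  proof eventually_elim
    case (elim n)
    let ?N = "level_count n (e + 2)" and ?W = "level_count n (e + 3)"
    let ?T = "T n"
    have Nsym: "?N (?T - k) = ?N k" for k unfolding T_def by (rule level_count_sym)
    have Wsym: "?W (?T + int n - k) = ?W k" for k
      using level_count_sym[of n "e + 3" k] by (simp add: T_def algebra_simps del: level_count.simps)
    have Nmono: "?N k \<le> ?N l" if "k \<le> l" "k + l \<le> ?T" for k l
      using that level_count_mono[of k l n "e + 2"] by (simp add: T_def)
    have u01: "u0 n \<le> u1 n" using u0_upper[of n] u1_bounds[of n] elim by linarith
    have "2 * ?W (2 * u1 n) \<le> ?W (u1 n)"
      using elim(1) Wsym[of "2 * u1 n"] by (simp add: numeral_3_eq_3 del: level_count.simps)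
    then obtain u where u: "u0 n \<le> u" "u \<le> u1 n" "2 * ?W (2 * u) \<le> ?W u"
      and least: "u = u0 n \<or> \<not> 2 * ?W (2 * (u - 1)) \<le> ?W (u - 1)"
      using exists_least_int_between[OF u01, of "\<lambda>u. 2 * ?W (2 * u) \<le> ?W u"] by blast
    have Nu: "?N (u - int n) \<le> ?N (u1 n - int n)"
      using u u1_bounds[of n] Tn[of n] by (intro Nmono) linarith+
    \<comment> \<open>At \<open>u0\<close> the mirror image of \<open>2 * u\<close> is within 3 of
      \<open>u\<close>. Otherwise the inequality fails at \<open>u - 1\<close>; going to
      \<open>u\<close> costs one Lipschitz step in \<open>W u\<close> and twice two steps in
      \<open>2 * W (2 * u)\<close>, hence 5.\<close>
    have "?W u \<le> 2 * ?W (2 * u) + 5 * real (Suc n) ^ (e + 1)"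
      using least
    proof
      assume uu: "u = u0 n"
      define j where "j = nat (u - (?T + int n - 2 * u))"
      have j: "int j = u - (?T + int n - 2 * u)" "j \<le> 3"
        using u0_lower[of n] u0_upper[of n] by (auto simp: j_def uu)
      have "\<bar>?W u - ?W (u - int j)\<bar> \<le> real j * real (Suc n) ^ (e + 1)" by (rule level_count_lipschitz_steps)
      also have "\<dots> \<le> 3 * real (Suc n) ^ (e + 1)" using j by (intro mult_right_mono) auto
      finally have "?W u \<le> ?W (2 * u) + 3 * real (Suc n) ^ (e + 1)"
        using Wsym[of "2 * u"] by (simp add: j del: level_count.simps)
      moreover have "0 \<le> real (Suc n) ^ (e + 1)" by simp
      ultimately show ?thesis using level_count_nonneg[of n "e + 3" "2 * u"] by linarith
    next
      assume *: "\<not> 2 * ?W (2 * (u - 1)) \<le> ?W (u - 1)"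
      have "\<bar>?W u - ?W (u - int 1)\<bar> \<le> real 1 * real (Suc n) ^ (e + 1)" by (rule level_count_lipschitz_steps)
      moreover have "\<bar>?W (2 * u) - ?W (2 * u - int 2)\<bar> \<le> real 2 * real (Suc n) ^ (e + 1)" by (rule level_count_lipschitz_steps)
      moreover have "2 * u - int 2 = 2 * (u - 1)" "u - int 1 = u - 1" by simp_all
      ultimately show ?thesis using * by (simp only: of_nat_1 of_nat_numeral mult_1_left)
    qed
    moreover have "2 * ?N (u - int n) \<le> ?N y" if "u + 1 \<le> y" "y \<le> 2 * u - int n - 1" for y
    proof -
      have "?N (?T + int n - 2 * u1 n) \<le> ?N (?T - y)"
        using that u u01 u0_lower[of n] by (intro Nmono) linarith+
      then show ?thesis using elim(2) Nu unfolding Nsym by linarith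
    qed
    moreover have "2 * ?N (u - int n) + 4 * ?N (2 * u) \<le> ?N y" if "u + 1 \<le> y" "y \<le> (?T + 1) div 2" for y
    proof -
      have "?N (u0 n) \<le> ?N y" using that u by (intro Nmono) linarith+
      moreover have "?N (?T - 2 * u) \<le> ?N (?T - 2 * u0 n)"
        using u u0_lower[of n] Tn[of n] by (intro Nmono) linarith+
      ultimately show ?thesis using elim(3) Nu unfolding Nsym by linarith
    qed
    ultimately show ?case
      using u u0_lower[of n] u1_bounds[of n] Tn[of n] elim(4) unfolding T_def[symmetric]
      by (intro exI[of _ u] conjI allI impI) (linarith | blast)+
  qed
qed

theorem eventually_card_sum_free_le:
  fixes J :: "'a set"
  assumes J: "finite J" "i \<notin> J" "card J \<ge> 2"
  shows "\<forall>\<^sub>F n in sequentially. \<exists>u. 0 \<le> u \<and> u \<le> int (n * card (insert i J)) \<and>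
    (\<forall>S \<subseteq> box_on (insert i J) n. (\<forall>x\<in>S. \<forall>y\<in>S. (\<lambda>i. x i + y i) \<notin> S) \<longrightarrow>
      real (card S) \<le> (\<Sum>k\<in>{u..2 * u - 1}. level_count n (card (insert i J)) k) + 8 * real (Suc n) ^ card J)"
proof -
  obtain e where e: "card J = e + 2" using J(3) nat_le_iff_add[of 2] by (auto simp: add.commute)
  have c: "card (insert i J) = Suc (card J)" using J by simp
  have e3: "e + 3 = Suc (e + 2)" "e + 1 = (e + 2) - 1" by simp_all
  show ?thesis using eventually_threshold[of e]
  proof eventually_elim
    case (elim n)
    then obtain u where u: "9 \<le> n" "int (n * (e + 2)) + int n \<le> 3 * u" "2 * u \<le> int (n * (e + 2)) + int n" "int n < u"
      "\<And>y. u + 1 \<le> y \<Longrightarrow> y \<le> 2 * u - int n - 1 \<Longrightarrow> 2 * level_count n (e + 2) (u - int n) \<le> level_count n (e + 2) y"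
      "\<And>y. u + 1 \<le> y \<Longrightarrow> y \<le> (int (n * (e + 2)) + 1) div 2 \<Longrightarrow>
        2 * level_count n (e + 2) (u - int n) + 4 * level_count n (e + 2) (2 * u) \<le> level_count n (e + 2) y"
      "2 * level_count n (Suc (e + 2)) (2 * u) \<le> level_count n (Suc (e + 2)) u"
      "level_count n (Suc (e + 2)) u \<le> 2 * level_count n (Suc (e + 2)) (2 * u) + 5 * real (Suc n) ^ (e + 2 - 1)"
      unfolding e3 by blast
    have "real (card S) \<le> (\<Sum>k\<in>{u..2 * u - 1}. level_count n (Suc (e + 2)) k) + 8 * real (Suc n) ^ (e + 2)"
      if "S \<subseteq> box_on (insert i J) n" "\<And>x y. x \<in> S \<Longrightarrow> y \<in> S \<Longrightarrow> (\<lambda>i. x i + y i) \<notin> S" for S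
      by (rule card_sum_free_le_slab_count[OF J(1,2) e that]) (use u in \<open>simp_all only: le_add2\<close>)
    moreover have "u \<le> int (n * Suc (e + 2))" using u(3,4) by (simp add: algebra_simps) 
    ultimately show ?case unfolding c e using u(4) by (intro exI[of _ u]) auto
  qed
qed

section \<open>Dimensions one and two\<close>

lemma sum_free_dim_1:
  assumes S: "S \<subseteq> box_on {i} n" and sf: "\<And>x y. x \<in> S \<Longrightarrow> y \<in> S \<Longrightarrow> (\<lambda>i. x i + y i) \<notin> S"
  shows "2 * card S \<le> n + 1"
proof -
  define A where "A = fibre S i (\<lambda>_. 0)"
  have box: "box_on {} n = {\<lambda>_. 0 :: nat}" by (auto simp: box_on_def)
  have "card S = (\<Sum>q\<in>box_on {} n. card (fibre S i q))"
    using S by (intro card_eq_sum_fibres) auto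
  then have cS: "card S = card A" by (simp add: box A_def)
  have A: "A \<subseteq> {..n}"
  proof
    fix s assume "s \<in> A"
    then have "(\<lambda>_. 0)(i := s) \<in> box_on {i} n" using S by (auto simp: A_def fibre_def)
    then show "s \<in> {..n}" by (auto simp: box_on_def dest: spec[of _ i])
  qed
  show ?thesis
  proof (cases "A = {}")
    case True then show ?thesis by (simp add: cS)
  next
    case False
    have fin: "finite A" using A finite_subset by blast
    define c where "c = Max A"
    have c: "c \<in> A" "\<And>a. a \<in> A \<Longrightarrow> a \<le> c" using fin False by (auto simp: c_def)
    have "a + b \<noteq> c" if "a \<in> A" "b \<in> A" for a b
    proof
      assume "a + b = c"
      moreover have "(\<lambda>j. ((\<lambda>_. 0)(i := a)) j + ((\<lambda>_. 0)(i := b)) j) = (\<lambda>_. 0)(i := a + b)" by auto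
      ultimately show False
        using sf[of "(\<lambda>_. 0)(i := a)" "(\<lambda>_. 0)(i := b)"] that c(1) by (auto simp: A_def fibre_def)
    qed
    then have "card (A \<inter> {..c}) + card (A \<inter> {..c}) \<le> c + 1" by (intro card_sum_avoid) auto
    moreover have "A \<inter> {..c} = A" using c by auto
    moreover have "c \<le> n" using c(1) A by auto
    ultimately show ?thesis by (simp add: cS)
  qed
qed

section \<open>Dimension two\<close>

text \<open>\<open>h\<close> lists the values of \<open>k\<close> in decreasing order; the second
  property is the form suited to a pigeonhole argument.\<close>

lemma exists_decreasing_rearrangement:
  fixes k :: "nat \<Rightarrow> nat"
  obtains h where "(\<Sum>x\<in>{..n}. h x) = (\<Sum>x\<in>{..n}. k x)" "\<And>q. q \<le> n \<Longrightarrow> card {x \<in> {..n}. h q < k x} \<le> q"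
proof
  define ks where "ks = map k [0..<Suc n]"
  define xs where "xs = sort ks"
  define h where "h x = xs ! (n - x)" for x
  have len: "length xs = Suc n" by (simp add: xs_def ks_def)
  have "(\<Sum>x\<in>{..n}. h x) = (\<Sum>x\<in>{..<Suc n}. xs ! (Suc n - Suc x))"
    by (intro sum.cong) (auto simp: h_def)
  also have "\<dots> = (\<Sum>x\<in>{..<Suc n}. xs ! x)" by (rule sum.nat_diff_reindex)
  also have "\<dots> = sum_list xs" by (simp add: sum_list_sum_nth len atLeast0LessThan)
  also have "\<dots> = sum_mset (mset ks)" by (simp add: xs_def sum_mset_sum_list[symmetric])
  also have "\<dots> = sum_list ks" by (simp add: sum_mset_sum_list)
  also have "\<dots> = (\<Sum>x\<in>{..n}. k x)"
    unfolding ks_def by (simp add: sum_list_distinct_conv_sum_set atLeast0AtMost atLeastLessThanSuc_atLeastAtMost del: upt_Suc)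
  finally show "(\<Sum>x\<in>{..n}. h x) = (\<Sum>x\<in>{..n}. k x)" .
  fix q assume q: "q \<le> n"
  have "card {x \<in> {..n}. h q < k x} = length (filter (\<lambda>v. h q < v) ks)"
  proof -
    have "{x \<in> {..n}. h q < k x} = {i. i < length ks \<and> h q < ks ! i}" by (auto simp: ks_def simp del: upt_Suc)
    then show ?thesis by (simp add: length_filter_conv_card)
  qed
  also have "\<dots> = length (filter (\<lambda>v. h q < v) xs)"
    unfolding xs_def by (simp add: filter_sort)
  also have "\<dots> = card {i. i < length xs \<and> h q < xs ! i}" by (rule length_filter_conv_card)
  also have "\<dots> \<le> card {n - q<..n}"
  proof (intro card_mono subsetI)
    fix i assume i: "i \<in> {i. i < length xs \<and> h q < xs ! i}"
    have "\<not> i \<le> n - q"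
    proof
      assume "i \<le> n - q"
      then have "xs ! i \<le> xs ! (n - q)" using len by (intro sorted_nth_mono) (auto simp: xs_def)
      then show False using i by (simp add: h_def)
    qed
    then show "i \<in> {n - q<..n}" using i len by auto
  qed simp
  finally show "card {x \<in> {..n}. h q < k x} \<le> q" using q by simp
qed

lemma sum_free_fibres_dim_2:
  fixes A :: "nat \<Rightarrow> nat set"
  assumes A: "\<And>q. q \<le> n \<Longrightarrow> A q \<subseteq> {..n}"
    and sf: "\<And>q r a b. q + r \<le> n \<Longrightarrow> a \<in> A q \<Longrightarrow> b \<in> A r \<Longrightarrow> a + b \<notin> A (q + r)"
    and u: "u \<le> n" "n < 2 * u" "4 * n + 1 \<le> 5 * u"
  shows "(\<Sum>q\<in>{..n}. card (A q)) \<le> (2 * u - n) * (n + 1)"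
proof -
  define c where "c q = (if A q = {} then 0 else Suc (Max (A q)))" for q
  define G where "G p = Max (c ` {p..n})" for p
  define k where "k q = G q - card (A q)" for q
  have finA: "finite (A q)" if "q \<le> n" for q using A[OF that] finite_subset by blast
  have A_c: "A q \<subseteq> {..<c q}" if "q \<le> n" for q
    using finA[OF that] by (auto simp: c_def less_Suc_eq_le)
  have c_le: "c q \<le> Suc n" if "q \<le> n" for q
    using A[OF that] finA[OF that] Max_in[of "A q"] by (auto simp: c_def)
  have c_G: "c p' \<le> G p" if "p \<le> p'" "p' \<le> n" for p p'
    using that by (auto simp: G_def)
  have G_le: "G p \<le> Suc n" if "p \<le> n" for p
    using that c_le by (auto simp: G_def)
  have card_G: "card (A q) \<le> G q" if "q \<le> n" for q
  proof -
    have "card (A q) \<le> card {..<c q}" using A_c[OF that] by (intro card_mono) auto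
    then show ?thesis using c_G[of q q] that by simp
  qed
  have key: "\<exists>p'. p \<le> p' \<and> p' \<le> n \<and> (\<forall>q\<le>p'. G p \<le> k q + k (p' - q))" if p: "p \<le> n" for p
  proof -
    have "G p \<in> c ` {p..n}" unfolding G_def using p by (intro Max_in) auto
    then obtain p' where p': "p \<le> p'" "p' \<le> n" "G p = c p'" by auto
    have "G p \<le> k q + k (p' - q)" if q: "q \<le> p'" for q
    proof (cases "A p' = {}")
      case True then show ?thesis using p' by (simp add: c_def)
    next
      case False
      define m where "m = Max (A p')"
      have m: "m \<in> A p'" "c p' = Suc m" using False finA[OF p'(2)] by (auto simp: m_def c_def)
      have half: "Suc m \<le> k r + card (A r \<inter> {..m})" if r: "r \<le> p'" for r
      proof -
        have rn: "r \<le> n" using r p' by simp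
        have "Suc m \<le> G r" using c_G[of r p'] r p' m by simp
        moreover have "card (A r) \<le> card (A r \<inter> {..m}) + card {Suc m..<G r}"
        proof -
          have "A r \<subseteq> (A r \<inter> {..m}) \<union> {Suc m..<G r}"
            using A_c[OF rn] c_G[of r r] rn by (auto simp: not_le less_le_trans)
          then have "card (A r) \<le> card ((A r \<inter> {..m}) \<union> {Suc m..<G r})"
            using finA[OF rn] by (intro card_mono) auto
          also have "\<dots> \<le> card (A r \<inter> {..m}) + card {Suc m..<G r}" by (rule card_Un_le)
          finally show ?thesis .
        qed
        ultimately show ?thesis using card_G[OF rn] by (simp add: k_def)
      qed
      have "a + b \<noteq> m" if "a \<in> A q" "b \<in> A (p' - q)" for a b
        using sf[of q "p' - q" a b] that q p' m by auto
      then have "card (A q \<inter> {..m}) + card (A (p' - q) \<inter> {..m}) \<le> m + 1" by (intro card_sum_avoid) auto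
      then show ?thesis using half[of q] half[of "p' - q"] q p' m by simp
    qed
    then show ?thesis using p' by blast
  qed
  obtain h where h: "(\<Sum>x\<in>{..n}. h x) = (\<Sum>x\<in>{..n}. k x)" "\<And>q. q \<le> n \<Longrightarrow> card {x \<in> {..n}. h q < k x} \<le> q"
    using exists_decreasing_rearrangement[of n k] by blast
  \<comment> \<open>Otherwise every \<open>x \<le> p'\<close> has \<open>k x > h q\<close> or
    \<open>k (p' - x) > h r\<close>; but this happens for at most \<open>q + r \<le> p'\<close> of
    these \<open>p' + 1\<close> values.\<close>
  have hG: "G (q + r) \<le> h q + h r" if qr: "q + r \<le> n" for q r
  proof (rule ccontr)
    assume less: "\<not> G (q + r) \<le> h q + h r"
    obtain p' where p': "q + r \<le> p'" "p' \<le> n" "\<And>x. x \<le> p' \<Longrightarrow> G (q + r) \<le> k x + k (p' - x)"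
      using key[OF qr] by blast
    let ?X = "{x \<in> {..n}. h q < k x}" and ?Y = "{x \<in> {..n}. h r < k x}"
    have "{..p'} \<subseteq> ?X \<union> (\<lambda>x. p' - x) ` (?Y \<inter> {..p'})"
    proof
      fix x assume x: "x \<in> {..p'}"
      then have "h q < k x \<or> h r < k (p' - x)" using p'(3)[of x] less by auto
      moreover have "x = p' - (p' - x)" using x by simp
      ultimately show "x \<in> ?X \<union> (\<lambda>x. p' - x) ` (?Y \<inter> {..p'})" using x p'(2) by fastforce
    qed
    then have "card {..p'} \<le> card (?X \<union> (\<lambda>x. p' - x) ` (?Y \<inter> {..p'}))" by (intro card_mono) auto
    also have "\<dots> \<le> card ?X + card ((\<lambda>x. p' - x) ` (?Y \<inter> {..p'}))" by (rule card_Un_le)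
    also have "card ((\<lambda>x. p' - x) ` (?Y \<inter> {..p'})) \<le> card (?Y \<inter> {..p'})" by (intro card_image_le) auto
    also have "card (?Y \<inter> {..p'}) \<le> card ?Y" by (intro card_mono) auto
    finally show False using h(2)[of q] h(2)[of r] qr p'(1) by simp
  qed
  have seg: "segment n u = {..u}" "segment n (u + u) = {2 * u - n..n}"
    using u by (auto simp: segment_eq)
  define H where "H = (\<Sum>x\<in>{..u}. real (h x))"
  define GG where "GG = (\<Sum>x\<in>{2 * u - n..n}. real (G x))"
  have "(\<Sum>x\<in>segment n u. - real (h x)) / real (card (segment n u)) + (\<Sum>x\<in>segment n u. - real (h x)) / real (card (segment n u))
      + (\<Sum>x\<in>segment n (u + u). real (G x)) / real (card (segment n (u + u))) \<le> 0"
  proof (rule segment_coupling)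
    fix x y assume "x \<in> segment n u" "y \<in> segment n u" "x + y \<in> segment n (u + u)"
    then have "x + y \<le> n" by (simp add: seg)
    from hG[OF this] show "- real (h x) + - real (h y) + real (G (x + y)) \<le> 0" by linarith
  qed (use u in auto)
  then have avg: "GG / real (2 * n + 1 - 2 * u) \<le> 2 * H / real (u + 1)"
    using u by (simp add: seg GG_def H_def sum_negf algebra_simps Suc_diff_le)
  have H0: "0 \<le> H" by (simp add: H_def sum_nonneg)
  have "GG = GG / real (2 * n + 1 - 2 * u) * real (2 * n + 1 - 2 * u)" using u by simp
  also have "\<dots> \<le> 2 * H / real (u + 1) * real (2 * n + 1 - 2 * u)" by (intro mult_right_mono avg) simp
  also have "\<dots> = H / real (u + 1) * real (2 * (2 * n + 1 - 2 * u))" by simp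
  \<comment> \<open>\<open>2 * (2 * n + 1 - 2 * u) \<le> u + 1\<close> is the hypothesis
    \<open>4 * n + 1 \<le> 5 * u\<close>.\<close>
  also have "\<dots> \<le> H / real (u + 1) * real (u + 1)"
    using H0 u by (intro mult_left_mono) auto
  also have "\<dots> = H" by simp
  also have "H \<le> (\<Sum>x\<in>{..n}. real (h x))" unfolding H_def using u by (intro sum_mono2) auto
  finally have "(\<Sum>x\<in>{2 * u - n..n}. G x) \<le> (\<Sum>x\<in>{..n}. k x)"
    unfolding GG_def h(1)[symmetric] by (simp only: of_nat_sum[symmetric] of_nat_le_iff)
  moreover have "(\<Sum>q\<in>{..n}. card (A q)) + (\<Sum>x\<in>{..n}. k x) = (\<Sum>x\<in>{..n}. G x)"
    unfolding sum.distrib[symmetric] using card_G by (intro sum.cong) (auto simp: k_def)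
  moreover have "(\<Sum>x\<in>{..n}. G x) = (\<Sum>x\<in>{..<2 * u - n}. G x) + (\<Sum>x\<in>{2 * u - n..n}. G x)"
    using u by (subst sum.union_disjoint[symmetric]) (auto intro!: sum.cong)
  moreover have "(\<Sum>x\<in>{..<2 * u - n}. G x) \<le> (2 * u - n) * (n + 1)"
    using sum_bounded_above[of "{..<2 * u - n}" G "n + 1"] G_le u by simp
  ultimately show ?thesis by linarith
qed

lemma sum_level_count_2:
  assumes "0 \<le> u" "u \<le> int n + 1" "int n \<le> v" "v \<le> 2 * int n"
  shows "(\<Sum>k\<in>{u..v}. level_count n (Suc (Suc 0)) k)
    = (real n + 1)\<^sup>2 - (2 * real n + 1 - of_int v) * (2 * real n - of_int v) / 2 - of_int u * (of_int u + 1) / 2"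
  using assms(3,4)
proof (induction v rule: int_ge_induct)
  case base
  show ?case using assms(2,1)
  proof (induction u rule: int_le_induct)
    case base
    show ?case by (simp add: power2_eq_square field_simps)
  next
    case (step i)
    have "{i - 1..int n} = insert (i - 1) {i..int n}" using step by auto
    then have "(\<Sum>k\<in>{i - 1..int n}. level_count n (Suc (Suc 0)) k)
        = level_count n (Suc (Suc 0)) (i - 1) + (\<Sum>k\<in>{i..int n}. level_count n (Suc (Suc 0)) k)"
      by (simp del: level_count.simps)
    also have "level_count n (Suc (Suc 0)) (i - 1) = of_int i"
      using step level_count_2[of "i - 1" n] by (simp del: level_count.simps)
    finally show ?case using step by (simp add: field_simps del: level_count.simps)
  qed
next
  case (step v)
  have "{u..v + 1} = insert (v + 1) {u..v}" using step assms by auto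
  then have "(\<Sum>k\<in>{u..v + 1}. level_count n (Suc (Suc 0)) k)
      = level_count n (Suc (Suc 0)) (v + 1) + (\<Sum>k\<in>{u..v}. level_count n (Suc (Suc 0)) k)"
    by (simp del: level_count.simps)
  also have "level_count n (Suc (Suc 0)) (v + 1) = 2 * real n - of_int v"
    using step level_count_2[of "2 * int n - (v + 1)" n] level_count_sym[of n "Suc (Suc 0)" "v + 1"]
    by (simp add: mult.commute del: level_count.simps)
  finally show ?case using step by (simp add: field_simps del: level_count.simps)
qed

lemma sum_free_dim_2:
  assumes ij: "i \<noteq> j" and S: "S \<subseteq> box_on {i, j} n" and sf: "\<And>x y. x \<in> S \<Longrightarrow> y \<in> S \<Longrightarrow> (\<lambda>i. x i + y i) \<notin> S"
    and u: "u \<le> n" "n < 2 * u" "4 * n + 1 \<le> 5 * u"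
  shows "card S \<le> (2 * u - n) * (n + 1)"
proof -
  define A where "A q = fibre S i ((\<lambda>_. 0)(j := q))" for q
  have box: "box_on {j} n = (\<lambda>q. (\<lambda>_. 0)(j := q)) ` {..n}"
  proof (intro equalityI subsetI)
    fix x assume "x \<in> box_on {j} n"
    then have "x = (\<lambda>_. 0)(j := x j)" "x j \<le> n" by (auto simp: box_on_def fun_eq_iff)
    then show "x \<in> (\<lambda>q. (\<lambda>_. 0)(j := q)) ` {..n}" by blast
  qed (auto simp: box_on_def)
  have inj: "inj_on (\<lambda>q. (\<lambda>_. 0 :: nat)(j := q)) {..n}" by (intro inj_onI) (metis fun_upd_same)
  have "card S = (\<Sum>q\<in>box_on {j} n. card (fibre S i q))"
    using S ij by (intro card_eq_sum_fibres) auto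
  then have cS: "card S = (\<Sum>q\<in>{..n}. card (A q))"
    unfolding box sum.reindex[OF inj] by (simp add: A_def)
  show ?thesis unfolding cS
  proof (rule sum_free_fibres_dim_2[OF _ _ u])
    fix q show "A q \<subseteq> {..n}"
    proof
      fix s assume "s \<in> A q"
      then have "(\<lambda>_. 0)(j := q, i := s) \<in> box_on {i, j} n" using S by (auto simp: A_def fibre_def)
      then have "((\<lambda>_. 0)(j := q, i := s)) i \<le> n" unfolding box_on_def by blast
      then show "s \<in> {..n}" by simp
    qed
  next
    fix q r a b assume "a \<in> A q" "b \<in> A r"
    moreover have "(\<lambda>l. ((\<lambda>_. 0)(j := q, i := a)) l + ((\<lambda>_. 0)(j := r, i := b)) l) = (\<lambda>_. 0)(j := q + r, i := a + b)"
      using ij by auto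
    ultimately show "a + b \<notin> A (q + r)"
      using sf[of "(\<lambda>_. 0)(j := q, i := a)" "(\<lambda>_. 0)(j := r, i := b)"] by (auto simp: A_def fibre_def)
  qed
qed

lemma card_sum_free_le_dim_1:
  assumes "S \<subseteq> box_on {i} n" "\<And>x y. x \<in> S \<Longrightarrow> y \<in> S \<Longrightarrow> (\<lambda>i. x i + y i) \<notin> S"
  defines "u \<equiv> int n div 2 + 1"
  shows "real (card S) \<le> (\<Sum>k\<in>{u..2 * u - 1}. level_count n (Suc 0) k) + 8"
proof -
  have *: "int n - u + 1 = int (card {u..int n})" by (simp add: u_def)
  have "real_of_int (int n - u + 1) = (\<Sum>k\<in>{u..int n}. 1)" unfolding * by (simp del: card_atLeastAtMost_int)
  also have "\<dots> = (\<Sum>k\<in>{u..int n}. level_count n (Suc 0) k)"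
    unfolding level_count_1 by (intro sum.cong) (auto simp: u_def)
  also have "\<dots> \<le> (\<Sum>k\<in>{u..2 * u - 1}. level_count n (Suc 0) k)"
    by (intro sum_mono2 level_count_nonneg) (auto simp: u_def)
  finally have "real_of_int (int n - u + 1) \<le> (\<Sum>k\<in>{u..2 * u - 1}. level_count n (Suc 0) k)" .
  moreover have "int (card S) \<le> int n - u + 1 + 8"
    using sum_free_dim_1[OF assms(1,2)] unfolding u_def by linarith
  then have "real_of_int (int (card S)) \<le> of_int (int n - u + 1 + 8)" by (simp only: of_int_le_iff)
  ultimately show ?thesis by (simp del: level_count.simps)
qed

text \<open>The planar slab has area \<open>1 - (2 - 2 * u)^2 / 2 - u^2 / 2\<close> for
  \<open>u\<close> between 1/2 and 1, which is largest at \<open>u = 4/5\<close> with value 3/5. The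
  integer \<open>u\<close> is the least one above \<open>4 * n / 5\<close>.\<close>

lemma card_sum_free_le_dim_2:
  assumes "i \<noteq> j" "S \<subseteq> box_on {i, j} n" "\<And>x y. x \<in> S \<Longrightarrow> y \<in> S \<Longrightarrow> (\<lambda>i. x i + y i) \<notin> S"
    and n: "1 \<le> n"
  defines "u \<equiv> (4 * int n + 5) div 5"
  shows "real (card S) \<le> (\<Sum>k\<in>{u..2 * u - 1}. level_count n (Suc (Suc 0)) k) + 8 * real (Suc n)"
proof -
  define v where "v = nat u"
  have v: "int v = u" by (simp add: v_def u_def)
  have u: "4 * int n + 1 \<le> 5 * u" "5 * u \<le> 4 * int n + 5" unfolding u_def by presburger+
  have "card S \<le> (2 * v - n) * (n + 1)"
    using u n by (intro sum_free_dim_2[OF assms(1-3)]) (auto simp: v[symmetric])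
  then have "real (card S) \<le> real ((2 * v - n) * (n + 1))" by (simp only: of_nat_le_iff)
  also have "\<dots> = (2 * of_int u - real n) * (real n + 1)"
  proof -
    have "n \<le> 2 * v" using u n v by linarith
    then have "real (2 * v - n) = 2 * real v - real n" by (simp add: of_nat_diff)
    moreover have "real_of_int u = real v" by (simp flip: v)
    ultimately show ?thesis by (simp only: of_nat_mult of_nat_add of_nat_1)
  qed
  finally have S: "real (card S) \<le> (2 * of_int u - real n) * (real n + 1)" .
  have V: "(\<Sum>k\<in>{u..2 * u - 1}. level_count n (Suc (Suc 0)) k)
    = (real n + 1)\<^sup>2 - (2 * real n + 2 - 2 * of_int u) * (2 * real n + 1 - 2 * of_int u) / 2 - of_int u * (of_int u + 1) / 2"
    using u n sum_level_count_2[of u n "2 * u - 1"] by (simp add: algebra_simps)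
  \<comment> \<open>In terms of the rounding error \<open>\<delta>\<close> the terms quadratic in
    \<open>n\<close> cancel.\<close>
  define \<delta> where "\<delta> = 5 * of_int u - 4 * real n"
  have "real_of_int (4 * int n + 1) \<le> of_int (5 * u)" "real_of_int (5 * u) \<le> of_int (4 * int n + 5)"
    using u by (simp_all only: of_int_le_iff)
  then have \<delta>: "1 \<le> \<delta>" "\<delta> \<le> 5" by (simp_all add: \<delta>_def)
  have un: "of_int u = (4 * real n + \<delta>) / 5" by (simp add: \<delta>_def)
  have "(2 * of_int u - real n) * (real n + 1)
      \<le> (real n + 1)\<^sup>2 - (2 * real n + 2 - 2 * of_int u) * (2 * real n + 1 - 2 * of_int u) / 2 - of_int u * (of_int u + 1) / 2 + 8 * real (Suc n)"
  proof -
    have "\<delta> * \<delta> \<le> 5 * 5" "\<delta> * real n \<le> 5 * real n" using \<delta> by (intro mult_mono mult_right_mono; simp)+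
    moreover have "(real n + 1)\<^sup>2 - (2 * real n + 2 - 2 * of_int u) * (2 * real n + 1 - 2 * of_int u) / 2 - of_int u * (of_int u + 1) / 2 + 8 * real (Suc n)
        - (2 * of_int u - real n) * (real n + 1) = (\<delta> + 80 + 84 * real n - \<delta> * \<delta> - 4 * (\<delta> * real n)) / 10"
      unfolding un by (simp add: power2_eq_square field_simps)
    ultimately show ?thesis using \<delta> by (simp add: field_simps) 
  qed
  then show ?thesis using S V by linarith
qed

section \<open>Volumes of slabs\<close>

lemma slab_eq: "slab u = {x \<in> cbox 0 1. u \<le> (\<Sum>i\<in>UNIV. x $ i) \<and> (\<Sum>i\<in>UNIV. x $ i) < 2 * u}"
  by (auto simp: slab_def mem_box_cart)

lemma sets_slab [measurable]: "slab u \<in> sets (borel :: (real ^ 'd::finite) measure)"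
proof -
  have "slab u = cbox 0 1 \<inter> ({x :: real ^ 'd. u \<le> (\<Sum>i\<in>UNIV. x $ i)} \<inter> {x. (\<Sum>i\<in>UNIV. x $ i) < 2 * u})"
    by (auto simp: slab_eq)
  moreover have "closed {x :: real ^ 'd. u \<le> (\<Sum>i\<in>UNIV. x $ i)}"
    by (intro closed_Collect_le continuous_intros)
  moreover have "open {x :: real ^ 'd. (\<Sum>i\<in>UNIV. x $ i) < 2 * u}"
    by (intro open_Collect_less continuous_intros)
  ultimately show ?thesis by auto
qed

lemma AE_sum_neq: "AE x :: real ^ 'd::finite in lborel. (\<Sum>i\<in>UNIV. x $ i) \<noteq> t"
proof -
  let ?H = "{x :: real ^ 'd. (\<Sum>i\<in>UNIV. x $ i) = t}"
  have "(\<chi> i. 1) \<noteq> (0 :: real ^ 'd)" by (simp add: vec_eq_iff)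
  then have "negligible {x :: real ^ 'd. (\<chi> i. 1) \<bullet> x = t}" by (intro negligible_hyperplane) simp
  then have "?H \<in> null_sets lebesgue" by (simp add: negligible_iff_null_sets inner_vec_def)
  moreover have "closed ?H" by (intro closed_Collect_eq continuous_intros)
  ultimately have "?H \<in> null_sets lborel"
    by (subst (asm) null_sets_completion_iff) auto
  then show ?thesis using AE_not_in by force
qed

text \<open>As \<open>u\<close> varies, the indicators converge off the two bounding hyperplanes,
  which are null sets; the unit cube dominates.\<close>

lemma slab_vol_continuous: "continuous_on A (slab_vol TYPE('d::finite))"
proof (rule continuous_on_subset[of UNIV])
  show "continuous_on UNIV (slab_vol TYPE('d))"
    unfolding continuous_on_sequentially
  proof (intro allI ballI impI, elim conjE)
    fix u :: "nat \<Rightarrow> real" and t assume u: "u \<longlonglongrightarrow> t"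
    have vol: "slab_vol TYPE('d) v = integral\<^sup>L lborel (indicator (slab v :: (real ^ 'd) set))" for v
      by (simp add: slab_vol_def)
    have "(\<lambda>n. integral\<^sup>L lborel (indicator (slab (u n) :: (real ^ 'd) set) :: _ \<Rightarrow> real))
        \<longlonglongrightarrow> integral\<^sup>L lborel (indicator (slab t :: (real ^ 'd) set))"
    proof (rule integral_dominated_convergence[where w = "indicator (cbox 0 1 :: (real ^ 'd) set)"])
      show "integrable lborel (indicator (cbox 0 1 :: (real ^ 'd) set) :: _ \<Rightarrow> real)"
        by (simp add: integrable_indicator_iff emeasure_lborel_cbox_eq)
      show "AE x :: real ^ 'd in lborel. norm (indicator (slab (u n)) x :: real) \<le> indicator (cbox 0 1) x" for n
        by (intro AE_I2) (auto simp: slab_eq indicator_def)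
      show "AE x :: real ^ 'd in lborel. (\<lambda>n. indicator (slab (u n)) x :: real) \<longlonglongrightarrow> indicator (slab t) x"
        using AE_sum_neq[of t] AE_sum_neq[of "2 * t"]
      proof eventually_elim
        case (elim x)
        let ?s = "\<Sum>i\<in>UNIV. x $ i"
        have u2: "(\<lambda>n. 2 * u n) \<longlonglongrightarrow> 2 * t" by (intro tendsto_intros u)
        have "\<forall>\<^sub>F n in sequentially. (u n \<le> ?s \<longleftrightarrow> t \<le> ?s)"
        proof (cases "t < ?s")
          case True then show ?thesis using order_tendstoD(2)[OF u True] by (auto elim: eventually_mono)
        next
          case False
          then have "?s < t" using elim by simp
          then show ?thesis using order_tendstoD(1)[OF u \<open>?s < t\<close>] by (auto elim: eventually_mono)
        qed
        moreover have "\<forall>\<^sub>F n in sequentially. (?s < 2 * u n \<longleftrightarrow> ?s < 2 * t)"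
        proof (cases "?s < 2 * t")
          case True then show ?thesis using order_tendstoD(1)[OF u2 True] by (auto elim: eventually_mono)
        next
          case False
          then have "2 * t < ?s" using elim by simp
          then show ?thesis using order_tendstoD(2)[OF u2 \<open>2 * t < ?s\<close>] by (auto elim: eventually_mono)
        qed
        ultimately have "\<forall>\<^sub>F n in sequentially. indicator (slab (u n)) x = (indicator (slab t) x :: real)"
          by eventually_elim (simp add: slab_eq indicator_def)
        then show ?case by (rule tendsto_eventually)
      qed
    qed auto
    then show "(slab_vol TYPE('d) \<circ> u) \<longlonglongrightarrow> slab_vol TYPE('d) t"
      by (simp add: vol o_def)
  qed
qed simp

text \<open>\<open>arg_max_on\<close> is a choice operator and yields a maximiser only once one is
  known to exist; continuity on a compact interval provides it.\<close>

lemma slab_vol_le_c_star: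
  assumes "0 \<le> u" "u \<le> real CARD('d::finite)"
  shows "slab_vol TYPE('d) u \<le> c_star TYPE('d)"
proof -
  let ?I = "{0..real CARD('d)}" and ?f = "slab_vol TYPE('d)"
  have "\<exists>x\<in>?I. \<forall>y\<in>?I. ?f y \<le> ?f x"
    by (intro continuous_attains_sup slab_vol_continuous) auto
  then obtain x where "x \<in> ?I" "\<And>y. y \<in> ?I \<Longrightarrow> ?f y \<le> ?f x" by blast
  then have "is_arg_max ?f (\<lambda>x. x \<in> ?I) x" by (auto simp: is_arg_max_def not_less)
  then have "is_arg_max ?f (\<lambda>x. x \<in> ?I) (u_star TYPE('d))"
    unfolding u_star_def arg_max_on_def arg_max_def by (rule someI)
  then have "\<not> ?f (u_star TYPE('d)) < ?f u" using assms by (auto simp: is_arg_max_def)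
  then show ?thesis by (simp add: c_star_def)
qed

lemma c_star_nonneg: "0 \<le> c_star TYPE('d::finite)"
  by (simp add: c_star_def slab_vol_def)

text \<open>Attach to each point \<open>k\<close> the open cube of side \<open>1 / m\<close> with
  lower corner \<open>k / m\<close>. Taking \<open>m = n + 1\<close> keeps the cubes inside the unit
  cube, and the summand \<open>CARD('d)\<close> in the hypothesis keeps them below the upper face of
  the slab. The cubes are disjoint.\<close>

lemma card_lattice_slab_le:
  fixes K :: "('d::finite \<Rightarrow> nat) set"
  assumes K: "K \<subseteq> box_on UNIV n"
    and u: "\<And>k. k \<in> K \<Longrightarrow> u \<le> int (sum k UNIV) \<and> int (sum k UNIV) + int CARD('d) \<le> 2 * u"
  shows "real (card K) \<le> real (Suc n) ^ CARD('d) * slab_vol TYPE('d) (of_int u / real (Suc n))"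
proof -
  define m where "m = real (Suc n)"
  have m: "m > 0" by (simp add: m_def)
  define Q where "Q k = box (\<chi> i. real (k i) / m) (\<chi> i. (real (k i) + 1) / m :: real ^ 'd)" for k :: "'d \<Rightarrow> nat"
  have Q: "y \<in> Q k \<longleftrightarrow> (\<forall>i. real (k i) < m * y $ i \<and> m * y $ i < real (k i) + 1)" for y k
    using m by (auto simp: Q_def mem_box_cart field_simps)
  have finK: "finite K" by (rule finite_subset[OF K finite_box_on]) simp
  have volQ: "measure lborel (Q k) = (1 / m) ^ CARD('d)" for k
  proof -
    have "measure lborel (Q k) = measure lborel (cbox (\<chi> i. real (k i) / m) (\<chi> i. (real (k i) + 1) / m :: real ^ 'd))"
      unfolding Q_def measure_lborel_box_eq measure_lborel_cbox_eq ..
    also have "\<dots> = (\<Prod>i\<in>(UNIV :: 'd set). 1 / m)"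
      using m by (subst content_cbox_cart) (auto simp: interval_ne_empty_cart field_simps)
    finally show ?thesis by simp
  qed
  have disj: "disjoint_family_on Q K"
  proof (unfold disjoint_family_on_def, intro ballI impI equals0I)
    fix k l y assume "k \<noteq> l" "y \<in> Q k \<inter> Q l"
    then have "real (k i) < real (l i) + 1" "real (l i) < real (k i) + 1" for i
      unfolding Int_iff Q by (meson less_trans)+
    then have "k i = l i" for i by (metis add.commute antisym less_Suc_eq_le of_nat_Suc of_nat_less_iff)
    then show False using \<open>k \<noteq> l\<close> by (simp add: fun_eq_iff)
  qed
  have sub: "(\<Union>k\<in>K. Q k) \<subseteq> slab (of_int u / m)"
  proof (intro UN_least subsetI)
    fix k y assume k: "k \<in> K" and "y \<in> Q k"
    then have y: "real (k i) < m * y $ i" "m * y $ i < real (k i) + 1" for i by (auto simp: Q)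
    have "0 \<le> y $ i \<and> y $ i \<le> 1" for i
    proof -
      have "real (k i) \<le> real n" using K k by (auto simp: box_on_def)
      then have "m * y $ i \<le> m * 1" using y(2)[of i] unfolding m_def mult_1_right of_nat_Suc by linarith
      then have "y $ i \<le> 1" using m by (simp only: mult_le_cancel_left_pos)
      moreover have "0 < m * y $ i" using y(1)[of i] of_nat_0_le_iff by (meson le_less_trans)
      ultimately show ?thesis using m by (simp add: zero_less_mult_iff)
    qed
    moreover have "of_int u \<le> m * (\<Sum>i\<in>UNIV. y $ i)"
    proof -
      have "real_of_int u \<le> of_int (int (sum k UNIV))" using u[OF k] by (simp only: of_int_le_iff)
      also have "\<dots> = (\<Sum>i\<in>UNIV. real (k i))" by simp
      also have "\<dots> \<le> (\<Sum>i\<in>UNIV. m * y $ i)" using y less_imp_le by (intro sum_mono) blast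
      finally show ?thesis by (simp add: sum_distrib_left)
    qed
    moreover have "m * (\<Sum>i\<in>UNIV. y $ i) < 2 * of_int u"
    proof -
      have "m * (\<Sum>i\<in>UNIV. y $ i) = (\<Sum>i\<in>UNIV. m * y $ i)" by (simp add: sum_distrib_left)
      also have "\<dots> < (\<Sum>i\<in>UNIV. real (k i) + 1)" using y by (intro sum_strict_mono) auto
      also have "\<dots> = of_int (int (sum k UNIV) + int CARD('d))" by (simp add: sum.distrib)
      also have "\<dots> \<le> of_int (2 * u)" using u[OF k] by (simp only: of_int_le_iff)
      finally show ?thesis by simp
    qed
    ultimately show "y \<in> slab (of_int u / m)" using m by (simp add: slab_def field_simps)
  qed
  have "real (card K) * (1 / m) ^ CARD('d) = (\<Sum>k\<in>K. measure lborel (Q k))" by (simp add: volQ)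
  also have "\<dots> = measure lborel (\<Union>k\<in>K. Q k)"
    using emeasure_lborel_box_finite by (intro measure_finite_Union[symmetric] finK disj) (auto simp: Q_def less_top)
  also have "\<dots> \<le> measure lborel (slab (of_int u / m) :: (real ^ 'd) set)"
  proof (rule measure_mono_fmeasurable[OF sub])
    show "(\<Union>k\<in>K. Q k) \<in> sets lborel" using finK by (auto simp: Q_def)
    have "slab (of_int u / m) \<subseteq> (cbox 0 1 :: (real ^ 'd) set)" by (auto simp: slab_eq)
    then show "(slab (of_int u / m) :: (real ^ 'd) set) \<in> fmeasurable lborel"
      by (rule fmeasurableI2[rotated]) (auto simp: fmeasurable_cbox)
  qed
  finally show ?thesis using m unfolding slab_vol_def m_def[symmetric] by (simp add: power_divide field_simps)
qed

text \<open>Cubes at the last \<open>CARD('d) - 1\<close> levels may cross the upper face; those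
  levels are bounded by \<open>level_count_le\<close> and form the error term.\<close>

lemma slab_count_le:
  fixes u :: int
  assumes "0 \<le> u"
  shows "(\<Sum>k\<in>{u..2 * u - 1}. level_count n CARD('d::finite) k)
    \<le> real (Suc n) ^ CARD('d) * slab_vol TYPE('d) (of_int u / real (Suc n)) + real CARD('d) * real (Suc n) ^ (CARD('d) - 1)"
proof -
  let ?d = "int CARD('d)" and ?L = "level_count n CARD('d)"
  define K where "K = {k \<in> box_on (UNIV :: 'd set) n. int (sum k UNIV) \<in> {u..2 * u - ?d}}"
  have finK: "finite K" using finite_box_on[of "UNIV :: 'd set" n] by (simp add: K_def)
  have "(\<Sum>j\<in>{u..2 * u - ?d}. ?L j) = (\<Sum>j\<in>{u..2 * u - ?d}. \<Sum>k\<in>{k \<in> K. int (sum k UNIV) = j}. 1)"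
  proof (rule sum.cong[OF refl])
    fix j assume j: "j \<in> {u..2 * u - ?d}"
    then have "{k \<in> K. int (sum k UNIV) = j} = level UNIV n (nat j)"
      using assms by (auto simp: K_def level_def simp del: of_nat_sum)
    then show "?L j = (\<Sum>k\<in>{k \<in> K. int (sum k UNIV) = j}. 1)"
      using card_level[of "UNIV :: 'd set" n "nat j"] j assms by simp
  qed
  also have "\<dots> = (\<Sum>k\<in>K. 1)" by (rule sum.group) (use finK in \<open>auto simp: K_def simp del: of_nat_sum\<close>)
  also have "\<dots> = real (card K)" by simp
  also have "\<dots> \<le> real (Suc n) ^ CARD('d) * slab_vol TYPE('d) (of_int u / real (Suc n))"
    by (rule card_lattice_slab_le) (auto simp: K_def simp del: of_nat_sum)
  finally have main: "(\<Sum>j\<in>{u..2 * u - ?d}. ?L j) \<le> real (Suc n) ^ CARD('d) * slab_vol TYPE('d) (of_int u / real (Suc n))" .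
  have d: "CARD('d) = Suc (CARD('d) - 1)" by simp
  have "?L j \<le> real (Suc n) ^ (CARD('d) - 1)" for j
    using level_count_le[of n "CARD('d) - 1" j] by (simp del: level_count.simps)
  then have "(\<Sum>j\<in>{2 * u - ?d<..2 * u - 1}. ?L j) \<le> real (card {2 * u - ?d<..2 * u - 1}) * real (Suc n) ^ (CARD('d) - 1)"
    by (intro sum_bounded_above)
  also have "\<dots> \<le> real CARD('d) * real (Suc n) ^ (CARD('d) - 1)"
    by (intro mult_right_mono) auto
  finally have rest: "(\<Sum>j\<in>{2 * u - ?d<..2 * u - 1}. ?L j) \<le> real CARD('d) * real (Suc n) ^ (CARD('d) - 1)" .
  have "(\<Sum>k\<in>{u..2 * u - 1}. ?L k) \<le> (\<Sum>k\<in>{u..2 * u - ?d} \<union> {2 * u - ?d<..2 * u - 1}. ?L k)"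
    using d by (intro sum_mono2 level_count_nonneg) auto
  also have "\<dots> = (\<Sum>k\<in>{u..2 * u - ?d}. ?L k) + (\<Sum>k\<in>{2 * u - ?d<..2 * u - 1}. ?L k)"
    by (rule sum.union_disjoint) auto
  finally show ?thesis using main rest by linarith
qed

section \<open>All dimensions together\<close>

lemma eventually_card_sum_free_le_UNIV:
  "\<forall>\<^sub>F n in sequentially. \<exists>u. 0 \<le> u \<and> u \<le> int (n * CARD('d::finite)) \<and>
    (\<forall>S \<subseteq> box_on (UNIV :: 'd set) n. (\<forall>x\<in>S. \<forall>y\<in>S. (\<lambda>i. x i + y i) \<notin> S) \<longrightarrow>
      real (card S) \<le> (\<Sum>k\<in>{u..2 * u - 1}. level_count n CARD('d) k) + 8 * real (Suc n) ^ (CARD('d) - 1))"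
proof -
  fix i :: 'd
  define J where "J = UNIV - {i}"
  have J: "finite J" "i \<notin> J" "insert i J = UNIV" by (auto simp: J_def)
  then have card: "CARD('d) = Suc (card J)" by (metis card_insert_disjoint)
  consider "card J = 0" | "card J = 1" | "card J \<ge> 2" by linarith
  then show ?thesis
  proof cases
    case 1
    then have i: "UNIV = {i}" and d: "CARD('d) = Suc 0" using J card by auto
    show ?thesis using eventually_ge_at_top[of 1]
    proof eventually_elim
      case (elim n)
      show ?case
      proof (intro allI exI conjI impI)
        fix S assume "S \<subseteq> box_on (UNIV :: 'd set) n" "\<forall>x\<in>S. \<forall>y\<in>S. (\<lambda>i. x i + y i) \<notin> S"
        then show "real (card S) \<le> (\<Sum>k\<in>{int n div 2 + 1..2 * (int n div 2 + 1) - 1}. level_count n CARD('d) k) + 8 * real (Suc n) ^ (CARD('d) - 1)"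
          using card_sum_free_le_dim_1[of S i n] by (simp add: d i del: level_count.simps)
      qed (use elim in \<open>auto simp: d\<close>)
    qed
  next
    case 2
    then obtain j where "J = {j}" using card_1_singletonE by blast
    then have ij: "i \<noteq> j" "UNIV = {i, j}" and d: "CARD('d) = Suc (Suc 0)" using J card 2 by auto
    show ?thesis using eventually_ge_at_top[of 1]
    proof eventually_elim
      case (elim n)
      show ?case
      proof (intro allI exI conjI impI)
        fix S assume "S \<subseteq> box_on (UNIV :: 'd set) n" "\<forall>x\<in>S. \<forall>y\<in>S. (\<lambda>i. x i + y i) \<notin> S"
        then show "real (card S) \<le> (\<Sum>k\<in>{(4 * int n + 5) div 5..2 * ((4 * int n + 5) div 5) - 1}. level_count n CARD('d) k) + 8 * real (Suc n) ^ (CARD('d) - 1)"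
          using card_sum_free_le_dim_2[of i j S n] elim ij by (simp add: d del: level_count.simps)
      qed (use elim in \<open>auto simp: d\<close>)
    qed
  next
    case 3
    show ?thesis using eventually_card_sum_free_le[OF J(1,2) 3] by (simp add: J card)
  qed
qed

lemma power_Suc_le: "1 \<le> n \<Longrightarrow> real (Suc n) ^ Suc d \<le> real n ^ Suc d + real (Suc d) * 2 ^ d * real n ^ d"
proof (induction d)
  case (Suc d)
  have "real (Suc n) ^ Suc d \<le> (2 * real n) ^ Suc d" using Suc.prems by (intro power_mono) auto
  then have "real (Suc n) ^ Suc (Suc d) \<le> real n * real (Suc n) ^ Suc d + 2 ^ Suc d * real n ^ Suc d"
    by (simp add: power_mult_distrib algebra_simps)
  also have "\<dots> \<le> real n * (real n ^ Suc d + real (Suc d) * 2 ^ d * real n ^ d) + 2 ^ Suc d * real n ^ Suc d"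
    using Suc by (intro add_right_mono mult_left_mono) auto
  also have "\<dots> \<le> real n ^ Suc (Suc d) + real (Suc (Suc d)) * 2 ^ Suc d * real n ^ Suc d"
    by (simp add: algebra_simps)
  finally show ?case .
qed simp

lemma card_sum_free_cube_le:
  "\<forall>\<^sub>F n in sequentially. \<forall>S \<subseteq> box_on (UNIV :: 'd::finite set) n. (\<forall>x\<in>S. \<forall>y\<in>S. (\<lambda>i. x i + y i) \<notin> S) \<longrightarrow>
    real (card S) \<le> c_star TYPE('d) * real (Suc n) ^ CARD('d) + (real CARD('d) + 8) * real (Suc n) ^ (CARD('d) - 1)"
  using eventually_card_sum_free_le_UNIV[where 'd = 'd]
proof eventually_elim
  case (elim n)
  then obtain u where u: "0 \<le> u" "u \<le> int (n * CARD('d))"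
    and S: "\<And>S. S \<subseteq> box_on (UNIV :: 'd set) n \<Longrightarrow> (\<forall>x\<in>S. \<forall>y\<in>S. (\<lambda>i. x i + y i) \<notin> S) \<Longrightarrow>
      real (card S) \<le> (\<Sum>k\<in>{u..2 * u - 1}. level_count n CARD('d) k) + 8 * real (Suc n) ^ (CARD('d) - 1)"
    by blast
  have "real_of_int u \<le> of_int (int (n * CARD('d)))" using u(2) by (simp only: of_int_le_iff)
  also have "\<dots> \<le> real CARD('d) * real (Suc n)" by simp
  finally have "slab_vol TYPE('d) (of_int u / real (Suc n)) \<le> c_star TYPE('d)"
    using u(1) by (intro slab_vol_le_c_star) (auto simp: pos_divide_le_eq simp del: of_nat_Suc)
  then have vol: "real (Suc n) ^ CARD('d) * slab_vol TYPE('d) (of_int u / real (Suc n)) \<le> real (Suc n) ^ CARD('d) * c_star TYPE('d)"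
    by (intro mult_left_mono) auto
  show ?case
  proof (intro allI impI)
    fix S assume "S \<subseteq> box_on (UNIV :: 'd set) n" "\<forall>x\<in>S. \<forall>y\<in>S. (\<lambda>i. x i + y i) \<notin> S"
    note S[OF this]
    also note slab_count_le[OF u(1), of n, where 'd = 'd]
    finally show "real (card S) \<le> c_star TYPE('d) * real (Suc n) ^ CARD('d) + (real CARD('d) + 8) * real (Suc n) ^ (CARD('d) - 1)"
      using vol by (simp only: distrib_right mult.commute[of "c_star TYPE('d)"]) linarith
  qed
qed

theorem theorem1p1:
  shows "\<exists>C::real. \<forall>n::nat. n \<ge> 1 \<longrightarrow>
    (\<forall>S :: (int ^ 'd) set. S \<subseteq> {x. \<forall>i. x $ i \<in> {0..int n}} \<and> sum_free S \<longrightarrow>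
      real (card S) \<le> c_star TYPE('d) * real n ^ CARD('d) + C * real n ^ (CARD('d) - 1))"
proof -
  let ?c = "c_star TYPE('d)" and ?d = "CARD('d)"
  define D where "D = ?d - 1"
  have d: "?d = Suc D" by (simp add: D_def)
  have "\<exists>n0. \<forall>n\<ge>n0. \<forall>S \<subseteq> box_on (UNIV :: 'd set) n. (\<forall>x\<in>S. \<forall>y\<in>S. (\<lambda>i. x i + y i) \<notin> S) \<longrightarrow>
      real (card S) \<le> ?c * real (Suc n) ^ Suc D + (real ?d + 8) * real (Suc n) ^ D"
    using card_sum_free_cube_le[where 'd = 'd] unfolding eventually_sequentially D_def[symmetric] d[symmetric] .
  then obtain n0 where n0: "\<forall>n\<ge>n0. \<forall>S \<subseteq> box_on (UNIV :: 'd set) n. (\<forall>x\<in>S. \<forall>y\<in>S. (\<lambda>i. x i + y i) \<notin> S) \<longrightarrow>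
      real (card S) \<le> ?c * real (Suc n) ^ Suc D + (real ?d + 8) * real (Suc n) ^ D" ..
  \<comment> \<open>The summands pay for expanding \<open>(n + 1) ^ d\<close>, for the error term
    with \<open>n + 1 \<le> 2 * n\<close>, and for all \<open>n < n0\<close>, where \<open>S\<close>
    has at most \<open>(n0 + 1) ^ d\<close> elements.\<close>
  define C where "C = ?c * (real ?d * 2 ^ D) + (real ?d + 8) * 2 ^ D + real (Suc n0) ^ Suc D"
  have "real (card S) \<le> ?c * real n ^ Suc D + C * real n ^ D"
    if n: "n \<ge> 1" and S: "S \<subseteq> {x. \<forall>i. x $ i \<in> {0..int n}}" "sum_free S" for n and S :: "(int ^ 'd) set"
  proof -
    define \<phi> where "\<phi> x = (\<lambda>i. nat (x $ i))" for x :: "int ^ 'd"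
    have S0: "0 \<le> x $ i" "x $ i \<le> int n" if "x \<in> S" for x i using S(1) that by auto
    have inj: "inj_on \<phi> S"
    proof (rule inj_onI)
      fix x y assume "x \<in> S" "y \<in> S" "\<phi> x = \<phi> y"
      then have "nat (x $ i) = nat (y $ i)" for i by (metis \<phi>_def)
      then show "x = y" using S0 \<open>x \<in> S\<close> \<open>y \<in> S\<close> by (simp add: vec_eq_iff eq_nat_nat_iff)
    qed
    then have card: "card (\<phi> ` S) = card S" by (rule card_image)
    have box: "\<phi> ` S \<subseteq> box_on UNIV n" using S0 by (auto simp: \<phi>_def box_on_def nat_le_iff)
    have "(\<lambda>i. \<phi> x i + \<phi> y i) \<noteq> \<phi> z" if "x \<in> S" "y \<in> S" "z \<in> S" for x y z
    proof
      assume "(\<lambda>i. \<phi> x i + \<phi> y i) = \<phi> z"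
      then have "nat (x $ i) + nat (y $ i) = nat (z $ i)" for i by (metis \<phi>_def)
      then have "nat (x $ i + y $ i) = nat (z $ i)" for i using S0 that by (simp add: nat_add_distrib)
      then have "x $ i + y $ i = z $ i" for i
        using S0(1)[OF that(1), of i] S0(1)[OF that(2), of i] S0(1)[OF that(3), of i] by (metis add_nonneg_nonneg nat_eq_iff2 nat_0_le)
      then have "x + y = z" by (simp add: vec_eq_iff)
      then show False using S(2) that unfolding sum_free_def by blast
    qed
    then have sf: "\<forall>x\<in>\<phi> ` S. \<forall>y\<in>\<phi> ` S. (\<lambda>i. x i + y i) \<notin> \<phi> ` S" by blast
    have c0: "0 \<le> ?c" by (rule c_star_nonneg)
    have nD: "1 \<le> real n ^ D" using n by simp
    show ?thesis
    proof (cases "n0 \<le> n")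
      case True
      have p: "real (Suc n) ^ D \<le> 2 ^ D * real n ^ D"
        unfolding power_mult_distrib[symmetric] using n by (intro power_mono) auto
      have "real (card S) \<le> ?c * real (Suc n) ^ Suc D + (real ?d + 8) * real (Suc n) ^ D"
        using n0[THEN spec, THEN mp, OF True, THEN spec, THEN mp, OF box, THEN mp, OF sf] by (simp only: card)
      also have "\<dots> \<le> ?c * (real n ^ Suc D + real ?d * 2 ^ D * real n ^ D) + (real ?d + 8) * (2 ^ D * real n ^ D)"
        using power_Suc_le[OF n, of D] p c0 unfolding d by (intro add_mono mult_left_mono) auto
      also have "\<dots> = ?c * real n ^ Suc D + (C - real (Suc n0) ^ Suc D) * real n ^ D"
        by (simp add: C_def algebra_simps)
      also have "\<dots> \<le> ?c * real n ^ Suc D + C * real n ^ D"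
        using nD by (intro add_left_mono mult_right_mono) auto
      finally show ?thesis .
    next
      case False
      have "card S \<le> card (box_on (UNIV :: 'd set) n)"
        unfolding card[symmetric] by (intro card_mono finite_box_on box) simp
      also have "\<dots> = Suc n ^ ?d"
      proof -
        have "box_on (UNIV :: 'd set) n = (UNIV :: 'd set) \<rightarrow>\<^sub>E {..n}" by (auto simp: box_on_def)
        then show ?thesis by (simp add: card_PiE)
      qed
      also have "\<dots> \<le> Suc n0 ^ ?d" using False by (intro power_mono) auto
      finally have "real (card S) \<le> real (Suc n0 ^ ?d)" by (simp only: of_nat_le_iff)
      also have "\<dots> = real (Suc n0) ^ Suc D" by (simp only: d of_nat_power)
      also have "\<dots> \<le> C" unfolding C_def using c0 by (intro le_add_same_cancel2[THEN iffD2] add_nonneg_nonneg mult_nonneg_nonneg) auto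
      also have "\<dots> \<le> C * real n ^ D"
      proof -
        have "0 \<le> C" unfolding C_def using c0 by (intro add_nonneg_nonneg mult_nonneg_nonneg) auto
        then show ?thesis using mult_left_mono[OF nD] by simp
      qed
      also have "\<dots> \<le> ?c * real n ^ Suc D + C * real n ^ D" using c0 by simp
      finally show ?thesis .
    qed
  qed
  then show ?thesis unfolding d diff_Suc_1 by blast
qed

end
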